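(* Let $n\geq 3$, $M\geq 1$ an integer, $\kappa>0$, and $a_1,\dots,a_n>0$. The solution of the equation \[ -(\Delta+\kappa^2)u({\mathbf x})=\prod_{j=1}^n \eta_{2M}(a_j x_j),\qquad {\mathbf x}=(x_1,\dots,x_n)\in\mathbb R^n, \] can be expressed by the one-dimensional integral \[ u({\mathbf x})=i\, \pi^{-n/2} \int_0^\infty e^{i\kappa^2 t} \prod_{j=1}^n \mathcal P_M(a_j x_j,4i a_j^2 t)\, e^{-(a_j x_j)^2/(1+4it a_j^2)}\,dt, \] where \[ \mathcal P_M(x,t)=\sum_{s=0}^{M-1} \frac{(-1)^s}{s!\, 4^s } \frac{1}{(1+ t)^{s+1/2}} H_{2s}\left(\frac{ x}{\sqrt{1+ t}}\right). \]
   Context: $H_k$ denotes the Hermite polynomial $H_k(x)=(-1)^k e^{x^2}\left(\frac{d}{dx}\right)^k e^{-x^2}$. The one-dimensional basis function is \[ \eta_{2M}(x)=\frac{(-1)^{M-1}}{2^{2M-1}\sqrt{\pi}\,(M-1)!}\,\frac{H_{2M-1}(x)\, e^{-x^2}}{x}. \] The equation $-(\Delta+\kappa^2)u=f$ is the Helmholtz equation whose (radiating) solution is the diffraction potential $u({\mathbf x})=\int_{\mathbb R^n}\mathcal E_\kappa({\mathbf x}-{\mathbf y})f({\mathbf y})\,d{\mathbf y}$ with $\mathcal E_\kappa({\mathbf x})=\frac{i}{4}\left(\frac{\kappa}{2\pi|{\mathbf x}|}\right)^{n/2-1}H^{(1)}_{n/2-1}(\kappa|{\mathbf x}|)$, $H^{(1)}_\nu$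 the Hankel function of the first kind, satisfying the Sommerfeld radiation condition $\lim_{|{\mathbf x}|\to\infty}|{\mathbf x}|^{(n-1)/2}\big(\langle {\mathbf x}/|{\mathbf x}|,\nabla u\rangle - i\kappa u\big)=0$. *)

theory Defs
  imports "HOL-Analysis.Analysis" "HOL-Computational_Algebra.Polynomial"
begin

definition hermite_rodrigues :: "nat \<Rightarrow> real \<Rightarrow> real" where
  "hermite_rodrigues k x = (-1)^k * exp (x^2) * (deriv ^^ k) (\<lambda>y. exp (-(y^2))) x"

definition hermite_poly :: "nat \<Rightarrow> real poly" where
  "hermite_poly k = (THE p. \<forall>x. poly p x = hermite_rodrigues k x)"

definition hermite_H :: "nat \<Rightarrow> complex \<Rightarrow> complex" where
  "hermite_H k z = poly (map_poly complex_of_real (hermite_poly k)) z"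

definition eta :: "nat \<Rightarrow> real \<Rightarrow> real" where
  "eta M x = (-1)^(M-1) / (2^(2*M-1) * sqrt pi * fact (M-1))
              * hermite_rodrigues (2*M-1) x * exp (-(x^2)) / x"

definition bessel_J :: "real \<Rightarrow> real \<Rightarrow> real" where
  "bessel_J \<nu> x = (\<Sum>k. (-1)^k / fact k * rGamma (real k + \<nu> + 1) * (x/2) powr (2 * real k + \<nu>))"

definition bessel_Y :: "real \<Rightarrow> real \<Rightarrow> real" where
  "bessel_Y \<nu> x =
     (if \<nu> \<notin> \<int> then (bessel_J \<nu> x * cos (\<nu> * pi) - bessel_J (-\<nu>) x) / sin (\<nu> * pi)
      else Lim (at \<nu>) (\<lambda>\<mu>. (bessel_J \<mu> x * cos (\<mu> * pi) - bessel_J (-\<mu>) x) / sin (\<mu> * pi)))"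

definition hankel1 :: "real \<Rightarrow> real \<Rightarrow> complex" where
  "hankel1 \<nu> x = Complex (bessel_J \<nu> x) (bessel_Y \<nu> x)"

text \<open>E_kappa(x) = i/4 (kappa/(2 pi |x|))^{n/2-1} H^(1)_{n/2-1}(kappa |x|), here as a function
  of the space dimension n and r = |x| (the value at r = 0 is irrelevant, a null set).\<close>

definition fund_sol :: "nat \<Rightarrow> real \<Rightarrow> real \<Rightarrow> complex" where
  "fund_sol n \<kappa> r = \<i> / 4 * complex_of_real ((\<kappa> / (2 * pi * r)) powr (real n / 2 - 1))
                      * hankel1 (real n / 2 - 1) (\<kappa> * r)"

definition diffraction_potential ::
    "real \<Rightarrow> (real^'n \<Rightarrow> complex) \<Rightarrow> real^'n \<Rightarrow> complex" where
  "diffraction_potential \<kappa> f x =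
     (\<integral>y. fund_sol CARD('n) \<kappa> (norm (x - y)) * f y \<partial>lborel)"

definition PM :: "nat \<Rightarrow> real \<Rightarrow> complex \<Rightarrow> complex" where
  "PM M x \<tau> = (\<Sum>s<M. (-1)^s / (of_nat (fact s) * 4^s)
                 * (1 / ((1 + \<tau>) powr (of_nat s + 1/2)))
                 * hermite_H (2 * s) (complex_of_real x / csqrt (1 + \<tau>)))"

end

theory Submission
  imports Defs "HOL-Probability.Probability" "HOL-Complex_Analysis.Complex_Analysis"
    "HOL-Real_Asymp.Real_Asymp"
begin

text \<open>
  In the variable \<open>\<sigma> = i t\<close> the right-hand side is an integral of
  \<open>e\<^bsup>\<kappa>\<^sup>2\<sigma>\<^esup>\<close> times the heat extension of \<open>f\<close> along the positive imaginary axis.  The product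
  \<open>\<Prod>\<P>\<^sub>M \<cdot> exp\<close> is this extension because the polynomial factor of \<open>\<eta>\<^bsub>2M\<^esub>\<close> is a sum of even Hermite
  polynomials, and integration by parts against the complex heat kernel reproduces the three-term
  recurrence of the Hermite polynomials.  The kernel \<open>\<E>\<^sub>\<kappa>\<close> is the integral of
  \<open>e\<^bsup>\<kappa>\<^sup>2\<sigma>\<^esup>(4\<pi>\<sigma>)\<^bsup>-n/2\<^esup> exp (-r\<^sup>2/4\<sigma>)\<close> along the path that runs from \<open>0\<close> to \<open>1\<close> and
  then vertically upwards.  On that path everything converges absolutely, so Fubini applies, and
  Cauchy's theorem moves the path to the imaginary axis, where the heat extension of \<open>f\<close>, unlike
  the kernel, has no singularity at \<open>0\<close>.

  For the kernel formula with non-integral index, \<open>e\<^bsup>\<kappa>\<^sup>2\<sigma>\<^esup>\<close> is expanded on \<open>[0,1]\<close> and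
  \<open>exp (-r\<^sup>2/4\<sigma>)\<close> on the vertical ray.  Both expansions give incomplete Gamma functions; their
  elementary parts cancel and the complete Gamma functions form the two Bessel series.  Integral
  index follows by continuity, which matches the definition of \<open>Y\<^sub>\<nu>\<close> as a limit.
\<close>

section \<open>Parameter integrals and the complex heat kernel\<close>

text \<open>The path is dictated by the factors of the kernel. On the imaginary axis near 0 the
  weight has modulus of order |\<sigma>|^(-n/2) and exp (-r^2/4\<sigma>) merely oscillates, so
  absolute convergence fails; on [0,1] the Gaussian tames the weight. Further along the real axis
  exp (\<kappa>^2 \<sigma>) would grow, while on 1 + i[0,\<infinity>) its modulus is the constant
  exp (\<kappa>^2), and |\<sigma>|^(-n/2) is integrable because n \<ge> 3. Turning upwards selects
  the outgoing wave: it produces the phase exp (-i pi \<mu>) in J_(-\<mu>) - exp (-i pi \<mu>)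
  J_\<mu>, which is a multiple of H^(1)_\<mu>. The corner 1 makes the two elementary parts series in
  the same denominators, so that they can cancel. Gaussian and Gamma integrals with a complex
  parameter are computed for a real one and continued by the identity theorem, which also fixes the
  branches of the roots.\<close>

lemma holomorphic_lebesgue_integral:
  fixes f :: "complex \<Rightarrow> 'a \<Rightarrow> complex"
  assumes S: "open S"
    and hol: "\<And>y. y \<in> space M \<Longrightarrow> (\<lambda>z. f z y) holomorphic_on S"
    and meas: "\<And>z. z \<in> S \<Longrightarrow> f z \<in> borel_measurable M"
    and dom: "\<And>z. z \<in> S \<Longrightarrow> \<exists>r>0. \<exists>w. cball z r \<subseteq> S \<and> integrable M w \<and>
                 (\<forall>u\<in>cball z r. \<forall>y\<in>space M. norm (f u y) \<le> w y)"
  shows "(\<lambda>z. \<integral>y. f z y \<partial>M) holomorphic_on S"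
proof -
  have int: "integrable M (f z)" if zS: "z \<in> S" for z
  proof -
    obtain r w where "r > 0" "integrable M w" "\<And>u y. u \<in> cball z r \<Longrightarrow> y \<in> space M \<Longrightarrow> norm (f u y) \<le> w y"
      using dom[OF zS] by blast
    then show ?thesis
      by (intro Bochner_Integration.integrable_bound[OF \<open>integrable M w\<close> meas[OF zS]])
         (auto intro!: AE_I2 order_trans[OF _ abs_ge_self])
  qed
  have "(\<lambda>z. \<integral>y. f z y \<partial>M) field_differentiable at z" if z: "z \<in> S" for z
  proof -
    obtain r w where r: "r > 0" "cball z r \<subseteq> S" and w: "integrable M w"
      and b: "\<And>u y. u \<in> cball z r \<Longrightarrow> y \<in> space M \<Longrightarrow> norm (f u y) \<le> w y"
      using dom[OF z] by blast
    let ?D = "\<lambda>y. deriv (\<lambda>z. f z y) z"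
    have deriv: "((\<lambda>z. f z y) has_field_derivative deriv (\<lambda>z. f z y) u) (at u)" if "y \<in> space M" "u \<in> S" for y u
      using hol[OF that(1)] S that(2) holomorphic_derivI by blast
    \<comment> \<open>Cauchy's inequality on circles of radius \<open>r/2\<close> turns the local
      bound \<open>w\<close> on the integrand into the bound \<open>w y / (r/2)\<close> on its
      derivative. By the mean value inequality the difference quotients obey the same bound, and
      dominated convergence applies.\<close>
    have db: "norm (deriv (\<lambda>z. f z y) u) \<le> w y / (r/2)" if y: "y \<in> space M" and u: "u \<in> ball z (r/2)" for y u
    proof -
      have sub: "cball u (r/2) \<subseteq> cball z r"
      proof
        fix v assume "v \<in> cball u (r/2)"
        then show "v \<in> cball z r" using u dist_triangle[of z v u] by simp
      qed
      have "norm ((deriv ^^ 1) (\<lambda>z. f z y) u) \<le> fact 1 * w y / (r/2)^1"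
      proof (rule Cauchy_inequality)
        show "(\<lambda>z. f z y) holomorphic_on ball u (r/2)"
          using hol[OF y] by (rule holomorphic_on_subset) (use sub r in force)
        show "continuous_on (cball u (r/2)) (\<lambda>z. f z y)"
          using holomorphic_on_imp_continuous_on[OF hol[OF y]]
          by (rule continuous_on_subset) (use sub r in force)
        show "norm (f x y) \<le> w y" if "cmod (u - x) = r/2" for x
          using that sub by (intro b y) (auto simp: dist_norm)
      qed (use r in simp)
      then show ?thesis by simp
    qed
    have "((\<lambda>z. \<integral>y. f z y \<partial>M) has_field_derivative (\<integral>y. ?D y \<partial>M)) (at z within ball z (r/2))"
      unfolding has_field_derivative_iff tendsto_at_iff_sequentially
    proof (intro allI impI)
      fix X :: "nat \<Rightarrow> complex"
      assume X: "\<forall>i. X i \<in> ball z (r/2) - {z}" "X \<longlonglongrightarrow> z"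
      have XS: "X i \<in> S" for i
        using spec[OF X(1), of i] r by (intro subsetD[OF r(2)]) auto
      let ?q = "\<lambda>i y. (f (X i) y - f z y) / (X i - z)"
      have lim: "(\<lambda>i. ?q i y) \<longlonglongrightarrow> ?D y" if "y \<in> space M" for y
        using deriv[OF that z, unfolded has_field_derivative_iff tendsto_at_iff_sequentially, rule_format, of X] X
        by (simp add: o_def)
      have qm: "?q i \<in> borel_measurable M" for i
        using meas[OF XS] meas[OF z] by measurable
      have "(\<lambda>i. \<integral>y. ?q i y \<partial>M) \<longlonglongrightarrow> (\<integral>y. ?D y \<partial>M)"
      proof (rule integral_dominated_convergence)
        show "integrable M (\<lambda>y. w y / (r/2))" using w by simp
        show "?D \<in> borel_measurable M"
          by (rule borel_measurable_LIMSEQ_metric[OF qm lim])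
        show "AE y in M. norm (?q i y) \<le> w y / (r/2)" for i
        proof (rule AE_I2)
          fix y assume y: "y \<in> space M"
          have "norm (f (X i) y - f z y) \<le> w y / (r/2) * norm (X i - z)"
          proof (rule field_differentiable_bound[of "ball z (r/2)" _ "deriv (\<lambda>z. f z y)"])
            show "((\<lambda>a. f a y) has_field_derivative deriv (\<lambda>z. f z y) u) (at u within ball z (r / 2))"
              if "u \<in> ball z (r/2)" for u
              by (rule has_field_derivative_at_within[OF deriv[OF y]], rule subsetD[OF r(2)])
                 (use that r(1) in auto)
            show "norm (deriv (\<lambda>z. f z y) u) \<le> w y / (r/2)" if "u \<in> ball z (r/2)" for u
              by (rule db[OF y that])
            show "X i \<in> ball z (r/2)" using spec[OF X(1), of i] by simp
          qed (use r in simp_all)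
          moreover have "X i - z \<noteq> 0" using spec[OF X(1), of i] by simp
          ultimately show "norm (?q i y) \<le> w y / (r/2)"
            by (simp add: norm_divide divide_le_eq)
        qed
      qed (use qm lim in auto)
      then show "((\<lambda>y. (integral\<^sup>L M (f y) - integral\<^sup>L M (f z)) / (y - z)) \<circ> X) \<longlonglongrightarrow> (\<integral>y. ?D y \<partial>M)"
        using int[OF XS] int[OF z] by (simp add: o_def)
    qed
    then show ?thesis
      using r by (auto simp: field_differentiable_def at_within_open[of z "ball z (r/2)"])
  qed
  then show ?thesis
    unfolding holomorphic_on_def using field_differentiable_at_within by blast
qed

text \<open>Identity theorem, with 1 as an accumulation point of the positive reals.\<close>

lemma holomorphic_eq_right_halfplane:
  assumes "f holomorphic_on {z. Re z > 0}" "g holomorphic_on {z. Re z > 0}"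
    and eq: "\<And>x::real. x > 0 \<Longrightarrow> f (of_real x) = g (of_real x)" and z: "Re z > 0"
  shows "f z = g z"
proof -
  let ?S = "{z. Re z > 0}" and ?U = "complex_of_real ` {0<..}"
  have lp: "1 islimpt ?U"
    unfolding islimpt_approachable
  proof (intro allI impI)
    fix e :: real assume "e > 0"
    have "complex_of_real (1 + e/2) \<in> ?U" using \<open>e > 0\<close> by (intro imageI) simp
    moreover have "complex_of_real (1 + e/2) \<noteq> 1 \<and> dist (complex_of_real (1 + e/2)) 1 < e"
      using \<open>e > 0\<close> by (simp add: dist_norm)
    ultimately show "\<exists>x'\<in>?U. x' \<noteq> 1 \<and> dist x' 1 < e" by blast
  qed
  have "f z - g z = 0"
    by (rule analytic_continuation[where S="?S" and U="?U" and \<xi>=1])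
       (use assms lp in \<open>auto intro!: holomorphic_intros open_halfspace_Re_gt convex_connected convex_halfspace_Re_gt\<close>)
  then show ?thesis by simp
qed

text \<open>The disc of radius \<open>Re z / 2\<close> serves in the domination arguments on the
  right half-plane: on it the real part stays bounded away from 0.\<close>

lemma Re_ge_half_of_cball:
  assumes "u \<in> cball z (Re z / 2)"
  shows "Re z / 2 \<le> Re u"
  using assms abs_Re_le_cmod[of "z - u"] by (simp add: dist_norm)

lemma set_lebesgue_integral_scale_nonneg:
  fixes h :: "real \<Rightarrow> 'b::{banach, second_countable_topology}"
  assumes "c > 0"
  shows "(LINT y:{0..}|lborel. h (c * y)) = (1/c) *\<^sub>R (LINT y:{0..}|lborel. h y)"
proof -
  have "(LINT y:{0..}|lborel. h y) = \<bar>c\<bar> *\<^sub>R (\<integral>y. indicator {0..} (0 + c * y) *\<^sub>R h (0 + c * y) \<partial>lborel)"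
    unfolding set_lebesgue_integral_def by (rule lborel_integral_real_affine) (use assms in simp)
  also have "(\<lambda>y. indicator {0..} (0 + c * y) *\<^sub>R h (0 + c * y)) = (\<lambda>y. indicator {0..} y *\<^sub>R h (c * y))"
    using assms by (auto simp: indicator_def zero_le_mult_iff)
  finally show ?thesis using assms by (simp add: set_lebesgue_integral_def)
qed

lemma set_integrable_exp_powr:
  fixes p a :: real
  assumes "p > -1" "a > 0"
  shows "set_integrable lborel {0..} (\<lambda>y. exp (- a * y) * y powr p)"
proof -
  have "(\<lambda>t. complex_of_real t powr (complex_of_real (p+1) - 1) / of_real (exp (a * t))) absolutely_integrable_on {0<..}"
    by (rule absolutely_integrable_Gamma_integral) (use assms in auto)
  then have "set_integrable lebesgue {0<..} (\<lambda>t. norm (complex_of_real t powr (complex_of_real (p+1) - 1) / of_real (exp (a * t))))"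
    by (rule set_integrable_norm)
  also have "?this \<longleftrightarrow> set_integrable lebesgue {0<..} (\<lambda>y. exp (- a * y) * y powr p)"
    by (intro set_integrable_cong) (auto simp: norm_divide norm_powr_real_powr exp_minus field_simps)
  also have "\<dots> \<longleftrightarrow> set_integrable lebesgue {0..} (\<lambda>y. exp (- a * y) * y powr p)"
    unfolding set_integrable_def
    by (intro integrable_cong_AE measurable_completion AE_I2) (measurable, auto simp: indicator_def)
  finally show ?thesis
    unfolding set_integrable_def by (subst (asm) integrable_completion) auto
qed

lemma LINT_exp_powr_real:
  fixes p a :: real
  assumes p: "p > -1" and a: "a > 0"
  shows "(LINT y:{0..}|lborel. exp (- a * y) * y powr p) = Gamma (p+1) * a powr (-(p+1))"
proof -
  have i1: "(LINT y:{0..}|lborel. exp (- 1 * y) * y powr p) = Gamma (p+1)"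
  proof -
    have "(LINT y:{0..}|lborel. exp (- 1 * y) * y powr p) = integral {0..} (\<lambda>y. exp (- 1 * y) * y powr p)"
      by (rule set_borel_integral_eq_integral(2)[OF set_integrable_exp_powr]) (use p in auto)
    also have "\<dots> = Gamma (p+1)"
      using integral_unique[OF Gamma_integral_real[of "p+1"]] p by (simp add: exp_minus field_simps)
    finally show ?thesis .
  qed
  have "(LINT y:{0..}|lborel. exp (- a * y) * y powr p)
      = (LINT y:{0..}|lborel. a powr (-p) *  (exp (- 1 * (a * y)) * (a * y) powr p))"
    by (intro set_lebesgue_integral_cong) (use a in \<open>auto simp: powr_mult powr_minus\<close>)
  also have "\<dots> = a powr (-p) * (1/a * Gamma (p+1))"
    using set_lebesgue_integral_scale_nonneg[OF a, of "\<lambda>y. exp (-1*y) * y powr p"] i1 by simp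
  also have "\<dots> = Gamma (p+1) * a powr (-(p+1))"
    using a by (simp add: powr_diff powr_minus powr_add field_simps)
  finally show ?thesis .
qed


text \<open>Both sides are holomorphic for \<open>Re z > 0\<close>, with the principal branch on the
  right, and agree for real \<open>z\<close>. Near \<open>z\<close> the integrand is dominated by
  the one with rate \<open>Re z / 2\<close>.\<close>

lemma LINT_exp_powr:
  fixes p :: real
  assumes p: "p \<ge> 0" and z: "Re z > 0"
  shows "set_integrable lborel {0..} (\<lambda>y. exp (- z * of_real y) * of_real (y powr p))"
    and "(LINT y:{0..}|lborel. exp (- z * of_real y) * of_real (y powr p))
           = of_real (Gamma (p+1)) * z powr of_real (- (p+1))"
proof -
  let ?f = "\<lambda>z y. indicator {0..} y *\<^sub>R (exp (- z * of_real y) * of_real (y powr p) :: complex)"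
  let ?w = "\<lambda>a y. indicator {0..} y *\<^sub>R (exp (- a * y) * y powr p)"
  have meas: "(\<lambda>y. ?f z y)
      \<in> borel_measurable lborel" for z
    by (intro borel_measurable_scaleR borel_measurable_times borel_measurable_continuous_onI) 
       (auto intro!: continuous_intros)
  have norm_le: "norm (?f z y)
      \<le> ?w a y" if "a \<le> Re z" for a y z
    using that by (auto simp: indicator_def norm_mult mult_right_mono)
  have dom: "integrable lborel (\<lambda>y. ?w a y)" if "a > 0" for a
    using set_integrable_exp_powr[of p a] p that unfolding set_integrable_def by simp
  show "set_integrable lborel {0..} (\<lambda>y. exp (- z * of_real y) * of_real (y powr p))"
    unfolding set_integrable_def
    by (rule Bochner_Integration.integrable_bound[OF dom[OF z] meas])
       (intro AE_I2, simp only: real_norm_def, rule order_trans[OF norm_le[OF order_refl] abs_ge_self])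
  show "(LINT y:{0..}|lborel. exp (- z * of_real y) * of_real (y powr p))
           = of_real (Gamma (p+1)) * z powr of_real (- (p+1))"
    unfolding set_lebesgue_integral_def
  proof (rule holomorphic_eq_right_halfplane[of _ "\<lambda>z. of_real (Gamma (p+1)) * z powr of_real (- (p+1))"])
    show "(\<lambda>z. \<integral>y. ?f z y \<partial>lborel)
            holomorphic_on {z. Re z > 0}"
    proof (rule holomorphic_lebesgue_integral)
      fix z :: complex assume "z \<in> {z. Re z > 0}"
      then have z: "Re z > 0" by simp
      have le: "norm (?f u y)
          \<le> ?w (Re z / 2) y" if "u \<in> cball z (Re z / 2)" for u y
        by (rule norm_le[OF Re_ge_half_of_cball[OF that]])
      show "\<exists>r>0. \<exists>w. cball z r \<subseteq> {z. Re z > 0} \<and> integrable lborel w \<and>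
              (\<forall>u\<in>cball z r. \<forall>y\<in>space lborel.
                norm (?f u y) \<le> w y)"
        by (rule exI[of _ "Re z / 2"], intro conjI exI[of _ "\<lambda>y. ?w (Re z / 2) y"])
           (use z le dom[of "Re z / 2"] in \<open>auto dest!: Re_ge_half_of_cball simp del: real_scaleR_def scaleR_conv_of_real\<close>)
    qed (use meas in \<open>auto intro!: open_halfspace_Re_gt holomorphic_intros\<close>)
    show "(\<lambda>z. of_real (Gamma (p+1)) * z powr of_real (- (p+1))) holomorphic_on {z. Re z > 0}"
      by (intro holomorphic_intros) (auto simp: complex_nonpos_Reals_iff)
    show "(\<integral>y. ?f (of_real a) y \<partial>lborel)
      = of_real (Gamma (p+1)) * of_real a powr of_real (- (p+1))" if a: "a > 0" for a
    proof -
      have "(\<integral>y. ?f (of_real a) y \<partial>lborel)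
        = (\<integral>y. complex_of_real (?w a y) \<partial>lborel)"
        by (intro Bochner_Integration.integral_cong) (auto simp: exp_of_real indicator_def simp flip: of_real_mult of_real_minus)
      also have "\<dots> = of_real (Gamma (p+1) * a powr (- (p+1)))"
        using LINT_exp_powr_real[of p a] p a unfolding set_lebesgue_integral_def integral_complex_of_real by simp
      also have "\<dots> = of_real (Gamma (p+1)) * of_real a powr of_real (- (p+1))"
        using powr_of_real[of a "- (p+1)"] a by (simp only: of_real_mult)
      finally show ?thesis .
    qed
  qed (use z in simp)
qed

section \<open>The heat kernel at complex time and its action on the Gaussian\<close>

definition heat_kernel :: "complex \<Rightarrow> real \<Rightarrow> complex" where
  "heat_kernel \<sigma> x = (4 * of_real pi * \<sigma>) powr (-1/2) * exp (- (complex_of_real x)\<^sup>2 / (4 * \<sigma>))"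

lemma Re_inverse_nonneg: "Re z \<ge> 0 \<Longrightarrow> Re (1 / z) \<ge> 0"
  by (simp add: Re_divide)

lemma heat_kernel_measurable [measurable]: "heat_kernel \<sigma> \<in> borel_measurable borel"
  unfolding heat_kernel_def by measurable

lemma four_pi_not_nonpos: "Re z > 0 \<Longrightarrow> 4 * complex_of_real pi * z \<notin> \<real>\<^sub>\<le>\<^sub>0"
proof
  assume *: "Re z > 0" "4 * complex_of_real pi * z \<in> \<real>\<^sub>\<le>\<^sub>0"
  have "pi * Re z > 0" using *(1) by simp
  moreover have "pi * Re z \<le> 0" using *(2) by (simp only: complex_nonpos_Reals_iff) simp
  ultimately show False by linarith
qed

lemma norm_exp_neg_sq_divide_le:
  assumes "Re z \<ge> 0"
  shows "norm (exp (- (complex_of_real x)\<^sup>2 / z)) \<le> 1"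
proof -
  have "Re (- (complex_of_real x)\<^sup>2 / z) = - (x\<^sup>2 * Re (1 / z))"
    by (simp add: Re_divide power2_eq_square)
  then show ?thesis using mult_nonneg_nonneg[OF _ Re_inverse_nonneg[OF assms], of "x\<^sup>2"] by simp
qed

lemma norm_heat_kernel_le:
  assumes "Re \<sigma> > 0"
  shows "norm (heat_kernel \<sigma> x) \<le> norm (4 * of_real pi * \<sigma>) powr (-1/2)"
proof -
  have "norm (exp (- (complex_of_real x)\<^sup>2 / (4 * \<sigma>))) \<le> 1"
    by (rule norm_exp_neg_sq_divide_le) (use assms in simp)
  then show ?thesis
    using mult_left_mono[of "norm (exp (- (complex_of_real x)\<^sup>2 / (4 * \<sigma>)))" 1 "norm ((4 * of_real pi * \<sigma>) powr (-1/2))"]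
    by (simp add: heat_kernel_def norm_mult norm_powr_real_powr')
qed

lemma integrable_gaussian: "integrable lborel (\<lambda>y::real. exp (- y\<^sup>2))"
proof -
  have "(\<lambda>y::real. exp (- y\<^sup>2)) = (\<lambda>y. sqrt pi * normal_density 0 (1 / sqrt 2) y)"
    by (auto simp: normal_density_def power_divide real_sqrt_mult)
  then show ?thesis by simp
qed

lemma heat_kernel_gaussian_real:
  fixes s x :: real
  assumes s: "s > 0"
  shows "(\<integral>y. heat_kernel (of_real s) (x - y) * complex_of_real (exp (- y\<^sup>2)) \<partial>lborel)
       = (1 + 4 * of_real s) powr (-1/2) * exp (- (complex_of_real x)\<^sup>2 / (1 + 4 * of_real s))"
proof -
  let ?l = "\<lambda>y. - (x - y)\<^sup>2 / (4 * s) + - y\<^sup>2"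
  \<comment> \<open>The product of the two Gaussians has inverse variance 1/(2s) + 2 = c/(2s) and
    mean x/c. Completing the square therefore leaves the normal density with standard deviation
    \<open>d\<close>, times c^(-1/2) exp (-x^2/c).\<close>
  define c where "c = 1 + 4 * s"
  define d where "d = sqrt (2 * s / c)"
  have c: "c > 0" and d: "d > 0" using s by (auto simp: c_def d_def)
  have d2: "d\<^sup>2 = 2 * s / c" using c s by (simp add: d_def)
  have eq: "heat_kernel (of_real s) (x - y) * complex_of_real (exp (- y\<^sup>2))
    = of_real (c powr (-1/2) * exp (- x\<^sup>2 / c) * normal_density (x / c) d y)" for y
  proof -
    have k: "heat_kernel (of_real s) (x - y) = of_real ((4 * pi * s) powr (-1/2) * exp (- (x - y)\<^sup>2 / (4 * s)))"
    proof -
      have "(4 * complex_of_real pi * of_real s) powr (-1/2) = of_real ((4 * pi * s) powr (-1/2))"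
        using powr_of_real[of "4 * pi * s" "-1/2"] s by simp
      then show ?thesis unfolding heat_kernel_def by (simp add: exp_of_real[symmetric])
    qed
    have "- (x - y)\<^sup>2 / (4 * s) + - y\<^sup>2 = - x\<^sup>2 / c + - (y - x / c)\<^sup>2 / (2 * d\<^sup>2)"
    proof -
      have "?l y * (4 * s * c) = (- x\<^sup>2 / c + - (y - x / c)\<^sup>2 / (2 * d\<^sup>2)) * (4 * s * c)"
      proof -
        have "(- x\<^sup>2 / c + - (y - x / c)\<^sup>2 / (2 * d\<^sup>2)) * (4 * s * c) = - x\<^sup>2 * (4 * s) - (y - x/c)\<^sup>2 * c\<^sup>2"
        proof -
          have *: "2 * d\<^sup>2 = 4 * s / c" by (simp add: d2)
          have "- (y - x / c)\<^sup>2 / (4 * s / c) * (4 * s * c) = - ((y - x/c)\<^sup>2 * c\<^sup>2)"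
            using c s by (simp add: power2_eq_square)
          then show ?thesis using c unfolding * by (simp add: algebra_simps)
        qed
        also have "(y - x/c)\<^sup>2 * c\<^sup>2 = (c * y - x)\<^sup>2"
          using c by (simp add: power_mult_distrib[symmetric] algebra_simps)
        also have "- x\<^sup>2 * (4 * s) - (c * y - x)\<^sup>2 = - (x - y)\<^sup>2 * c - y\<^sup>2 * (4 * s * c)"
          by (simp add: c_def power2_eq_square algebra_simps)
        also have "\<dots> = ?l y * (4 * s * c)"
          using s by (simp add: field_simps)
        finally show ?thesis by (rule sym)
      qed
      from mult_cancel_right[THEN iffD1, OF this] show ?thesis
      proof
        assume "4 * s * c = 0"
        then show ?thesis using c s by simp
      qed
    qed
    then have e: "exp (- (x - y)\<^sup>2 / (4 * s)) * exp (- y\<^sup>2) = exp (- x\<^sup>2 / c) * exp (- (y - x / c)\<^sup>2 / (2 * d\<^sup>2))"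
      by (simp only: exp_add[symmetric])
    have r: "(4 * pi * s) powr (-1/2) = c powr (-1/2) * (1 / sqrt (2 * pi * d\<^sup>2))"
    proof -
      have *: "w powr (-1/2) = 1 / sqrt w" if "w > 0" for w :: real
        using that by (simp add: powr_minus powr_half_sqrt field_simps)
      have "c * (2 * pi * d\<^sup>2) = 4 * pi * s" using c by (simp add: d2)
      then have "sqrt (4 * pi * s) = sqrt c * sqrt (2 * pi * d\<^sup>2)" by (metis real_sqrt_mult)
      then show ?thesis using s c *[of "4 * pi * s"] *[of c] by simp
    qed
    have "heat_kernel (of_real s) (x - y) * complex_of_real (exp (- y\<^sup>2)) 
       = of_real ((4 * pi * s) powr (-1/2) * (exp (- (x - y)\<^sup>2 / (4 * s)) * exp (- y\<^sup>2)))"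
      by (simp add: k)
    also have "\<dots> = of_real (c powr (-1/2) * exp (- x\<^sup>2 / c) * normal_density (x / c) d y)"
      unfolding e r normal_density_def by (simp add: mult_ac)
    finally show ?thesis .
  qed
  have "(\<integral>y. heat_kernel (of_real s) (x - y) * complex_of_real (exp (- y\<^sup>2)) \<partial>lborel)
     = of_real (c powr (-1/2) * exp (- x\<^sup>2 / c))"
    unfolding eq integral_complex_of_real using d by simp
  also have "\<dots> = (1 + 4 * of_real s) powr (-1/2) * exp (- (complex_of_real x)\<^sup>2 / (1 + 4 * of_real s))"
    using powr_of_real[of c "-1/2"] c by (simp add: c_def exp_of_real[symmetric])
  finally show ?thesis .
qed

lemma heat_kernel_gaussian:
  assumes \<sigma>: "Re \<sigma> > 0"
  shows "(\<integral>y. heat_kernel \<sigma> (x - y) * complex_of_real (exp (- y\<^sup>2)) \<partial>lborel)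
       = (1 + 4 * \<sigma>) powr (-1/2) * exp (- (of_real x)\<^sup>2 / (1 + 4 * \<sigma>))"
proof (rule holomorphic_eq_right_halfplane[where z=\<sigma> and g="\<lambda>\<sigma>. (1 + 4 * \<sigma>) powr (-1/2) * exp (- (of_real x)\<^sup>2 / (1 + 4 * \<sigma>))"])
  let ?f = "\<lambda>\<sigma> y. heat_kernel \<sigma> (x - y) * complex_of_real (exp (- y\<^sup>2))"
  let ?C = "\<lambda>z. (4 * pi * (Re z / 2)) powr (-1/2)"
  have nz: "1 + 4 * \<sigma> \<notin> \<real>\<^sub>\<le>\<^sub>0" "1 + 4 * \<sigma> \<noteq> 0" if "Re \<sigma> > 0" for \<sigma>
    using that by (auto simp: complex_nonpos_Reals_iff complex_eq_iff)
  show "(\<lambda>\<sigma>. (1 + 4 * \<sigma>) powr (-1/2) * exp (- (of_real x)\<^sup>2 / (1 + 4 * \<sigma>))) holomorphic_on {z. Re z > 0}"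
    by (intro holomorphic_intros) (use nz in auto)
  show "(\<lambda>\<sigma>. \<integral>y. ?f \<sigma> y \<partial>lborel) holomorphic_on {z. Re z > 0}"
  proof (rule holomorphic_lebesgue_integral)
    show "(\<lambda>\<sigma>. ?f \<sigma> y) holomorphic_on {z. Re z > 0}" for y
      unfolding heat_kernel_def 
      by (intro holomorphic_intros) (use four_pi_not_nonpos in auto)
    fix z :: complex assume "z \<in> {z. Re z > 0}"
    then have z: "Re z > 0" by simp
    have le: "norm (?f u y) \<le> ?C z * exp (- y\<^sup>2)"
      if "u \<in> cball z (Re z / 2)" for u y
    proof -
      have "norm (heat_kernel u (x - y)) \<le> norm (4 * complex_of_real pi * u) powr (-1/2)"
        using Re_ge_half_of_cball[OF that] z by (intro norm_heat_kernel_le) linarith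
      also have "\<dots> \<le> ?C z"
      proof (rule powr_mono2')
        have "Re z / 2 \<le> norm u" using Re_ge_half_of_cball[OF that] complex_Re_le_cmod[of u] by linarith
        then show "4 * pi * (Re z / 2) \<le> norm (4 * complex_of_real pi * u)" by (simp add: norm_mult)
      qed (use z in auto)
      finally show ?thesis by (simp add: norm_mult)
    qed
    show "\<exists>r>0. \<exists>w. cball z r \<subseteq> {z. Re z > 0} \<and> integrable lborel w \<and>
            (\<forall>u\<in>cball z r. \<forall>y\<in>space lborel. norm (?f u y) \<le> w y)"
      by (rule exI[of _ "Re z / 2"], intro conjI exI[of _ "\<lambda>y. ?C z * exp (- y\<^sup>2)"])
         (use z le integrable_gaussian in \<open>auto dest!: Re_ge_half_of_cball\<close>)
  qed (auto intro!: open_halfspace_Re_gt)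
qed (use \<sigma> heat_kernel_gaussian_real in auto)

text \<open>Cauchy's theorem on the rectangle with opposite corners 0 and 1 + iR; the top side has
  length 1 and contributes at most \<open>b R\<close>. On the boundary only continuity is assumed,
  because one of the integrands is a power of \<sigma> with its branch point at the corner
  0.\<close>

lemma half_strip_integral:
  fixes h :: "complex \<Rightarrow> complex" and b :: "real \<Rightarrow> real"
  assumes cont: "continuous_on {z. 0 \<le> Re z \<and> Re z \<le> 1 \<and> 0 \<le> Im z} h"
    and hol: "h holomorphic_on {z. 0 < Re z \<and> Re z < 1 \<and> 0 < Im z}"
    and bound: "\<And>z. 0 \<le> Re z \<Longrightarrow> Re z \<le> 1 \<Longrightarrow> 0 \<le> Im z \<Longrightarrow> norm (h z) \<le> b (Im z)"
    and b: "(b \<longlongrightarrow> 0) at_top"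
    and int0: "set_integrable lborel {0..} (\<lambda>y. h (Complex 0 y))"
    and int1: "set_integrable lborel {0..} (\<lambda>y. h (Complex 1 y))"
  shows "(LINT x:{0..1}|lborel. h (of_real x)) + \<i> * (LINT y:{0..}|lborel. h (Complex 1 y))
       = \<i> * (LINT y:{0..}|lborel. h (Complex 0 y))"
proof -
  let ?L = "\<lambda>c. LINT y:{0..}|lborel. h (Complex c y)"
  let ?l = "\<lambda>c R. LINT y:{0..R}|lborel. h (Complex c y)"
  let ?I = "LINT x:{0..1}|lborel. h (of_real x)"
  let ?top = "\<lambda>R. contour_integral (linepath (Complex 1 R) (Complex 0 R)) h"
  let ?S = "{z. 0 \<le> Re z \<and> Re z \<le> 1 \<and> 0 \<le> Im z}"
  have Sconv: "convex ?S"
  proof -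
    have "?S = {z. Re z \<ge> 0} \<inter> {z. Re z \<le> 1} \<inter> {z. Im z \<ge> 0}" by auto
    then show ?thesis
      by (simp add: convex_Int convex_halfspace_Re_ge convex_halfspace_Re_le convex_halfspace_Im_ge)
  qed
  have seg: "closed_segment a c \<subseteq> ?S" if "a \<in> ?S" "c \<in> ?S" for a c
    using Sconv that by (meson closed_segment_subset)
  have ci: "h contour_integrable_on linepath a c" if "a \<in> ?S" "c \<in> ?S" for a c
    using continuous_on_subset[OF cont seg[OF that]] by (rule contour_integrable_continuous_linepath)
  have fin: "?I + \<i> * ?l 1 R
       - \<i> * ?l 0 R = - ?top R"
    if R: "R > 0" for R
  proof -
    have "(h has_contour_integral 0) (rectpath 0 (Complex 1 R))"
    proof (rule Cauchy_theorem_convex[OF cont Sconv, of "{}"])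
      fix x assume x: "x \<in> interior ?S - {}"
      have op: "open {z. 0 < Re z \<and> Re z < 1 \<and> 0 < Im z}"
        by (intro open_Collect_conj open_Collect_less continuous_intros)
      obtain e where e: "e > 0" "ball x e \<subseteq> ?S" using x by (auto simp: mem_interior)
      \<comment> \<open>Moving x by e/2 to the left, to the right and downwards stays inside the
        closed strip, so its three inequalities are strict at x.\<close>
      have "x - e/2 \<in> ball x e" "x + e/2 \<in> ball x e" "x - \<i> * (e/2) \<in> ball x e"
        using e(1) by (auto simp: dist_norm norm_mult)
      then have "x - e/2 \<in> ?S" "x + e/2 \<in> ?S" "x - \<i> * (e/2) \<in> ?S" using e(2) by blast+
      then have "x \<in> {z. 0 < Re z \<and> Re z < 1 \<and> 0 < Im z}" using e(1) by auto
      then show "h field_differentiable at x"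
        using hol op by (simp add: holomorphic_on_imp_differentiable_at)
    next
      have "path_image (rectpath 0 (Complex 1 R)) \<subseteq> cbox 0 (Complex 1 R)"
        by (rule path_image_rectpath_subset_cbox) (use R in auto)
      then show "path_image (rectpath 0 (Complex 1 R)) \<subseteq> ?S"
        by (auto simp: in_cbox_complex_iff)
    qed auto
    then have "0 = contour_integral (rectpath 0 (Complex 1 R)) h"
      by (simp add: contour_integral_unique)
    also have "\<dots> = contour_integral (linepath 0 1) h + (contour_integral (linepath 1 (Complex 1 R)) h
       + (?top R + contour_integral (linepath (Complex 0 R) 0) h))"
      using R ci unfolding rectpath_def Let_def
      by (auto simp: valid_path_join contour_integrable_joinI Complex_eq)
    also have "contour_integral (linepath (Complex 0 R) 0) h = - contour_integral (linepath 0 (Complex 0 R)) h"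
      by (metis contour_integral_reversepath reversepath_linepath valid_path_linepath)
    also have "contour_integral (linepath 0 (Complex 0 R)) h = \<i> * integral {0..R} (\<lambda>y. h (Complex 0 y))"
      by (rule contour_integral_linepath_same_Re) (use R in auto)
    also have "contour_integral (linepath 1 (Complex 1 R)) h = \<i> * integral {0..R} (\<lambda>y. h (Complex 1 y))"
      by (rule contour_integral_linepath_same_Re) (use R in auto)
    also have "contour_integral (linepath 0 1) h = integral {0..1} (\<lambda>x. h (of_real x))"
      using contour_integral_linepath_Reals_eq[of 0 1 h] by simp
    also have "integral {0..1} (\<lambda>x. h (of_real x)) = ?I"
      by (intro set_borel_integral_eq_integral(2)[symmetric] borel_integrable_atLeastAtMost' continuous_on_compose2[OF cont])
         (auto intro!: continuous_intros)
    also have "integral {0..R} (\<lambda>y. h (Complex 0 y)) = ?l 0 R"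
      by (intro set_borel_integral_eq_integral(2)[symmetric] set_integrable_subset[OF int0]) auto
    also have "integral {0..R} (\<lambda>y. h (Complex 1 y)) = ?l 1 R"
      by (intro set_borel_integral_eq_integral(2)[symmetric] set_integrable_subset[OF int1]) auto
    finally show ?thesis by (simp add: algebra_simps)
  qed
  have "((\<lambda>R. - ?top R) \<longlongrightarrow> 0) at_top"
  proof (rule Lim_null_comparison[OF _ b], rule eventually_at_top_linorderI)
    fix R :: real assume R: "R \<ge> 0"
    have "norm (?top R) \<le> b R * norm (Complex 0 R - Complex 1 R)"
    proof (rule contour_integral_bound_linepath[OF ci])
      have bR: "norm (h (Complex 0 R)) \<le> b R" using bound[of "Complex 0 R"] R by simp
      show "0 \<le> b R" using order_trans[OF norm_ge_zero bR] .
      fix x assume x: "x \<in> closed_segment (Complex 1 R) (Complex 0 R)"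
      then obtain u where "x = (1 - u) *\<^sub>R Complex 1 R + u *\<^sub>R Complex 0 R"
        by (auto simp: closed_segment_def)
      then have "Im x = (1 - u) * R + u * R" by simp
      then have "Im x = R" by (simp add: algebra_simps)
      moreover have "x \<in> ?S" using seg[of "Complex 1 R" "Complex 0 R"] x R by auto
      ultimately show "norm (h x) \<le> b R" using bound[of x] by auto
    qed (use R in auto)
    also have "Complex 0 R - Complex 1 R = -1" by (simp add: complex_eq_iff)
    finally show "norm (- ?top R) \<le> b R" by simp
  qed
  moreover have "\<forall>\<^sub>F R in at_top. - ?top R =
       ?I + \<i> * ?l 1 R
       - \<i> * ?l 0 R"
    using eventually_gt_at_top[of 0] by eventually_elim (use fin in simp)
  ultimately have "((\<lambda>R. ?I + \<i> * ?l 1 R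
       - \<i> * ?l 0 R) \<longlongrightarrow> 0) at_top"
    by (rule Lim_transform_eventually)
  moreover have "((\<lambda>R. ?I + \<i> * ?l 1 R
       - \<i> * ?l 0 R) \<longlongrightarrow>
      ?I + \<i> * ?L 1
       - \<i> * ?L 0) at_top"
    by (intro tendsto_intros tendsto_set_lebesgue_integral_at_top int0 int1) auto
  ultimately have "?I + \<i> * ?L 1
       - \<i> * ?L 0 = 0"
    using tendsto_unique[OF trivial_limit_at_top_linorder] by blast
  then show ?thesis by simp
qed

section \<open>Hermite polynomials and Gaussians\<close>

text \<open>The step is the effect of one derivative on a polynomial times exp (-y^2), with the sign
  of the Rodrigues formula absorbed. This gives polynomials by construction, which the description
  of \<open>hermite_poly\<close> presupposes.\<close>

fun hpoly :: "nat \<Rightarrow> real poly" where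
  "hpoly 0 = 1"
| "hpoly (Suc k) = [:0, 2:] * hpoly k - pderiv (hpoly k)"

text \<open>The Appell property. Substituted into the defining recursion it removes the derivative
  and yields the three-term recurrence.\<close>

lemma pderiv_hpoly_Suc: "pderiv (hpoly (Suc k)) = smult (2 * (real k + 1)) (hpoly k)"
proof (induction k)
  case 0
  then show ?case by (simp add: pderiv_pCons)
next
  case (Suc k)
  have "pderiv (hpoly (Suc (Suc k))) = pderiv ([:0, 2:] * hpoly (Suc k) - pderiv (hpoly (Suc k)))"
    by (simp only: hpoly.simps)
  also have "\<dots> = smult 2 (hpoly (Suc k)) + [:0, 2:] * pderiv (hpoly (Suc k)) - pderiv (pderiv (hpoly (Suc k)))"
    by (simp add: pderiv_diff pderiv_pCons pderiv_smult del: hpoly.simps)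
  also have "\<dots> = smult 2 (hpoly (Suc k)) + smult (2 * (real k + 1)) ([:0, 2:] * hpoly k - pderiv (hpoly k))"
    by (simp only: Suc.IH pderiv_smult smult_diff_right mult_smult_right add_diff_eq)
  also have "\<dots> = smult (2 * (real (Suc k) + 1)) (hpoly (Suc k))"
    by (simp only: hpoly.simps(2)[symmetric] smult_add_left[symmetric]) (simp add: algebra_simps)
  finally show ?case .
qed

lemma hpoly_Suc_Suc:
  "hpoly (Suc (Suc k)) = [:0, 2:] * hpoly (Suc k) - smult (2 * (real k + 1)) (hpoly k)"
  by (rule trans[OF hpoly.simps(2)]) (simp only: pderiv_hpoly_Suc)

lemma poly_hpoly_Suc_Suc:
  "poly (hpoly (Suc (Suc k))) x = 2 * x * poly (hpoly (Suc k)) x - 2 * (real k + 1) * poly (hpoly k) x"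
  by (simp only: hpoly_Suc_Suc) simp

lemma hpoly_gaussian_deriv:
  "((\<lambda>y. poly (hpoly k) y * exp (- y\<^sup>2)) has_real_derivative - (poly (hpoly (Suc k)) y * exp (- y\<^sup>2))) (at y)"
  by (auto intro!: derivative_eq_intros simp: algebra_simps)

lemma funpow_deriv_gaussian:
  "(deriv ^^ k) (\<lambda>y::real. exp (- (y\<^sup>2))) = (\<lambda>y. (-1)^k * (poly (hpoly k) y * exp (- y\<^sup>2)))"
proof (induction k)
  case (Suc k)
  have "deriv (\<lambda>y. (-1)^k * (poly (hpoly k) y * exp (- y\<^sup>2))) y
      = (-1)^k * - (poly (hpoly (Suc k)) y * exp (- y\<^sup>2))" for y
    by (rule DERIV_imp_deriv, rule DERIV_cmult, rule hpoly_gaussian_deriv)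
  then show ?case using Suc by (simp del: hpoly.simps)
qed simp

lemma hermite_rodrigues_eq: "hermite_rodrigues k x = poly (hpoly k) x"
proof -
  have "hermite_rodrigues k x = ((-1)^k * (-1)^k) * (exp (x\<^sup>2) * exp (- x\<^sup>2)) * poly (hpoly k) x"
    by (simp add: hermite_rodrigues_def funpow_deriv_gaussian mult_ac del: hpoly.simps)
  also have "(-1)^k * (-1)^k = (1::real)" by (simp flip: power_mult_distrib)
  also have "exp (x\<^sup>2) * exp (- x\<^sup>2) = 1" by (simp flip: exp_add)
  finally show ?thesis by simp
qed

text \<open>The description in \<open>hermite_poly\<close> is legitimate: a real polynomial is
  determined by its values.\<close>

lemma hermite_poly_eq: "hermite_poly k = hpoly k"
  unfolding hermite_poly_def hermite_rodrigues_eq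
  by (rule the_equality) (auto simp: poly_eq_poly_eq_iff[symmetric])

lemma hermite_H_0 [simp]: "hermite_H 0 z = 1"
  and hermite_H_1: "hermite_H (Suc 0) z = 2 * z"
  by (simp_all add: hermite_H_def hermite_poly_eq map_poly_pCons pderiv_1)

lemma hermite_H_Suc_Suc:
  "hermite_H (Suc (Suc k)) z = 2 * z * hermite_H (Suc k) z - 2 * (of_nat k + 1) * hermite_H k z"
proof -
  have "map_poly complex_of_real (hpoly (Suc (Suc k)))
     = pCons 0 (smult 2 (map_poly complex_of_real (hpoly (Suc k))))
       - smult (2 * (of_nat k + 1)) (map_poly complex_of_real (hpoly k))"
    unfolding hpoly_Suc_Suc
    by (rule poly_eqI) (simp add: coeff_map_poly coeff_pCons split: nat.splits del: hpoly.simps)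
  then show ?thesis by (simp add: hermite_H_def hermite_poly_eq del: hpoly.simps)
qed

text \<open>This removes the division by x. In H_(2M+1) = 2x H_(2M) - 4M H_(2M-1), the first term
  divided by x is the new even summand, and the second reproduces \<open>eta M x\<close>. The
  constants in \<open>eta\<close> are normalised so that no further factor appears.\<close>

lemma eta_eq_sum:
  assumes "M \<ge> 1" "x \<noteq> 0"
  shows "eta M x = (\<Sum>s<M. (-1)^s / (fact s * 4^s) * (poly (hpoly (2 * s)) x * exp (- x\<^sup>2))) / sqrt pi"
  using assms(1)
proof (induction M rule: nat_induct_at_least)
  case base
  then show ?case using assms(2) by (simp add: eta_def hermite_rodrigues_eq pderiv_1)
next
  case (Suc M)
  obtain m where m: "M = Suc m" using Suc(1) by (cases M) auto
  define h where "h = (\<lambda>k. poly (hpoly k) x)"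
  have rec: "h (2*M+1) = 2 * x * h (2*M) - 4 * real M * h (2*M-1)"
    unfolding h_def m by (simp add: poly_hpoly_Suc_Suc del: hpoly.simps)
  have e: "eta N x * sqrt pi = (-1)^(N-1) / (2^(2*N-1) * fact (N-1)) * h (2*N-1) * exp (- x\<^sup>2) / x" for N
    by (simp add: eta_def hermite_rodrigues_eq h_def)
  have "eta (Suc M) x * sqrt pi = (-1)^M / (2 * 4^M * fact M) * h (2*M+1) * exp (- x\<^sup>2) / x"
    unfolding e by (simp add: power_mult)
  also have "\<dots> = (-1)^M / (fact M * 4^M) * (h (2*M) * exp (- x\<^sup>2))
      + (- 1)^M * (-4 * real M) / (2 * 4^M * fact M) * h (2*M-1) * exp (- x\<^sup>2) / x"
    unfolding rec using assms(2) by (simp add: field_simps)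
  \<comment> \<open>The coefficient inherited from the recurrence equals the normalising constant of
    \<open>eta M\<close>: the factor \<open>real M\<close> reduces \<open>fact M\<close> to
    \<open>fact (M-1)\<close>, and the 4 lowers the power of 2.\<close>
  also have "(- 1)^M * (-4 * real M) / (2 * 4^M * fact M) = (-1)^(M-1) / (2^(2*M-1) * fact (M-1))"
  proof -
    have "2 ^ (2*M-1) = 2 * (4::real)^m" unfolding m by (simp add: power_mult)
    moreover have "fact M = real M * fact m" "real M \<noteq> 0" by (simp_all add: m)
    moreover have "(-1::real)^M = - ((-1)^m)" "(4::real)^M = 4 * 4^m" "M - 1 = m" by (simp_all add: m)
    ultimately show ?thesis by (simp add: field_simps)
  qed
  also have "\<dots> * h (2*M-1) * exp (- x\<^sup>2) / x = eta M x * sqrt pi"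
    unfolding e ..
  finally show ?case
    using Suc.IH by (simp add: h_def field_simps del: hpoly.simps)
qed

section \<open>Decay and integrability of polynomials times the Gaussian\<close>

lemma tendsto_power_gaussian_0: "((\<lambda>y::real. y ^ k * exp (- y\<^sup>2)) \<longlongrightarrow> 0) at_top"
  by real_asymp


lemma tendsto_power_gaussian_0_bot: "((\<lambda>y::real. y ^ k * exp (- y\<^sup>2)) \<longlongrightarrow> 0) at_bot"
proof -
  have "((\<lambda>y::real. (-1)^k * (y ^ k * exp (- y\<^sup>2))) \<longlongrightarrow> (-1)^k * 0) at_top"
    by (intro tendsto_mult tendsto_const tendsto_power_gaussian_0)
  then have "((\<lambda>y::real. (-y) ^ k * exp (- (-y)\<^sup>2)) \<longlongrightarrow> 0) at_top"
    by (simp add: power_mult_distrib[symmetric] mult.assoc[symmetric])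
  then show ?thesis by (simp add: filterlim_at_bot_mirror)
qed

lemma integrable_power_gaussian: "integrable lborel (\<lambda>y::real. y ^ k * exp (- y\<^sup>2))"
proof (rule Bochner_Integration.integrable_bound)
  show "integrable lborel (\<lambda>x. sqrt (2 * pi) * (std_normal_density x * \<bar>x\<bar>^k))"
    using integrable_std_normal_moment_abs[of k] by simp
  have "\<bar>y\<bar>^k * exp (- y\<^sup>2) \<le> \<bar>y\<bar>^k * exp (- y\<^sup>2 / 2)" for y :: real
    by (intro mult_left_mono) auto
  then show "AE y in lborel. norm (y ^ k * exp (- y\<^sup>2)) \<le> norm (sqrt (2 * pi) * (std_normal_density y * \<bar>y\<bar>^k))"
    by (auto simp: normal_density_def abs_mult power_abs mult.commute)
qed auto

lemma poly_gaussian_eq: "poly p y * exp (- y\<^sup>2) = (\<Sum>i\<le>degree p. coeff p i * (y ^ i * exp (- y\<^sup>2)))" for y :: real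
  by (simp add: poly_altdef sum_distrib_left mult_ac)

lemma integrable_poly_gaussian: "integrable lborel (\<lambda>y::real. poly p y * exp (- y\<^sup>2))"
  unfolding poly_gaussian_eq
  by (intro Bochner_Integration.integrable_sum integrable_mult_right integrable_power_gaussian)

lemma tendsto_poly_gaussian:
  "((\<lambda>y::real. poly p y * exp (- y\<^sup>2)) \<longlongrightarrow> 0) at_top"
  "((\<lambda>y::real. poly p y * exp (- y\<^sup>2)) \<longlongrightarrow> 0) at_bot"
  unfolding poly_gaussian_eq
  by (auto intro!: tendsto_null_sum tendsto_mult_right_zero tendsto_power_gaussian_0 tendsto_power_gaussian_0_bot)

lemma bounded_poly_gaussian:
  obtains C where "\<And>y::real. \<bar>poly p y * exp (- y\<^sup>2)\<bar> \<le> C"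
proof -
  let ?f = "\<lambda>y::real. poly p y * exp (- y\<^sup>2)"
  have "\<forall>\<^sub>F y in at_top. norm (?f y) < 1" "\<forall>\<^sub>F y in at_bot. norm (?f y) < 1"
    using tendsto_poly_gaussian[of p] by (auto simp: tendsto_iff dist_norm)
  then obtain A B where A: "\<And>y. y \<ge> A \<Longrightarrow> norm (?f y) < 1" and B: "\<And>y. y \<le> B \<Longrightarrow> norm (?f y) < 1"
    unfolding eventually_at_top_linorder eventually_at_bot_linorder by blast
  have "continuous_on {B..A} ?f" by (intro continuous_intros)
  then obtain C where C: "\<And>y. y \<in> {B..A} \<Longrightarrow> norm (?f y) \<le> C"
    by (rule continuous_on_compact_bound[OF compact_Icc]) blast
  show thesis
  proof (rule that[of "max C 1"])
    fix y :: real
    have "norm (?f y) \<le> C \<or> norm (?f y) \<le> 1"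
    proof (cases "y \<ge> A \<or> y \<le> B")
      case True
      then have "norm (?f y) < 1" using A[of y] B[of y] by blast
      then show ?thesis by linarith
    next
      case False
      then show ?thesis using C[of y] by simp
    qed
    then show "\<bar>?f y\<bar> \<le> max C 1"
      unfolding le_max_iff_disj real_norm_def .
  qed
qed

section \<open>Integration by parts against the heat kernel\<close>

lemma heat_kernel_deriv:
  assumes "\<sigma> \<noteq> 0"
  shows "((\<lambda>y. heat_kernel \<sigma> (x - y)) has_vector_derivative heat_kernel \<sigma> (x - y) * (of_real (x - y) / (2 * \<sigma>))) (at y)"
proof -
  have "((\<lambda>w. (4 * of_real pi * \<sigma>) powr (-1/2) * exp (- (of_real x - w)\<^sup>2 / (4 * \<sigma>))) has_field_derivative
      heat_kernel \<sigma> (x - y) * (of_real (x - y) / (2 * \<sigma>))) (at (of_real y))"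
    unfolding heat_kernel_def using assms
    by (auto intro!: derivative_eq_intros simp: field_simps)
  then have "((\<lambda>w. (4 * of_real pi * \<sigma>) powr (-1/2) * exp (- (of_real x - of_real w)\<^sup>2 / (4 * \<sigma>))) has_vector_derivative
      heat_kernel \<sigma> (x - y) * (of_real (x - y) / (2 * \<sigma>))) (at y)"
    by (rule has_vector_derivative_real_field)
  then show ?thesis by (simp add: heat_kernel_def)
qed

lemma integrable_heat_kernel_mult:
  fixes g :: "real \<Rightarrow> complex"
  assumes "Re \<sigma> > 0" "integrable lborel g"
  shows "integrable lborel (\<lambda>y. heat_kernel \<sigma> (x - y) * g y)"
proof (rule Bochner_Integration.integrable_bound)
  show "integrable lborel (\<lambda>y. norm (4 * of_real pi * \<sigma>) powr (-1/2) * norm (g y))"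
    using assms(2) by simp
  show "(\<lambda>y. heat_kernel \<sigma> (x - y) * g y) \<in> borel_measurable lborel"
    using assms(2) by measurable
  show "AE y in lborel. norm (heat_kernel \<sigma> (x - y) * g y) \<le> norm (norm (4 * of_real pi * \<sigma>) powr (-1/2) * norm (g y))"
    using norm_heat_kernel_le[OF assms(1)] by (auto intro!: AE_I2 mult_right_mono simp: norm_mult)
qed

definition hermite_gauss :: "nat \<Rightarrow> real \<Rightarrow> complex" where
  "hermite_gauss k y = of_real (poly (hpoly k) y * exp (- y\<^sup>2))"

lemma integrable_hermite_gauss: "integrable lborel (hermite_gauss k)"
  unfolding hermite_gauss_def using integrable_poly_gaussian[of "hpoly k"] by (rule integrable_of_real)

text \<open>The three-term recurrence solved for y H_k. It also covers k = 0, where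
  \<open>k - 1\<close> is 0 but has coefficient 0.\<close>

lemma hermite_gauss_mult:
  "of_real y * hermite_gauss k y = (hermite_gauss (Suc k) y + 2 * of_nat k * hermite_gauss (k - 1) y) / 2"
proof (cases k)
  case (Suc m)
  then show ?thesis
    by (simp add: hermite_gauss_def poly_hpoly_Suc_Suc del: hpoly.simps) (simp add: algebra_simps)
qed (simp add: hermite_gauss_def pderiv_1)

text \<open>The y-derivative of K(x - y) H_k(y) exp (-y^2) integrates to 0, since the kernel is
  bounded and the Hermite factor decays. The derivative of the kernel brings down (x -
  y)/(2\<sigma>); the product y H_k is expanded in H_(k+1) and H_(k-1), and multiplication by
  4\<sigma> collects the two H_(k+1) terms into 1 + 4\<sigma>.\<close>

lemma heat_kernel_hermite_rec:
  fixes x :: real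
  assumes \<sigma>: "Re \<sigma> > 0"
  defines "I \<equiv> \<lambda>k. \<integral>y. heat_kernel \<sigma> (x - y) * hermite_gauss k y \<partial>lborel"
  shows "(1 + 4 * \<sigma>) * I (Suc k) = 2 * of_real x * I k - 2 * of_nat k * I (k - 1)"
proof -
  have nz: "\<sigma> \<noteq> 0" using \<sigma> by auto
  note int = integrable_heat_kernel_mult[OF \<sigma> integrable_hermite_gauss, of x]
  let ?K = "\<lambda>y. heat_kernel \<sigma> (x - y)"
  let ?F = "\<lambda>y. ?K y * hermite_gauss k y"
  let ?c = "1 / (2 * \<sigma>)"
  let ?f = "\<lambda>y. (of_real x * ?c) * (?K y * hermite_gauss k y) 
        - (?c / 2) * (?K y * hermite_gauss (Suc k) y) - (?c * of_nat k) * (?K y * hermite_gauss (k-1) y)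
        - ?K y * hermite_gauss (Suc k) y"
  have hd: "(hermite_gauss k has_vector_derivative - hermite_gauss (Suc k) y) (at y)" for y
    using has_vector_derivative_of_real[OF hpoly_gaussian_deriv[of k y], where ?'a=complex]
    by (simp add: hermite_gauss_def[abs_def] del: hpoly.simps)
  have "(?F has_vector_derivative ?f y) (at y)" for y
  proof -
    have "(?F has_vector_derivative ?K y * - hermite_gauss (Suc k) y + (?K y * (of_real (x - y) / (2 * \<sigma>))) * hermite_gauss k y) (at y)"
      by (rule has_vector_derivative_mult[OF heat_kernel_deriv[OF nz] hd])
    also have "(?K y * (of_real (x - y) / (2 * \<sigma>))) * hermite_gauss k y 
       = ?K y * ?c * (of_real x * hermite_gauss k y - of_real y * hermite_gauss k y)"
      using nz by (simp add: field_simps)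
    also have "?K y * - hermite_gauss (Suc k) y + \<dots> = ?f y"
      unfolding hermite_gauss_mult using nz by (simp add: field_simps)
    finally show ?thesis .
  qed
  moreover have "isCont ?f y" for y
    unfolding hermite_gauss_def heat_kernel_def using nz by (auto intro!: continuous_intros simp del: hpoly.simps)
  moreover have "integrable lborel ?f"
    by (intro Bochner_Integration.integrable_diff integrable_mult_right int)
  moreover have "(?F \<longlongrightarrow> 0) at_top" "(?F \<longlongrightarrow> 0) at_bot"
  proof -
    have "norm (?F y) \<le> norm (4 * of_real pi * \<sigma>) powr (-1/2) * norm (poly (hpoly k) y * exp (- y\<^sup>2))" for y
      using norm_heat_kernel_le[OF \<sigma>] by (auto simp: norm_mult hermite_gauss_def abs_mult simp del: hpoly.simps intro!: mult_right_mono)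
    then have le: "\<forall>\<^sub>F y in G. norm (?F y) \<le> norm (4 * of_real pi * \<sigma>) powr (-1/2) * norm (poly (hpoly k) y * exp (- y\<^sup>2))" for G
      by (intro always_eventually allI)
    show "(?F \<longlongrightarrow> 0) at_top" "(?F \<longlongrightarrow> 0) at_bot"
      by (rule Lim_null_comparison[OF le], intro tendsto_mult_right_zero tendsto_norm_zero tendsto_poly_gaussian)+
  qed
  ultimately have "(LBINT y=-\<infinity>..\<infinity>. ?f y) = 0 - 0"
    by (intro interval_integral_FTC_integrable[where F="?F"])
       (simp_all only: ereal_tendsto_simps set_integrable_def einterval_eq indicator_UNIV scaleR_one, simp_all)
  then have "0 = integral\<^sup>L lborel ?f"
    by (simp add: interval_lebesgue_integral_def set_lebesgue_integral_def)
  also have "\<dots> = (of_real x * ?c) * I k - (?c / 2) * I (Suc k) - (?c * of_nat k) * I (k-1) - I (Suc k)"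
    unfolding I_def using int by simp
  finally have "0 = ((of_real x * ?c) * I k - (?c / 2) * I (Suc k) - (?c * of_nat k) * I (k-1) - I (Suc k)) * (4 * \<sigma>)"
    by simp
  also have "\<dots> = 2 * of_real x * I k - I (Suc k) - 2 * of_nat k * I (k-1) - 4 * \<sigma> * I (Suc k)"
    using nz by (simp add: field_simps)
  finally show ?thesis by (simp add: algebra_simps)
qed

text \<open>With q^2 = 1 + 4\<sigma>, the recurrence for the integrals becomes the Hermite
  recurrence in x/q once the k-th integral is multiplied by q^k. The start is the Gaussian integral
  at k = 0; the recurrence itself supplies k = 1.\<close>

lemma heat_kernel_hermite:
  assumes \<sigma>: "Re \<sigma> > 0"
  defines "q \<equiv> csqrt (1 + 4 * \<sigma>)"
  shows "(\<integral>y. heat_kernel \<sigma> (x - y) * hermite_gauss k y \<partial>lborel)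
     = (1 + 4 * \<sigma>) powr (-1/2) * exp (- (of_real x)\<^sup>2 / (1 + 4 * \<sigma>)) * (hermite_H k (of_real x / q) / q ^ k)"
proof -
  let ?I = "\<lambda>k. \<integral>y. heat_kernel \<sigma> (x - y) * hermite_gauss k y \<partial>lborel"
  let ?G = "(1 + 4 * \<sigma>) powr (-1/2) * exp (- (of_real x)\<^sup>2 / (1 + 4 * \<sigma>))"
  have q2: "q\<^sup>2 = 1 + 4 * \<sigma>" by (simp add: q_def)
  have nz: "1 + 4 * \<sigma> \<noteq> 0" using \<sigma> by (auto simp: complex_eq_iff)
  then have q: "q \<noteq> 0" using q2 by auto
  have I0: "?I 0 = ?G"
    using heat_kernel_gaussian[OF \<sigma>, of x] by (simp add: hermite_gauss_def)
  show "?I k = ?G * (hermite_H k (of_real x / q) / q ^ k)"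
  proof (induction k rule: induct_nat_012)
    case 0
    then show ?case using I0 by simp
  next
    case 1
    have "q\<^sup>2 * ?I (Suc 0) = 2 * of_real x * ?G"
      using heat_kernel_hermite_rec[OF \<sigma>, of x 0] I0 by (simp add: q2)
    also have "\<dots> = q\<^sup>2 * (?G * (hermite_H (Suc 0) (of_real x / q) / q ^ Suc 0))"
      using q by (simp add: hermite_H_1 power2_eq_square)
    finally show ?case
      by (rule mult_left_cancel[THEN iffD1, rotated]) (use q in simp)
  next
    case (ge2 k)
    have "q\<^sup>2 * ?I (Suc (Suc k)) = 2 * of_real x * ?I (Suc k) - 2 * of_nat (Suc k) * ?I k"
      using heat_kernel_hermite_rec[OF \<sigma>, of x "Suc k"] by (simp add: q2)
    also have "\<dots> = 2 * of_real x * (?G * (hermite_H (Suc k) (of_real x / q) / q ^ Suc k)) 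
         - 2 * of_nat (Suc k) * (?G * (hermite_H k (of_real x / q) / q ^ k))"
      by (simp only: ge2)
    also have "\<dots> = q\<^sup>2 * (?G * (hermite_H (Suc (Suc k)) (of_real x / q) / q ^ Suc (Suc k)))"
      using q by (simp add: hermite_H_Suc_Suc field_simps power2_eq_square)
    finally show ?case
      by (rule mult_left_cancel[THEN iffD1, rotated]) (use q in simp)
  qed
qed

section \<open>Gaussian convolution of the basis functions\<close>

lemma poly_measurable [measurable]: "poly (p :: real poly) \<in> borel_measurable borel"
  by (intro borel_measurable_continuous_onI continuous_on_poly continuous_on_id)

lemma eta_measurable [measurable]: "eta M \<in> borel_measurable borel"
  unfolding eta_def hermite_rodrigues_eq by measurable

lemma of_real_eta_eq_sum:
  assumes "M \<ge> 1" "y \<noteq> 0"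
  shows "complex_of_real (eta M y) =
    of_real (1 / sqrt pi) * (\<Sum>s<M. (-1)^s / (of_nat (fact s) * 4^s) * hermite_gauss (2 * s) y)"
  unfolding eta_eq_sum[OF assms] hermite_gauss_def by simp

text \<open>The point 0 is excluded because division by 0 gives \<open>eta\<close> the value 0
  there, while the sum need not vanish.\<close>

lemma AE_eta_eq_sum:
  assumes "M \<ge> 1"
  shows "AE y in lborel. complex_of_real (eta M y) =
    of_real (1 / sqrt pi) * (\<Sum>s<M. (-1)^s / (of_nat (fact s) * 4^s) * hermite_gauss (2 * s) y)"
  using AE_lborel_singleton[of 0] by eventually_elim (rule of_real_eta_eq_sum[OF assms])

lemma hermite_gauss_measurable [measurable]: "hermite_gauss k \<in> borel_measurable borel"
  unfolding hermite_gauss_def by measurable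

lemma integrable_eta:
  assumes "M \<ge> 1"
  shows "integrable lborel (\<lambda>y. complex_of_real (eta M y))"
proof -
  have "integrable lborel (\<lambda>y. of_real (1 / sqrt pi) * (\<Sum>s<M. (-1)^s / (of_nat (fact s) * 4^s) * hermite_gauss (2 * s) y))"
    by (intro integrable_mult_right Bochner_Integration.integrable_sum integrable_hermite_gauss)
  also have "?this \<longleftrightarrow> ?thesis"
    by (intro integrable_cong_AE) (use AE_eta_eq_sum[OF assms] in \<open>auto simp: eq_commute\<close>)
  finally show ?thesis .
qed

text \<open>Near \<sigma> = 0 the heat kernel is controlled only in L^1, so the convolution estimate
  there requires a bounded right-hand side.\<close>

lemma bounded_eta:
  assumes "M \<ge> 1"
  obtains C where "\<And>y. \<bar>eta M y\<bar> \<le> C"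
proof -
  let ?h = "\<lambda>s y. poly (hpoly (2 * s)) y * exp (- y\<^sup>2)"
  let ?c = "\<lambda>s. (-1)^s / (fact s * 4^s) :: real"
  have "\<exists>C. \<forall>y. \<bar>?h s y\<bar> \<le> C" for s
    using bounded_poly_gaussian by metis
  then obtain C where C: "\<And>s y. \<bar>?h s y\<bar> \<le> C s" by metis
  let ?B = "(\<Sum>s<M. C s / (fact s * 4^s)) / sqrt pi"
  have B: "\<bar>eta M y\<bar> \<le> ?B" if "y \<noteq> 0" for y
  proof -
    have "\<bar>eta M y\<bar> \<le> (\<Sum>s<M. \<bar>?c s * ?h s y\<bar>) / sqrt pi"
      unfolding eta_eq_sum[OF assms that] abs_divide[of _ "sqrt pi"] abs_of_nonneg[OF real_sqrt_ge_zero[OF pi_ge_zero]]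
      by (intro divide_right_mono sum_abs) simp
    also have "\<dots> \<le> ?B"
    proof (intro divide_right_mono sum_mono)
      fix s
      have "\<bar>?c s * ?h s y\<bar>
          = \<bar>?h s y\<bar> / (fact s * 4^s)"
        by (simp add: abs_mult abs_divide power_abs)
      also have "\<dots> \<le> C s / (fact s * 4^s)" by (intro divide_right_mono C) simp
      finally show "\<bar>?c s * ?h s y\<bar> \<le> C s / (fact s * 4^s)" .
    qed simp
    finally show ?thesis .
  qed
  show thesis
  proof (rule that)
    fix y
    show "\<bar>eta M y\<bar> \<le> ?B"
    proof (cases "y = 0")
      case True
      have "\<bar>eta M 1\<bar> \<le> ?B" by (rule B) simp
      then have "0 \<le> ?B" by linarith
      then show ?thesis using True by (simp add: eta_def)
    qed (rule B)
  qed
qed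

text \<open>The argument \<open>4 * \<sigma>\<close> of \<open>PM\<close> becomes 4 i a^2 t when
  \<sigma> = i a^2 t. The factors 1/sqrt pi, one per coordinate, are the source of pi^(-n/2) in the
  theorem.\<close>

definition eta_heat :: "nat \<Rightarrow> real \<Rightarrow> complex \<Rightarrow> complex" where
  "eta_heat M x \<sigma> = of_real (1 / sqrt pi) * PM M x (4 * \<sigma>) * exp (- (of_real x)\<^sup>2 / (1 + 4 * \<sigma>))"

text \<open>Only even indices 2s occur, so the root enters through q^(2s) = (1 + 4\<sigma>)^s. With
  the Gaussian prefactor (1 + 4\<sigma>)^(-1/2) this is the exponent -(s + 1/2) in
  \<open>PM\<close>.\<close>

lemma heat_kernel_eta:
  assumes \<sigma>: "Re \<sigma> > 0" and M: "M \<ge> 1"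
  shows "(\<integral>y. heat_kernel \<sigma> (x - y) * of_real (eta M y) \<partial>lborel) = eta_heat M x \<sigma>"
proof -
  let ?J = "\<lambda>s. \<integral>y. heat_kernel \<sigma> (x - y) * hermite_gauss (2 * s) y \<partial>lborel"
  let ?E = "exp (- (complex_of_real x)\<^sup>2 / (1 + 4 * \<sigma>))"
  let ?c = "\<lambda>s. (-1)^s / (of_nat (fact s) * 4^s) :: complex"
  let ?w = "1 + 4 * \<sigma>"
  have nz: "?w \<noteq> 0" using \<sigma> by (auto simp: complex_eq_iff)
  have term_eq: "?J s
     = 1 / (?w powr (of_nat s + 1/2)) * (hermite_H (2 * s) (of_real x / csqrt ?w) * ?E)" for s
  proof -
    have "csqrt ?w ^ (2 * s) = ?w ^ s" by (simp add: power_mult)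
    moreover have "?w powr (-1/2) = 1 / ?w powr (1/2)" by (simp add: powr_minus field_simps)
    moreover have "?w powr (of_nat s + 1/2) = ?w ^ s * ?w powr (1/2)"
      using nz by (simp add: powr_add powr_nat)
    ultimately have eq: "?w powr (-1/2) / csqrt ?w ^ (2 * s) = 1 / (?w powr (of_nat s + 1/2))" by simp
    have "?w powr (-1/2) * E * (H / csqrt ?w ^ (2 * s)) = (?w powr (-1/2) / csqrt ?w ^ (2 * s)) * (H * E)" for E H
      by simp
    then show ?thesis by (simp only: heat_kernel_hermite[OF \<sigma>] eq)
  qed
  have "(\<integral>y. heat_kernel \<sigma> (x - y) * of_real (eta M y) \<partial>lborel)
     = (\<integral>y. of_real (1 / sqrt pi) * (\<Sum>s<M. ?c s * (heat_kernel \<sigma> (x - y) * hermite_gauss (2 * s) y)) \<partial>lborel)"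
    by (intro integral_cong_AE) (use AE_eta_eq_sum[OF M] in \<open>auto simp: sum_distrib_left mult_ac elim!: eventually_mono\<close>)
  also have "\<dots> = of_real (1 / sqrt pi) * (\<Sum>s<M. ?c s * ?J s)"
    by (subst integral_mult_right_zero, subst Bochner_Integration.integral_sum)
       (auto intro!: integrable_mult_right integrable_heat_kernel_mult[OF \<sigma>] integrable_hermite_gauss)
  also have "\<dots> = of_real (1 / sqrt pi) * (\<Sum>s<M. ?c s * (1 / (?w powr (of_nat s + 1/2))) 
       * hermite_H (2 * s) (of_real x / csqrt ?w) * ?E)"
    by (simp only: term_eq mult.assoc)
  also have "\<dots> = eta_heat M x \<sigma>"
    unfolding eta_heat_def PM_def sum_distrib_right[symmetric] mult.assoc[symmetric] ..
  finally show ?thesis .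
qed

text \<open>Parabolic scaling: space by \<open>a\<close>, time by \<open>a\<^sup>2\<close>. A
  positive real factor may be taken out of a complex power without changing the branch.\<close>

lemma heat_kernel_scale:
  assumes a: "a > 0"
  shows "heat_kernel \<sigma> (x - y / a) = of_real a * heat_kernel (of_real (a\<^sup>2) * \<sigma>) (a * x - y)"
proof -
  have a': "complex_of_real a \<noteq> 0" using a by simp
  have "a * (a\<^sup>2) powr (-1/2) = 1"
    using a by (simp add: powr_minus powr_half_sqrt real_sqrt_unique field_simps)
  moreover have "(complex_of_real (a\<^sup>2)) powr (-1/2) = of_real ((a\<^sup>2) powr (-1/2))"
    using powr_of_real[of "a\<^sup>2" "-1/2"] by simp
  ultimately have 1: "of_real a * (complex_of_real (a\<^sup>2)) powr (-1/2) = 1"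
    by (metis of_real_1 of_real_mult)
  have "4 * complex_of_real pi * (of_real (a\<^sup>2) * \<sigma>) = of_real (a\<^sup>2) * (4 * of_real pi * \<sigma>)" by simp
  also have "\<dots> powr (-1/2) = of_real (a\<^sup>2) powr (-1/2) * (4 * of_real pi * \<sigma>) powr (-1/2)"
    by (rule powr_times_real_left) auto
  finally have "of_real a * (4 * complex_of_real pi * (of_real (a\<^sup>2) * \<sigma>)) powr (-1/2) = (4 * of_real pi * \<sigma>) powr (-1/2)"
    using 1 by (simp add: mult.assoc[symmetric])
  moreover have "(complex_of_real (a * x - y))\<^sup>2 / (4 * (of_real (a\<^sup>2) * \<sigma>)) = (complex_of_real (x - y / a))\<^sup>2 / (4 * \<sigma>)"
  proof -
    have "complex_of_real (a * x - y) = of_real a * of_real (x - y / a)" using a' by (simp add: algebra_simps)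
    then show ?thesis using a' by (simp add: power_mult_distrib)
  qed
  ultimately show ?thesis unfolding heat_kernel_def by (simp add: mult.assoc[symmetric])
qed

lemma heat_kernel_eta_scaled:
  assumes \<sigma>: "Re \<sigma> > 0" and M: "M \<ge> 1" and a: "a > 0"
  shows "(\<integral>y. heat_kernel \<sigma> (x - y) * of_real (eta M (a * y)) \<partial>lborel) = eta_heat M (a * x) (of_real (a\<^sup>2) * \<sigma>)"
proof -
  have "(\<integral>y. heat_kernel \<sigma> (x - y) * of_real (eta M (a * y)) \<partial>lborel)
     = \<bar>1/a\<bar> *\<^sub>R (\<integral>y. heat_kernel \<sigma> (x - (0 + 1/a * y)) * of_real (eta M (a * (0 + 1/a * y))) \<partial>lborel)"
    by (rule lborel_integral_real_affine) (use a in simp)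
  also have "\<dots> = \<bar>1/a\<bar> *\<^sub>R (\<integral>y. of_real a * (heat_kernel (of_real (a\<^sup>2) * \<sigma>) (a * x - y) * of_real (eta M y)) \<partial>lborel)"
    using a by (simp add: heat_kernel_scale mult.assoc del: integral_mult_right_zero)
  also have "\<dots> = (\<integral>y. heat_kernel (of_real (a\<^sup>2) * \<sigma>) (a * x - y) * of_real (eta M y) \<partial>lborel)"
    using a by (simp add: scaleR_conv_of_real)
  also have "\<dots> = eta_heat M (a * x) (of_real (a\<^sup>2) * \<sigma>)"
    by (rule heat_kernel_eta) (use \<sigma> M a in auto)
  finally show ?thesis .
qed

lemma integrable_eta_scaled:
  assumes "M \<ge> 1" "a > 0"
  shows "integrable lborel (\<lambda>y. complex_of_real (eta M (a * y)))"
  using lborel_integrable_real_affine[OF integrable_eta[OF assms(1)], of a 0] assms(2) by simp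

section \<open>Products over the coordinates\<close>

lemma Basis_vec_real: "(Basis :: (real^'n) set) = range (\<lambda>j. axis j 1)"
  by (auto simp: Basis_vec_def)

lemma inj_axis_1: "inj (\<lambda>j. axis j (1::real))"
  by (auto simp: inj_on_def axis_eq_axis)

text \<open>\<open>lborel\<close> on real^n is the image of a product measure indexed by
  \<open>Basis\<close>, that is by the vectors \<open>axis j 1\<close>. Reindexing by the inverse of
  this injection turns products over \<open>Basis\<close> into products over coordinates.\<close>

lemma lborel_vec_prod:
  fixes f :: "'n::finite \<Rightarrow> real \<Rightarrow> 'a::{real_normed_field, banach, second_countable_topology}"
  assumes int: "\<And>j. integrable lborel (f j)"
  shows "integrable lborel (\<lambda>y::real^'n. \<Prod>j\<in>UNIV. f j (y $ j))"
    and "(\<integral>(y::real^'n). (\<Prod>j\<in>UNIV. f j (y $ j)) \<partial>lborel) = (\<Prod>j\<in>UNIV. integral\<^sup>L lborel (f j))"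
proof -
  let ?T = "\<lambda>g::real^'n \<Rightarrow> real. \<Sum>b\<in>Basis. g b *\<^sub>R b"
  let ?P = "\<Pi>\<^sub>M b\<in>(Basis :: (real^'n) set). (lborel :: real measure)"
  let ?ix = "inv (\<lambda>j::'n. axis j (1::real))"
  interpret product_sigma_finite "\<lambda>_::real^'n. lborel :: real measure" by standard
  have ix: "?ix (axis j 1) = j" for j by (rule inv_f_f[OF inj_axis_1])
  have comp: "?T g $ j = g (axis j 1)" for g j
    unfolding Basis_vec_real
    by (subst sum.reindex[OF inj_axis_1]) (simp add: axis_def if_distrib[of "(*) _"] cong: if_cong)
  have prod: "(\<Prod>j\<in>UNIV. f j (?T g $ j)) = (\<Prod>b\<in>Basis. f (?ix b) (g b))" for g
  proof -
    have "(\<Prod>b\<in>Basis. f (?ix b) (g b)) = (\<Prod>j\<in>UNIV. f j (g (axis j 1)))"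
      unfolding Basis_vec_real by (subst prod.reindex[OF inj_axis_1]) (simp add: ix)
    then show ?thesis by (simp only: comp)
  qed
  have fm: "f j \<in> borel_measurable borel" for j using int[of j] by auto
  have m: "(\<lambda>y::real^'n. \<Prod>j\<in>UNIV. f j (y $ j)) \<in> borel_measurable borel"
    by (intro borel_measurable_prod measurable_compose[OF _ fm]) auto
  have T: "?T \<in> ?P \<rightarrow>\<^sub>M borel" by measurable
  show "integrable lborel (\<lambda>y::real^'n. \<Prod>j\<in>UNIV. f j (y $ j))"
    unfolding lborel_eq[where 'a="real^'n"] integrable_distr_eq[OF T m] prod
    by (intro product_integrable_prod int) auto
  have "(\<integral>(y::real^'n). (\<Prod>j\<in>UNIV. f j (y $ j)) \<partial>lborel) = (\<Prod>b\<in>Basis. integral\<^sup>L lborel (f (?ix b)))"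
    unfolding lborel_eq[where 'a="real^'n"] integral_distr[OF T m] prod
    by (intro product_integral_prod int) auto
  also have "\<dots> = (\<Prod>j\<in>UNIV. integral\<^sup>L lborel (f j))"
    unfolding Basis_vec_real by (subst prod.reindex[OF inj_axis_1]) (simp add: ix)
  finally show "(\<integral>(y::real^'n). (\<Prod>j\<in>UNIV. f j (y $ j)) \<partial>lborel) = (\<Prod>j\<in>UNIV. integral\<^sup>L lborel (f j))" .
qed

text \<open>Each prefactor is the exponential of -1/2 times a principal logarithm, so its n-th power
  is the principal power with exponent -n/2 and no branch correction arises.\<close>

lemma prod_heat_kernel:
  fixes z :: "real^'n"
  assumes "\<sigma> \<noteq> 0"
  shows "(\<Prod>j\<in>UNIV. heat_kernel \<sigma> (z $ j)) =
    (4 * of_real pi * \<sigma>) powr (- of_nat CARD('n) / 2) * exp (- (of_real (norm z))\<^sup>2 / (4 * \<sigma>))"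
proof -
  have "((4 * of_real pi * \<sigma>) powr (-1/2)) ^ CARD('n) = (4 * of_real pi * \<sigma>) powr (- of_nat CARD('n) / 2)"
    using assms by (simp add: powr_def exp_of_nat_mult[symmetric])
  moreover have "(\<Prod>j\<in>UNIV. exp (- (complex_of_real (z $ j))\<^sup>2 / (4 * \<sigma>))) = exp (- (of_real (norm z))\<^sup>2 / (4 * \<sigma>))"
  proof -
    have "(norm z)\<^sup>2 = (\<Sum>j\<in>UNIV. (z $ j)\<^sup>2)"
      by (simp add: norm_vec_def L2_set_def real_sqrt_pow2 sum_nonneg)
    then have "(complex_of_real (norm z))\<^sup>2 = (\<Sum>j\<in>UNIV. (complex_of_real (z $ j))\<^sup>2)"
      by (metis (no_types, lifting) of_real_power of_real_sum sum.cong)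
    then show ?thesis by (simp add: exp_sum[symmetric] sum_divide_distrib sum_negf)
  qed
  ultimately show ?thesis by (simp add: heat_kernel_def prod.distrib)
qed

section \<open>Incomplete Gamma functions\<close>

text \<open>The product form \<open>b k * w x\<close> of the bound makes the integrals of the norms
  summable. Besides integrating series term by term, this is applied with counting measure to
  exchange the sums of a double series.\<close>

lemma sums_set_lebesgue_integral_dominated:
  fixes f :: "nat \<Rightarrow> 'a \<Rightarrow> 'b::{banach, second_countable_topology}"
  assumes f: "\<And>k. set_borel_measurable M S (f k)"
    and w: "set_integrable M S (w :: 'a \<Rightarrow> real)"
    and b: "summable b"
    and le: "\<And>k x. x \<in> S \<Longrightarrow> norm (f k x) \<le> b k * w x"
    and g: "\<And>x. x \<in> S \<Longrightarrow> (\<lambda>k. f k x) sums g x"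
  shows "(\<lambda>k. LINT x:S|M. f k x) sums (LINT x:S|M. g x)"
    and "set_integrable M S g"
proof -
  let ?f = "\<lambda>k x. indicator S x *\<^sub>R f k x"
  let ?w = "\<lambda>x. indicator S x *\<^sub>R w x"
  have nle: "norm (?f k x) \<le> b k * ?w x" for k x
    using le[of x k] by (auto simp: indicator_def)
  have int: "integrable M (?f k)" for k
  proof (rule Bochner_Integration.integrable_bound[of M "\<lambda>x. b k * ?w x"])
    show "integrable M (\<lambda>x. b k * ?w x)"
      using w unfolding set_integrable_def by (rule integrable_mult_right)
    show "?f k \<in> borel_measurable M"
      using f[of k] unfolding set_borel_measurable_def .
    show "AE x in M. norm (?f k x) \<le> norm (b k * ?w x)"
      unfolding real_norm_def by (intro AE_I2 order_trans[OF nle abs_ge_self])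
  qed
  have s: "summable (\<lambda>k. norm (?f k x))" for x
    by (rule summable_comparison_test'[OF summable_mult2[OF b, of "?w x"]]) (use nle in auto)
  have "norm (\<integral>x. norm (?f k x) \<partial>M) \<le> b k * (\<integral>x. ?w x \<partial>M)" for k
  proof -
    have "(\<integral>x. norm (?f k x) \<partial>M) \<le> (\<integral>x. b k * ?w x \<partial>M)"
      using w int nle unfolding set_integrable_def
      by (intro integral_mono integrable_norm integrable_mult_right) auto
    moreover have "0 \<le> (\<integral>x. norm (?f k x) \<partial>M)" by simp
    ultimately show ?thesis by (simp del: Bochner_Integration.integral_nonneg)
  qed
  then have s2: "summable (\<lambda>k. \<integral>x. norm (?f k x) \<partial>M)"
    by (intro summable_comparison_test'[OF summable_mult2[OF b, of "\<integral>x. ?w x \<partial>M"]]) auto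
  have eq: "(\<Sum>k. ?f k x) = indicator S x *\<^sub>R g x" for x
    using g[of x] by (auto simp: indicator_def sums_iff)
  show "(\<lambda>k. LINT x:S|M. f k x) sums (LINT x:S|M. g x)"
    using sums_integral[OF int AE_I2[OF s] s2] unfolding set_lebesgue_integral_def eq .
  show "set_integrable M S g"
    using integrable_suminf[OF int AE_I2[OF s] s2] unfolding set_integrable_def eq .
qed

lemma set_borel_measurable_lborel_continuous:
  fixes f :: "'a::euclidean_space \<Rightarrow> 'b::{banach, second_countable_topology}"
  assumes "A \<in> sets borel" "continuous_on A f"
  shows "set_borel_measurable lborel A f"
  using borel_measurable_continuous_on_indicator[OF assms] by (simp add: set_borel_measurable_def)

lemma AE_set_integral_Ici_Ioi:
  fixes f :: "real \<Rightarrow> 'b::{banach, second_countable_topology}"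
  assumes f: "set_borel_measurable lborel {a..} f"
  shows "(LINT x:{a..}|lborel. f x) = (LINT x:{a<..}|lborel. f x)"
  unfolding set_lebesgue_integral_def
proof (rule integral_cong_AE)
  show "AE x in lborel. indicator {a..} x *\<^sub>R f x = indicator {a<..} x *\<^sub>R f x"
    using AE_lborel_singleton[of a] by eventually_elim (auto simp: indicator_def)
  have "set_borel_measurable lborel {a<..} f"
    by (rule set_borel_measurable_subset[OF f]) auto
  then show "(\<lambda>x. indicator {a<..} x *\<^sub>R f x) \<in> borel_measurable lborel"
    unfolding set_borel_measurable_def .
qed (use f in \<open>simp add: set_borel_measurable_def\<close>)

text \<open>Formally the integral of \<open>exp (z x) x\<^bsup>-s-1\<^esup>\<close> over \<open>[0,1]\<close>, continued in \<open>s\<close>: the elementary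
  part of an incomplete Gamma function.\<close>

definition eser :: "real \<Rightarrow> complex \<Rightarrow> complex" where
  "eser s z = (\<Sum>k. z ^ k / (fact k * (of_nat k - of_real s)))"

text \<open>The distance of \<open>s\<close> from the nearest integer bounds all denominators k - s
  of \<open>eser\<close> from below at once.\<close>

lemma dist_Ints_pos:
  fixes s :: real
  assumes "s \<notin> \<int>"
  obtains d where "d > 0" "\<And>k::int. d \<le> \<bar>of_int k - s\<bar>"
proof
  show "min (frac s) (1 - frac s) > 0"
    using assms frac_lt_1[of s] by (simp add: frac_gt_0_iff)
  show "min (frac s) (1 - frac s) \<le> \<bar>of_int k - s\<bar>" for k :: int
  proof (cases "k \<le> \<lfloor>s\<rfloor>")
    case True
    then have "of_int k \<le> (of_int \<lfloor>s\<rfloor> :: real)" by simp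
    then show ?thesis unfolding frac_def by linarith
  next
    case False
    then have "of_int k \<ge> (of_int \<lfloor>s\<rfloor> + 1 :: real)" by linarith
    then show ?thesis unfolding frac_def by linarith
  qed
qed

lemma summable_eser_norm:
  assumes "s \<notin> \<int>"
  shows "summable (\<lambda>k. norm (z ^ k / (fact k * (of_nat k - of_real s) :: complex)))"
proof -
  obtain d where d: "d > 0" "\<And>k::int. d \<le> \<bar>of_int k - s\<bar>" using dist_Ints_pos[OF assms] by blast
  show ?thesis
  proof (rule summable_comparison_test')
    show "summable (\<lambda>k. norm (z ^ k /\<^sub>R fact k) * (1 / d))"
      by (intro summable_mult2 summable_norm_exp)
    show "norm (norm (z ^ k / (fact k * (of_nat k - of_real s) :: complex))) \<le> norm (z ^ k /\<^sub>R fact k) * (1 / d)" for k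
    proof -
      have "norm (of_nat k - of_real s :: complex) = \<bar>of_int (int k) - s\<bar>"
        by (metis of_int_of_nat_eq of_real_diff of_real_of_nat_eq norm_of_real)
      then have "d \<le> norm (of_nat k - of_real s :: complex)" using d(2)[of "int k"] by simp
      then have "1 / norm (of_nat k - of_real s :: complex) \<le> 1 / d" using d(1) by (simp add: frac_le)
      then have "norm (z ^ k /\<^sub>R fact k) * (1 / norm (of_nat k - of_real s :: complex)) \<le> norm (z ^ k /\<^sub>R fact k) * (1 / d)"
        by (rule mult_left_mono) simp
      moreover have eq: "norm (z ^ k / (fact k * (of_nat k - of_real s) :: complex))
          = norm (z ^ k /\<^sub>R fact k) * (1 / norm (of_nat k - of_real s :: complex))"
        by (simp add: norm_divide norm_mult divide_inverse norm_inverse)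
      ultimately have "norm (z ^ k / (fact k * (of_nat k - of_real s) :: complex)) \<le> norm (z ^ k /\<^sub>R fact k) * (1 / d)"
        by (simp only: eq)
      then show ?thesis by (simp only: real_norm_def abs_norm_cancel)
    qed
  qed
qed

lemma eser_sums:
  assumes "s \<notin> \<int>"
  shows "(\<lambda>k. z ^ k / (fact k * (of_nat k - of_real s))) sums eser s z"
  unfolding eser_def using summable_norm_cancel[OF summable_eser_norm[OF assms]] by (rule summable_sums)

lemma Ints_shift_iff: "s - 1 \<in> \<int> \<longleftrightarrow> (s :: real) \<in> \<int>"
  using Ints_diff[of s 1] Ints_add[of "s - 1" 1] by auto

lemma nonint_shift:
  assumes "(\<mu> :: real) \<notin> \<int>"
  shows "\<mu> + real m \<notin> \<int>" "real m - \<mu> \<notin> \<int>" "\<mu> - real m \<notin> \<int>" "- (\<mu> + real m) \<notin> \<int>"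
proof -
  show 1: "\<mu> + real m \<notin> \<int>" using assms by (metis Ints_diff Ints_of_nat add_diff_cancel_right')
  show 2: "\<mu> - real m \<notin> \<int>" using assms by (metis Ints_add Ints_of_nat diff_add_cancel)
  show "- (\<mu> + real m) \<notin> \<int>" using 1 by (metis minus_in_Ints_iff)
  show "real m - \<mu> \<notin> \<int>" using 2 by (metis minus_diff_eq minus_in_Ints_iff)
qed

text \<open>Formally the fundamental theorem for exp (z x) x^(-s) on [0,1], with only the endpoint 1
  contributing. Termwise, the index shift gives the first series the factor k; the difference then
  has coefficients (k - s)/(k - s) = 1 and is the exponential series.\<close>

lemma eser_rec:
  assumes s: "s \<notin> \<int>"
  shows "z * eser (s - 1) z - of_real s * eser s z = exp z"
proof -
  let ?t = "\<lambda>k. z ^ k / (fact k * (of_nat k - of_real s))"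
  have s1: "s - 1 \<notin> \<int>" using s Ints_shift_iff by blast
  have nz: "of_nat k - complex_of_real s \<noteq> 0" for k
  proof
    assume "of_nat k - complex_of_real s = 0"
    then have "s = of_nat k" by (metis eq_iff_diff_eq_0 of_real_eq_iff of_real_of_nat_eq)
    with s show False by simp
  qed
  have "(\<lambda>k. z * (z ^ k / (fact k * (of_nat k - of_real (s - 1))))) sums (z * eser (s - 1) z)"
    by (intro sums_mult eser_sums s1)
  also have "(\<lambda>k. z * (z ^ k / (fact k * (of_nat k - of_real (s - 1)))))
      = (\<lambda>k. of_nat (Suc k) * (?t (Suc k)))"
  proof
    fix k
    have "of_nat (Suc k) / (fact (Suc k) :: complex) = 1 / fact k"
      by (simp add: divide_simps del: of_nat_Suc)
    then have "of_nat (Suc k) * (?t (Suc k))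
       = 1 / fact k * (z ^ Suc k / (of_nat (Suc k) - of_real s))"
      by (metis (no_types, lifting) mult.commute times_divide_eq_left times_divide_times_eq mult.right_neutral)
    also have "\<dots> = z * (z ^ k / (fact k * (of_nat k - of_real (s - 1))))"
      by (simp add: algebra_simps)
    finally show "z * (z ^ k / (fact k * (of_nat k - of_real (s - 1)))) 
       = of_nat (Suc k) * (?t (Suc k))" by simp
  qed
  finally have "(\<lambda>k. of_nat k * ?t k) sums (z * eser (s - 1) z)"
    by (subst (asm) sums_Suc_iff) simp
  then have "(\<lambda>k. of_nat k * ?t k - of_real s * ?t k)
      sums (z * eser (s - 1) z - of_real s * eser s z)"
    by (intro sums_diff sums_mult eser_sums s)
  also have "(\<lambda>k. of_nat k * ?t k - of_real s * ?t k)
      = (\<lambda>k. z ^ k /\<^sub>R fact k)"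
  proof
    fix k
    have "of_nat k * ?t k - of_real s * ?t k
      = (of_nat k - of_real s) * ?t k" by (simp only: left_diff_distrib)
    also have "\<dots> = z ^ k / fact k" using nz[of k] by simp
    finally show "of_nat k * ?t k - of_real s * ?t k
      = z ^ k /\<^sub>R fact k" by (simp add: scaleR_conv_of_real divide_inverse mult.commute)
  qed
  finally show ?thesis using exp_converges[of z] sums_unique2 by blast
qed

lemma eser_isCont: 
  assumes "s \<notin> \<int>"
  shows "isCont (eser s) z"
proof -
  have "isCont (\<lambda>z. \<Sum>k. 1 / (fact k * (of_nat k - of_real s)) * z ^ k) z"
    by (rule isCont_powser_converges_everywhere) 
       (use summable_norm_cancel[OF summable_eser_norm[OF assms]] in simp)
  then show ?thesis by (simp add: eser_def[abs_def])
qed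

text \<open>Both sides obey the same first-order recurrence in \<open>s\<close>, so the identity propagates from
  \<open>s < -2\<close>, where the path of integration can start at the origin.\<close>

lemma incomplete_Gamma_rec:
  fixes B q :: "real \<Rightarrow> complex"
  assumes B: "\<And>s. s \<notin> \<int> \<Longrightarrow> z * B (s - 1) - of_real s * B s = - exp z"
    and q: "\<And>s. q s = - z * q (s - 1)"
    and base: "\<And>s. s \<notin> \<int> \<Longrightarrow> s < -2 \<Longrightarrow> B s = q s * of_real (Gamma (- s)) - eser s z"
    and s: "s \<notin> \<int>"
  shows "B s = q s * of_real (Gamma (- s)) - eser s z"
proof -
  have "B s = q s * of_real (Gamma (- s)) - eser s z" if "s < -2 + real n" "s \<notin> \<int>" for n s
    using that
  proof (induction n arbitrary: s)
    case 0
    then show ?case using base by simp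
  next
    case (Suc n)
    have s: "s \<notin> \<int>" "s \<noteq> 0" using Suc.prems by auto
    have "s - 1 \<notin> \<int>" using s Ints_shift_iff by blast
    then have IH: "B (s - 1) = q (s - 1) * of_real (Gamma (- (s - 1))) - eser (s - 1) z"
      using Suc.prems by (intro Suc.IH) auto
    have G: "Gamma (- (s - 1)) = - s * Gamma (- s)"
    proof -
      have "- s \<notin> \<int>\<^sub>\<le>\<^sub>0" using s(1) by (metis minus_in_Ints_iff nonpos_Ints_Int)
      then show ?thesis using Gamma_plus1[of "- s"] by simp
    qed
    have "of_real s * B s = z * B (s - 1) + exp z" using B[OF s(1)] by (simp add: algebra_simps)
    also have "\<dots> = z * q (s - 1) * (of_real (- s * Gamma (- s))) - (z * eser (s - 1) z - exp z)"
      by (simp only: IH G right_diff_distrib mult.assoc) simp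
    also have "z * eser (s - 1) z - exp z = of_real s * eser s z"
      using eser_rec[OF s(1), of z] by (simp add: algebra_simps)
    also have "z * q (s - 1) * (of_real (- s * Gamma (- s))) = of_real s * (q s * of_real (Gamma (- s)))"
      by (subst q[of s]) simp
    finally have "of_real s * B s = of_real s * (q s * of_real (Gamma (- s)) - eser s z)"
      by (simp only: right_diff_distrib)
    then show ?case
      by (rule mult_left_cancel[THEN iffD1, rotated]) (use s in simp)
  qed
  moreover obtain n where "s < -2 + real n" using reals_Archimedean2[of "s + 2"] by (auto simp: algebra_simps)
  ultimately show ?thesis using s by blast
qed

text \<open>In this range of \<open>s\<close> the formal meaning of \<open>eser\<close> is literal:
  x^(k-s-1) integrates to 1/(k - s), and x^(-s-1) \<le> 1 on [0,1] lets the exponential series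
  dominate.\<close>

lemma LINT_unit_exp_powr:
  fixes s :: real and z :: complex
  assumes s: "s < -1" "s \<notin> \<int>"
  shows "(LINT x:{0..1}|lborel. exp (z * of_real x) * of_real (x powr (- s - 1))) = eser s z"
proof -
  let ?f = "\<lambda>k x. (z * of_real x) ^ k /\<^sub>R fact k * complex_of_real (x powr (- s - 1))"
  have i: "((\<lambda>x. x powr (real k - s - 1)) has_integral (1 / (real k - s))) {0..1}" for k
    using has_integral_powr_from_0[of "real k - s - 1" 1] s by simp
  have "(LINT x:{0..1}|lborel. ?f k x) = z ^ k / (fact k * (of_nat k - of_real s))" for k
  proof -
    have "(LINT x:{0..1}|lborel. ?f k x) = (LINT x:{0..1}|lborel. (z ^ k / fact k) * complex_of_real (x powr (real k - s - 1)))"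
    proof (intro set_lebesgue_integral_cong ballI allI impI)
      fix x :: real assume "x \<in> {0..1}"
      moreover have "x powr real k * x powr (- s - 1) = x powr (real k - s - 1)"
        by (simp add: powr_add[symmetric] algebra_simps)
      \<comment> \<open>At x = 0 both sides vanish, because \<open>0 powr p\<close> is 0 for every
        p, including p = 0.\<close>
      moreover have "x ^ k * x powr (- s - 1) = x powr real k * x powr (- s - 1)" if "x \<ge> 0"
        using that s by (cases "x = 0") (auto simp: powr_realpow)
      ultimately have *: "x ^ k * x powr (- s - 1) = x powr (real k - s - 1)" by simp
      have "?f k x = (z ^ k / fact k) * complex_of_real (x ^ k * x powr (- s - 1))"
        by (simp add: scaleR_conv_of_real power_mult_distrib divide_inverse mult_ac)
      then show "?f k x = (z ^ k / fact k) * complex_of_real (x powr (real k - s - 1))" unfolding * .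
    qed simp
    also have "\<dots> = (z ^ k / fact k) * complex_of_real (LINT x:{0..1}|lborel. x powr (real k - s - 1))"
      by (simp add: set_integral_complex_of_real)
    also have "(LINT x:{0..1}|lborel. x powr (real k - s - 1)) = 1 / (real k - s)"
    proof -
      have "set_integrable lborel {0..1} (\<lambda>x. x powr (real k - s - 1))"
        by (intro borel_integrable_atLeastAtMost' continuous_on_powr' continuous_on_id continuous_on_const)
           (use s in auto)
      then show ?thesis using set_borel_integral_eq_integral(2) integral_unique[OF i] by metis
    qed
    finally show ?thesis by simp
  qed
  moreover have "(\<lambda>k. LINT x:{0..1}|lborel. ?f k x) sums 
     (LINT x:{0..1}|lborel. exp (z * of_real x) * of_real (x powr (- s - 1)))"
  proof (rule sums_set_lebesgue_integral_dominated(1))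
    show "set_borel_measurable lborel {0..1} (?f k)" for k
      unfolding set_borel_measurable_def by measurable
    show "set_integrable lborel {0..1} (\<lambda>x::real. 1::real)"
      by (intro borel_integrable_atLeastAtMost' continuous_intros)
    show "summable (\<lambda>k. norm (z ^ k /\<^sub>R fact k))" by (rule summable_norm_exp)
    fix x :: real assume x: "x \<in> {0..1}"
    show "(\<lambda>k. ?f k x) sums (exp (z * of_real x) * of_real (x powr (- s - 1)))"
      by (intro sums_mult2 exp_converges)
    have "norm (?f k x) = norm (z ^ k /\<^sub>R fact k) * (x ^ k * x powr (- s - 1))" for k
      using x by (simp add: norm_mult norm_power power_mult_distrib)
    moreover have "x ^ k * x powr (- s - 1) \<le> 1" for k
      using x s by (intro mult_le_one power_le_one powr_le1) auto
    ultimately show "norm (?f k x) \<le> norm (z ^ k /\<^sub>R fact k) * 1" for k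
      by (simp only:) (intro mult_left_mono, auto)
  qed
  ultimately show ?thesis using sums_unique2[OF _ eser_sums[OF s(2)]] by simp
qed

section \<open>Integrals along rays starting at 1\<close>

lemma set_integrable_exp_powr_shift:
  fixes p a :: real
  assumes p: "p \<ge> 0" and a: "a > 0"
  shows "set_integrable lborel {0..} (\<lambda>y. exp (- a * y) * (1 + y) powr p)"
proof -
  have "set_integrable lborel {1..} (\<lambda>y. exp (- a * y) * y powr p)"
    by (rule set_integrable_subset[OF set_integrable_exp_powr]) (use p a in auto)
  then have "integrable lborel (\<lambda>y. indicator {1..} (1 + 1 * y) *\<^sub>R (exp (- a * (1 + 1 * y)) * (1 + 1 * y) powr p))"
    unfolding set_integrable_def by (rule lborel_integrable_real_affine) simp
  then have "integrable lborel (\<lambda>y. exp a * (indicator {1..} (1 + 1 * y) *\<^sub>R (exp (- a * (1 + 1 * y)) * (1 + 1 * y) powr p)))"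
    by (rule integrable_mult_right)
  also have "(\<lambda>y. exp a * (indicator {1..} (1 + 1 * y) *\<^sub>R (exp (- a * (1 + 1 * y)) * (1 + 1 * y) powr p)))
     = (\<lambda>y. indicator {0..} y *\<^sub>R (exp (- a * y) * (1 + y) powr p))"
  proof
    fix y :: real
    have "exp a * exp (- a * (1 + 1 * y)) = exp (- a * y)"
      unfolding exp_add[symmetric] by (simp add: algebra_simps)
    then have e: "exp a * (exp (- a * (1 + 1 * y)) * P) = exp (- a * y) * P" for P
      by (simp only: mult.assoc[symmetric])
    then show "exp a * (indicator {1..} (1 + 1 * y) *\<^sub>R (exp (- a * (1 + 1 * y)) * (1 + 1 * y) powr p))
       = indicator {0..} y *\<^sub>R (exp (- a * y) * (1 + y) powr p)"
    proof (cases "y \<ge> 0")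
      case True
      then have "indicator {1..} (1 + 1 * y) = (1::real)" "indicator {0..} y = (1::real)" "1 + 1 * y = 1 + y" by simp_all
      then show ?thesis using e by (simp only: scaleR_one)
    qed simp
  qed
  finally show ?thesis unfolding set_integrable_def .
qed

lemma set_integrable_powr_shift:
  fixes p :: real
  assumes p: "p < -1"
  shows "set_integrable lborel {0..} (\<lambda>y. (1 + y) powr p)"
proof -
  have "((\<lambda>x. x powr p) has_integral -(1 powr (p+1)) / (p+1)) {1..}"
    by (rule has_integral_powr_to_inf) (use p in auto)
  then have "(\<lambda>x. x powr p) absolutely_integrable_on {1..}"
    by (intro nonnegative_absolutely_integrable_1) auto
  then have "set_integrable lborel {1..} (\<lambda>x. x powr p)"
    unfolding set_integrable_def by (subst (asm) integrable_completion) auto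
  then have "integrable lborel (\<lambda>y. indicator {1..} (1 + 1 * y) *\<^sub>R (1 + 1 * y) powr p)"
    unfolding set_integrable_def by (rule lborel_integrable_real_affine) simp
  also have "(\<lambda>y. indicator {1..} (1 + 1 * y) *\<^sub>R (1 + 1 * y) powr p) = (\<lambda>y. indicator {0..} y *\<^sub>R (1 + y) powr p)"
    by (auto simp: indicator_def)
  finally show ?thesis unfolding set_integrable_def .
qed

text \<open>The contour integral of exp (z \<sigma>) \<sigma>^(-s-1) along the ray from 1 in
  direction \<open>d\<close>. For d = 1 and z = -c it is c^s times the upper incomplete Gamma
  function \<Gamma>(-s, c); d = \<i> is the vertical part of the path.\<close>

definition ray_integral :: "complex \<Rightarrow> complex \<Rightarrow> real \<Rightarrow> complex" where
  "ray_integral d z s = (LINT y:{0..}|lborel. d * (exp (z * (1 + d * of_real y)) * (1 + d * of_real y) powr of_real (- s - 1)))"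

lemma ray_not_nonpos:
  assumes "Re d \<ge> 0" "y \<ge> 0"
  shows "1 + d * complex_of_real y \<notin> \<real>\<^sub>\<le>\<^sub>0" "1 + d * complex_of_real y \<noteq> 0"
proof -
  have "Re (1 + d * complex_of_real y) \<ge> 1" using assms by simp
  then show "1 + d * complex_of_real y \<notin> \<real>\<^sub>\<le>\<^sub>0" "1 + d * complex_of_real y \<noteq> 0"
    by (force simp: complex_nonpos_Reals_iff)+
qed

text \<open>The modulus of 1 + d y lies between 1 and 1 + y, so the exponent \<bar>p\<bar> gives an
  upper bound for either sign of p.\<close>

lemma norm_ray_powr_le:
  assumes "Re d \<ge> 0" "norm d = 1" "y \<ge> 0"
  shows "norm ((1 + d * complex_of_real y) powr of_real p) \<le> (1 + y) powr \<bar>p\<bar>"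
proof -
  have 1: "norm (1 + d * complex_of_real y) \<ge> 1"
    using complex_Re_le_cmod[of "1 + d * complex_of_real y"] mult_nonneg_nonneg[OF assms(1,3)] by simp
  have 2: "norm (1 + d * complex_of_real y) \<le> 1 + y"
    using norm_triangle_ineq[of 1 "d * complex_of_real y"] assms by (simp add: norm_mult)
  have "norm (1 + d * complex_of_real y) powr p \<le> norm (1 + d * complex_of_real y) powr \<bar>p\<bar>"
    using 1 by (intro powr_mono) auto
  also have "\<dots> \<le> (1 + y) powr \<bar>p\<bar>"
    using 2 by (intro powr_mono2) auto
  finally show ?thesis by (simp add: norm_powr_real_powr')
qed

lemma norm_ray_exp: "norm (exp (z * (1 + d * complex_of_real y))) = exp (Re z) * exp (Re (z * d) * y)"
  by (simp add: exp_add[symmetric] algebra_simps)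

lemma ray_integrand_measurable:
  assumes "Re d \<ge> 0"
  shows "set_borel_measurable lborel {0..} (\<lambda>y. d * (exp (z * (1 + d * of_real y)) * (1 + d * of_real y) powr of_real p))"
  by (intro set_borel_measurable_lborel_continuous continuous_intros)
     (use assms ray_not_nonpos in \<open>auto simp: mult_nonneg_nonneg\<close>)

lemma ray_integrable:
  assumes d: "Re d \<ge> 0" "norm d = 1" and z: "Re (z * d) < 0"
  shows "set_integrable lborel {0..} (\<lambda>y. d * (exp (z * (1 + d * of_real y)) * (1 + d * of_real y) powr of_real p))"
proof -
  have "set_integrable lborel {0..} (\<lambda>y. exp (Re z) * (exp (- (- Re (z * d)) * y) * (1 + y) powr \<bar>p\<bar>))"
    by (intro set_integrable_mult_right set_integrable_exp_powr_shift) (use z in auto)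
  then show ?thesis
  proof (rule set_integrable_bound)
    show "AE y in lborel. y \<in> {0..} \<longrightarrow> norm (d * (exp (z * (1 + d * of_real y)) * (1 + d * of_real y) powr of_real p)) 
       \<le> norm (exp (Re z) * (exp (- (- Re (z * d)) * y) * (1 + y) powr \<bar>p\<bar>))"
      using norm_ray_powr_le[OF d, of _ p] 
      by (intro AE_I2) (auto simp: norm_mult d norm_ray_exp simp del: norm_exp_eq_Re)
  qed (rule ray_integrand_measurable[OF d(1)])
qed

lemma tendsto_exp_powr_shift:
  fixes p a :: real
  assumes "a > 0"
  shows "((\<lambda>y. exp (- a * y) * (1 + y) powr p) \<longlongrightarrow> 0) at_top"
  using assms by real_asymp

text \<open>The fundamental theorem for exp (z \<sigma>) \<sigma>^(-s) along the ray, whose start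
  contributes -exp z. In \<open>eser_rec\<close> the same point is the end and contributes exp z, so
  the sum of the two functions satisfies the homogeneous recurrence of the complete Gamma
  function.\<close>

lemma ray_integral_rec:
  assumes d: "Re d \<ge> 0" "norm d = 1" and z: "Re (z * d) < 0"
  shows "z * ray_integral d z (s - 1) - of_real s * ray_integral d z s = - exp z"
proof -
  let ?w = "\<lambda>y. 1 + d * complex_of_real y"
  let ?F = "\<lambda>y. exp (z * ?w y) * ?w y powr of_real (- s)"
  let ?g = "\<lambda>s y. d * (exp (z * ?w y) * ?w y powr of_real (- s - 1))"
  let ?f = "\<lambda>y. z * ?g (s - 1) y - of_real s * ?g s y"
  have int: "set_integrable lborel {0..} ?f"
    using ray_integrable[OF d z, of "-s"] ray_integrable[OF d z, of "-s-1"] by (intro set_integral_diff set_integrable_mult_right) auto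
  have der: "(?F has_vector_derivative ?f y) (at y)" if "y \<ge> 0" for y
  proof -
    have "((\<lambda>u. exp (z * (1 + d * u)) * (1 + d * u) powr of_real (- s)) has_field_derivative ?f y) (at (complex_of_real y))"
      using ray_not_nonpos[OF d(1) that]
      by (auto intro!: derivative_eq_intros simp: algebra_simps)
    then show ?thesis by (rule has_vector_derivative_real_field)
  qed
  have cont: "isCont ?f y" if "y \<ge> 0" for y
    using ray_not_nonpos[OF d(1) that] by (auto intro!: continuous_intros)
  have lim: "(?F \<longlongrightarrow> 0) at_top"
  proof (rule Lim_null_comparison)
    show "((\<lambda>y. exp (Re z) * (exp (- (- Re (z * d)) * y) * (1 + y) powr \<bar>- s\<bar>)) \<longlongrightarrow> 0) at_top"
      by (intro tendsto_mult_right_zero tendsto_exp_powr_shift) (use z in simp)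
    show "\<forall>\<^sub>F y in at_top. norm (?F y) \<le> exp (Re z) * (exp (- (- Re (z * d)) * y) * (1 + y) powr \<bar>- s\<bar>)"
      using eventually_ge_at_top[of 0]
    proof eventually_elim
      case (elim y)
      show ?case using norm_ray_powr_le[OF d elim, of "- s"] 
        by (simp add: norm_mult norm_ray_exp del: norm_exp_eq_Re)
    qed
  qed
  have "(LBINT y=0..\<infinity>. ?f y) = 0 - exp z"
  proof (rule interval_integral_FTC_integrable[where F="?F"])
    show "(?F has_vector_derivative ?f y) (at y)" if "0 < ereal y" for y using der that by simp
    show "isCont ?f y" if "0 < ereal y" for y using cont that by simp
    show "set_integrable lborel (einterval 0 \<infinity>) ?f"
      by (rule set_integrable_subset[OF int]) (auto simp: einterval_def)
    have "isCont ?F 0" using der[of 0] by (auto intro: has_vector_derivative_continuous)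
    then have "(?F \<longlongrightarrow> exp z) (at_right 0)"
      by (auto simp: isCont_def intro: tendsto_mono[OF at_le])
    then show "((?F \<circ> real_of_ereal) \<longlongrightarrow> exp z) (at_right 0)"
      unfolding zero_ereal_def ereal_tendsto_simps .
    show "((?F \<circ> real_of_ereal) \<longlongrightarrow> 0) (at_left \<infinity>)"
      using lim unfolding ereal_tendsto_simps .
  qed simp
  moreover have "(LBINT y=0..\<infinity>. ?f y) = (LINT y:{0..}|lborel. ?f y)"
    unfolding zero_ereal_def interval_integral_to_infinity_eq
    by (rule AE_set_integral_Ici_Ioi[symmetric], use int in \<open>simp add: set_integrable_def set_borel_measurable_def\<close>)
  moreover have "(LINT y:{0..}|lborel. ?f y) = z * ray_integral d z (s - 1) - of_real s * ray_integral d z s"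
    unfolding ray_integral_def using ray_integrable[OF d z, of "-s"] ray_integrable[OF d z, of "-s-1"]
    by (simp add: set_integral_diff)
  ultimately show ?thesis by simp
qed

lemma ray_integral_one_eq:
  fixes c s :: real
  assumes "c > 0"
  shows "ray_integral 1 (- of_real c) s = of_real (LINT v:{1..}|lborel. exp (- c * v) * v powr (- s - 1))"
proof -
  have "ray_integral 1 (- of_real c) s = (LINT y:{0..}|lborel. complex_of_real (exp (- c * (1 + y)) * (1 + y) powr (- s - 1)))"
    unfolding ray_integral_def
  proof (intro set_lebesgue_integral_cong ballI allI impI)
    fix y :: real assume y: "y \<in> {0..}"
    then have "complex_of_real (1 + y) powr of_real (- s - 1) = of_real ((1 + y) powr (- s - 1))"
      by (intro powr_of_real) auto
    moreover have "exp (- complex_of_real c * (1 + 1 * of_real y)) = of_real (exp (- c * (1 + y)))"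
      by (simp flip: exp_of_real)
    ultimately show "1 * (exp (- complex_of_real c * (1 + 1 * of_real y)) * (1 + 1 * of_real y) powr of_real (- s - 1)) = of_real (exp (- c * (1 + y)) * (1 + y) powr (- s - 1))"
      by simp
  qed simp
  also have "\<dots> = of_real (LINT y:{0..}|lborel. exp (- c * (1 + y)) * (1 + y) powr (- s - 1))"
    by (rule set_integral_complex_of_real)
  also have "(LINT y:{0..}|lborel. exp (- c * (1 + y)) * (1 + y) powr (- s - 1)) = (LINT v:{1..}|lborel. exp (- c * v) * v powr (- s - 1))"
    unfolding set_lebesgue_integral_def
    by (subst (2) lborel_integral_real_affine[of 1 _ 1])
       (auto simp: indicator_def intro!: Bochner_Integration.integral_cong)
  finally show ?thesis .
qed

text \<open>The power is integrable at 0 in this range, so the integral from 1 is the complete Gamma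
  integral minus the part over [0,1], which is \<open>eser\<close>.\<close>

lemma ray_integral_real_base:
  fixes c s :: real
  assumes c: "c > 0" and s: "s < -2" "s \<notin> \<int>"
  shows "ray_integral 1 (- of_real c) s = of_real (c powr s) * of_real (Gamma (- s)) - eser s (- of_real c)"
proof -
  let ?h = "\<lambda>x. exp (- of_real c * of_real x) * complex_of_real (x powr (- s - 1))"
  have int: "set_integrable lborel {0..} ?h"
    by (rule LINT_exp_powr(1)) (use s c in auto)
  have "ray_integral 1 (- of_real c) s = (LINT y:{1..}|lborel. ?h y)"
    unfolding ray_integral_one_eq[OF c] set_integral_complex_of_real[symmetric] by (simp flip: exp_of_real)
  also have "\<dots> = (LINT y:{1<..}|lborel. ?h y)"
    by (rule AE_set_integral_Ici_Ioi, rule set_borel_measurable_lborel_continuous)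
       (auto intro!: continuous_intros)
  also have "\<dots> = (LINT y:{0..}|lborel. ?h y) - (LINT y:{0..1}|lborel. ?h y)"
  proof -
    have "{0::real..} = {0..1} \<union> {1<..}" by auto
    moreover have "(LINT y:{0..1} \<union> {1<..}|lborel. ?h y) = (LINT y:{0..1}|lborel. ?h y) + (LINT y:{1<..}|lborel. ?h y)"
      by (intro set_integral_Un set_integrable_subset[OF int]) auto
    ultimately show ?thesis by simp
  qed
  also have "(LINT y:{0..1}|lborel. ?h y) = eser s (- of_real c)"
    by (rule LINT_unit_exp_powr) (use s in auto)
  also have "(LINT y:{0..}|lborel. ?h y) = of_real (Gamma (- s)) * of_real c powr of_real s"
    using LINT_exp_powr(2)[of "- s - 1" "of_real c"] s c by simp
  also have "complex_of_real c powr of_real s = of_real (c powr s)"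
    using c by (simp add: powr_of_real)
  finally show ?thesis by simp
qed

lemma ray_integral_real:
  fixes c s :: real
  assumes c: "c > 0" and s: "s \<notin> \<int>"
  shows "ray_integral 1 (- of_real c) s = of_real (c powr s) * of_real (Gamma (- s)) - eser s (- of_real c)"
proof (rule incomplete_Gamma_rec[OF _ _ _ s])
  show "- of_real c * ray_integral 1 (- of_real c) (s - 1) - of_real s * ray_integral 1 (- of_real c) s = - exp (- of_real c)" for s
    by (rule ray_integral_rec) (use c in auto)
  show "complex_of_real (c powr s) = - (- of_real c) * of_real (c powr (s - 1))" for s
    using c by (simp add: powr_diff)
qed (use ray_integral_real_base[OF c] in auto)

text \<open>Cauchy's theorem replaces the vertical ray from 1 by the imaginary axis minus [0,1].
  Writing the rate as \<i> w makes the exponential on the axis exp (-w y), a Gamma integral that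
  converges for Re w > 0; the phase of the powers of \<i> y gives
  \<open>\<i> powr of_real (- s)\<close>.\<close>

lemma ray_integral_imag_base:
  fixes s :: real
  assumes w: "Re w > 0" and s: "s < -2" "s \<notin> \<int>"
  shows "ray_integral \<i> (\<i> * w) s = \<i> powr of_real (- s) * w powr of_real s * of_real (Gamma (- s)) - eser s (\<i> * w)"
proof -
  let ?b = "\<lambda>y. exp (norm w) * (exp (- Re w * y) * (1 + y) powr (- s - 1))"
  let ?h = "\<lambda>\<sigma>. exp (\<i> * w * \<sigma>) * \<sigma> powr of_real (- s - 1)"
  \<comment> \<open>A positive exponent makes the integrand continuous at the corner 0 of the strip,
    as the contour lemma demands.\<close>
  have p: "- s - 1 > 1" using s by simp
  have hb: "norm (?h \<sigma>) \<le> ?b (Im \<sigma>)"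
    if "0 \<le> Re \<sigma>" "Re \<sigma> \<le> 1" "0 \<le> Im \<sigma>" for \<sigma>
  proof -
    have "Re (\<i> * w * \<sigma>) = - Im w * Re \<sigma> + - Re w * Im \<sigma>" by simp
    moreover have "- Im w * Re \<sigma> \<le> norm w"
    proof -
      have "- Im w * Re \<sigma> \<le> \<bar>Im w\<bar> * 1" using that by (intro mult_mono) auto
      then show ?thesis using abs_Im_le_cmod[of w] by simp
    qed
    ultimately have 1: "norm (exp (\<i> * w * \<sigma>)) \<le> exp (norm w) * exp (- Re w * Im \<sigma>)"
      by (simp flip: exp_add)
    have "norm \<sigma> \<le> 1 + Im \<sigma>" using cmod_le[of \<sigma>] that by simp
    then have "norm (\<sigma> powr of_real (- s - 1)) \<le> (1 + Im \<sigma>) powr (- s - 1)"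
      using p by (subst norm_powr_real_powr') (auto intro!: powr_mono2)
    then show ?thesis unfolding norm_mult mult.assoc[symmetric] by (intro mult_mono 1) auto
  qed
  have strip: "(LINT x:{0..1}|lborel. ?h (of_real x)) + \<i> * (LINT y:{0..}|lborel. ?h (Complex 1 y))
      = \<i> * (LINT y:{0..}|lborel. ?h (Complex 0 y))"
  proof (rule half_strip_integral[where b="?b"])
    show "norm (?h \<sigma>) \<le> ?b (Im \<sigma>)"
      if "0 \<le> Re \<sigma>" "Re \<sigma> \<le> 1" "0 \<le> Im \<sigma>" for \<sigma> using that by (rule hb)
    show "continuous_on {z. 0 \<le> Re z \<and> Re z \<le> 1 \<and> 0 \<le> Im z} ?h"
      by (intro continuous_intros) (use p in auto)
    show "?h holomorphic_on {z. 0 < Re z \<and> Re z < 1 \<and> 0 < Im z}"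
      by (intro holomorphic_intros) (auto simp: complex_nonpos_Reals_iff)
    show "(?b \<longlongrightarrow> 0) at_top"
      by (intro tendsto_mult_right_zero tendsto_exp_powr_shift w)
    have dom: "set_integrable lborel {0..} ?b"
      by (intro set_integrable_mult_right set_integrable_exp_powr_shift) (use w p in auto)
    have "set_integrable lborel {0..} (\<lambda>y. ?h (Complex c y))" if "c = 0 \<or> c = 1" for c
      using dom
    proof (rule set_integrable_bound)
      show "AE y in lborel. y \<in> {0..} \<longrightarrow> norm (?h (Complex c y)) \<le> norm (?b y)"
        using hb[of "Complex c _"] that by (intro AE_I2 impI) auto
    next
      show "set_borel_measurable lborel {0..} (\<lambda>y. ?h (Complex c y))"
        unfolding Complex_eq
        by (intro set_borel_measurable_lborel_continuous continuous_intros) (use that p in auto)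
    qed
    then show "set_integrable lborel {0..} (\<lambda>y. ?h (Complex 0 y))" "set_integrable lborel {0..} (\<lambda>y. ?h (Complex 1 y))"
      by simp_all
  qed
  have "(LINT x:{0..1}|lborel. ?h (of_real x)) = (LINT x:{0..1}|lborel. exp (\<i> * w * of_real x) * of_real (x powr (- s - 1)))"
    by (intro set_lebesgue_integral_cong) (auto simp: powr_of_real[symmetric])
  also have "\<dots> = eser s (\<i> * w)"
    by (rule LINT_unit_exp_powr) (use s in auto)
  finally have 1: "(LINT x:{0..1}|lborel. ?h (of_real x)) = eser s (\<i> * w)" .
  have 2: "\<i> * (LINT y:{0..}|lborel. ?h (Complex 1 y)) = ray_integral \<i> (\<i> * w) s"
    unfolding ray_integral_def set_integral_mult_right[symmetric] Complex_eq by simp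
  have "(LINT y:{0..}|lborel. ?h (Complex 0 y)) = (LINT y:{0..}|lborel. \<i> powr of_real (- s - 1) * (exp (- w * of_real y) * of_real (y powr (- s - 1))))"
  proof (intro set_lebesgue_integral_cong ballI allI impI)
    fix y :: real assume y: "y \<in> {0..}"
    have "(complex_of_real y * \<i>) powr of_real (- s - 1) = of_real y powr of_real (- s - 1) * \<i> powr of_real (- s - 1)"
      by (rule powr_times_real_left) (use y in auto)
    moreover have "complex_of_real y powr of_real (- s - 1) = of_real (y powr (- s - 1))"
      using y by (intro powr_of_real) auto
    moreover have "Complex 0 y = of_real y * \<i>" by (simp add: Complex_eq mult.commute)
    moreover have "\<i> * w * (of_real y * \<i>) = - w * of_real y" by (simp add: algebra_simps)
    ultimately show "?h (Complex 0 y) = \<i> powr of_real (- s - 1) * (exp (- w * of_real y) * of_real (y powr (- s - 1)))"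
      by (simp only: mult_ac)
  qed simp
  also have "\<dots> = \<i> powr of_real (- s - 1) * (of_real (Gamma (- s)) * w powr of_real s)"
    using LINT_exp_powr(2)[of "- s - 1" w] w p by (simp only: set_integral_mult_right) simp
  finally have "\<i> * (LINT y:{0..}|lborel. ?h (Complex 0 y)) = \<i> * \<i> powr of_real (- s - 1) * (of_real (Gamma (- s)) * w powr of_real s)"
    by simp
  also have "\<i> * \<i> powr of_real (- s - 1) = \<i> powr of_real (- s)"
    by (simp add: powr_diff)
  finally show ?thesis using strip 1 2 by (simp add: algebra_simps)
qed

lemma ray_integral_imag:
  fixes s :: real
  assumes w: "Re w > 0" and s: "s \<notin> \<int>"
  shows "ray_integral \<i> (\<i> * w) s = \<i> powr of_real (- s) * w powr of_real s * of_real (Gamma (- s)) - eser s (\<i> * w)"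
proof (rule incomplete_Gamma_rec[OF _ _ _ s, where q="\<lambda>s. \<i> powr of_real (- s) * w powr of_real s"])
  show "\<i> * w * ray_integral \<i> (\<i> * w) (s - 1) - of_real s * ray_integral \<i> (\<i> * w) s = - exp (\<i> * w)" for s
    by (rule ray_integral_rec) (use w in auto)
  show "\<i> powr of_real (- s) * w powr of_real s = - (\<i> * w) * (\<i> powr of_real (- (s - 1)) * w powr of_real (s - 1))" for s
  proof -
    have "w \<noteq> 0" using w by auto
    then have "w * w powr of_real (s - 1) = w powr of_real s" by (simp add: powr_diff)
    moreover have "\<i> powr of_real (- (s - 1)) = \<i> * \<i> powr of_real (- s)"
      by (simp add: powr_add[symmetric] powr_diff powr_minus field_simps)
    moreover have "- (\<i> * w) * (\<i> * \<i> powr of_real (- s) * w powr of_real (s - 1)) = \<i> powr of_real (- s) * (w * w powr of_real (s - 1))"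
      by (simp add: mult.assoc[symmetric]) (simp add: mult_ac)
    ultimately show ?thesis by (simp only:)
  qed
qed (use ray_integral_imag_base[OF w] in auto)

section \<open>Contour integrals for the Hankel functions\<close>

lemma norm_one_plus_ii_ge:
  assumes "y \<ge> 0"
  shows "(1 + y) / 2 \<le> norm (1 + \<i> * complex_of_real y)" "1 \<le> norm (1 + \<i> * complex_of_real y)"
proof -
  have "1 \<le> norm (1 + \<i> * complex_of_real y)" using complex_Re_le_cmod[of "1 + \<i> * complex_of_real y"] by simp
  moreover have "y \<le> norm (1 + \<i> * complex_of_real y)" using abs_Im_le_cmod[of "1 + \<i> * complex_of_real y"] by simp
  ultimately show "(1 + y) / 2 \<le> norm (1 + \<i> * complex_of_real y)" "1 \<le> norm (1 + \<i> * complex_of_real y)" by auto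
qed

lemma norm_one_plus_ii_powr_le:
  assumes "y \<ge> 0" "p \<le> 0"
  shows "norm ((1 + \<i> * complex_of_real y) powr of_real p) \<le> 2 powr (- p) * (1 + y) powr p"
proof -
  have "norm ((1 + \<i> * complex_of_real y) powr of_real p) = norm (1 + \<i> * complex_of_real y) powr p"
    by (subst norm_powr_real_powr') auto
  also have "\<dots> \<le> ((1 + y) / 2) powr p"
    using norm_one_plus_ii_ge[OF assms(1)] assms by (intro powr_mono2') auto
  also have "\<dots> = 2 powr (- p) * (1 + y) powr p"
    using assms by (simp add: powr_divide powr_minus field_simps)
  finally show ?thesis .
qed

text \<open>Here \<open>z = k\<close> is on the boundary of the half-plane where the integral converges for every \<open>s\<close>.\<close>

lemma ray_integral_imag_limit:
  fixes k s :: real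
  assumes k: "k > 0" and s: "s > 0" "s \<notin> \<int>"
  shows "ray_integral \<i> (of_real k) s = of_real (k powr s) * exp (- \<i> * pi * of_real s) * of_real (Gamma (- s)) - eser s (of_real k)"
proof -
  let ?f = "\<lambda>z y. indicator {0..} y *\<^sub>R (\<i> * (exp (z * (1 + \<i> * of_real y)) * (1 + \<i> * of_real y) powr of_real (- s - 1)))"
  \<comment> \<open>These have positive real part, and \<i> w_n = k + \<i>/(n+1) tends to k, so the
    boundary rate is approached from inside the half-plane of convergence.\<close>
  let ?w = "\<lambda>n. of_real (1 / (real n + 1)) - \<i> * complex_of_real k"
  let ?z = "\<lambda>n. \<i> * ?w n"
  have wlim: "?w \<longlonglongrightarrow> 0 - \<i> * complex_of_real k"
  proof (intro tendsto_diff tendsto_const)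
    have "(\<lambda>n. 1 / (real n + 1)) \<longlonglongrightarrow> 0" using LIMSEQ_inverse_real_of_nat by (simp add: inverse_eq_divide add.commute)
    from tendsto_of_real[OF this, where 'a=complex] show "(\<lambda>n. complex_of_real (1 / (real n + 1))) \<longlonglongrightarrow> 0" by simp
  qed
  then have zlim: "?z \<longlonglongrightarrow> of_real k"
    using tendsto_mult[OF tendsto_const[of "\<i>"] wlim] by (simp add: algebra_simps)
  have L1: "(\<lambda>n. ray_integral \<i> (?z n) s) \<longlonglongrightarrow> ray_integral \<i> (of_real k) s"
    unfolding ray_integral_def set_lebesgue_integral_def
  proof (rule integral_dominated_convergence)
    \<comment> \<open>The exponential has modulus exp (k - y/(n+1)), at most exp k uniformly in n.
      Integrability comes from the power alone, whose exponent -s-1 is below -1 because s >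
      0.\<close>
    let ?dom = "\<lambda>y. indicator {0..} y *\<^sub>R (exp k * (2 powr (s + 1) * (1 + y) powr (- s - 1)))"
    show "integrable lborel ?dom"
      using set_integrable_powr_shift[of "- s - 1"] s unfolding set_integrable_def
      by (simp add: mult.left_commute[of "indicator _ _"])
    show "AE y in lborel. (\<lambda>n. ?f (?z n) y)
      \<longlonglongrightarrow> ?f (of_real k) y"
      by (intro AE_I2 tendsto_intros zlim)
    show "AE y in lborel. norm (?f (?z n) y) \<le> ?dom y" for n
    proof (rule AE_I2)
      fix y :: real
      show "norm (?f (?z n) y) \<le> ?dom y"
      proof (cases "y \<ge> 0")
        case True
        have "Re (?z n * (1 + \<i> * of_real y)) = k - y / (real n + 1)" by simp
        also have "\<dots> \<le> k" using True by simp
        finally have "norm (exp (?z n * (1 + \<i> * of_real y))) \<le> exp k" by simp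
        then have "norm (exp (?z n * (1 + \<i> * of_real y))) * norm ((1 + \<i> * complex_of_real y) powr of_real (- s - 1)) 
           \<le> exp k * (2 powr (- (- s - 1)) * (1 + y) powr (- s - 1))"
          using norm_one_plus_ii_powr_le[OF True, of "- s - 1"] s by (intro mult_mono) auto
        then show ?thesis using True by (simp add: norm_mult add.commute del: norm_exp_eq_Re)
      qed simp
    qed
  qed (use ray_integrand_measurable[of \<i>, unfolded set_borel_measurable_def] in auto)
  have eq: "(\<lambda>n. ray_integral \<i> (?z n) s) = (\<lambda>n. \<i> powr of_real (- s) * ?w n powr of_real s * of_real (Gamma (- s)) - eser s (?z n))"
    by (intro ext ray_integral_imag s) (simp add: add_pos_nonneg)
  have L2: "(\<lambda>n. \<i> powr of_real (- s) * ?w n powr of_real s * of_real (Gamma (- s)) - eser s (?z n)) \<longlonglongrightarrow>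
      \<i> powr of_real (- s) * (0 - \<i> * complex_of_real k) powr of_real s * of_real (Gamma (- s)) - eser s (of_real k)"
    by (intro tendsto_intros wlim isCont_tendsto_compose[OF eser_isCont[OF s(2)]] zlim)
       (use k in \<open>auto simp: complex_nonpos_Reals_iff\<close>)
  \<comment> \<open>The principal logarithm of -\<i> k is ln k - \<i> pi/2. Together with the factor
    \<open>\<i> powr of_real (- s)\<close> the two quarter turns add up to exp (-\<i> pi s).\<close>
  have "\<i> powr of_real (- s) * (0 - \<i> * complex_of_real k) powr of_real s = of_real (k powr s) * exp (- \<i> * pi * of_real s)"
  proof -
    have "Ln (0 - \<i> * complex_of_real k) = Ln (of_real k * (- \<i>))" by (simp add: mult.commute)
    also have "\<dots> = of_real (ln k) + Ln (- \<i>)" using k by (subst Ln_times_of_real) (auto simp: Ln_of_real)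
    finally have "(0 - \<i> * complex_of_real k) powr of_real s = exp (of_real s * (of_real (ln k) - \<i> * pi / 2))"
      using k by (simp add: powr_def Ln_of_real)
    moreover have "\<i> powr of_real (- s) = exp (- of_real s * (\<i> * pi / 2))" by (simp add: powr_def)
    ultimately have "\<i> powr of_real (- s) * (0 - \<i> * complex_of_real k) powr of_real s 
       = exp (- of_real s * (\<i> * pi / 2) + of_real s * (of_real (ln k) - \<i> * pi / 2))"
      by (simp only: exp_add)
    also have "\<dots> = exp (of_real (s * ln k) + (- \<i> * pi * of_real s))" by (simp add: algebra_simps)
    also have "\<dots> = of_real (k powr s) * exp (- \<i> * pi * of_real s)"
      using k by (simp only: exp_add exp_of_real) (simp add: powr_def Ln_of_real)
    finally show ?thesis .
  qed
  then show ?thesis using LIMSEQ_unique[OF L1 L2[folded eq]] by (simp only:)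
qed

lemma set_integrable_exp_powr_Ici_1:
  fixes c p :: real
  assumes "c > 0"
  shows "set_integrable lborel {1..} (\<lambda>v. exp (- c * v) * v powr p)"
proof (rule set_integrable_bound)
  show "set_integrable lborel {1..} (\<lambda>v. exp (- c * v) * v powr \<bar>p\<bar>)"
    by (rule set_integrable_subset[OF set_integrable_exp_powr]) (use assms in auto)
  show "AE v in lborel. v \<in> {1..} \<longrightarrow> norm (exp (- c * v) * v powr p) \<le> norm (exp (- c * v) * v powr \<bar>p\<bar>)"
    by (intro AE_I2) (auto intro!: powr_mono)
qed (simp add: set_borel_measurable_def)

text \<open>Substitution v = 1/x. No condition on \<open>s\<close> arises, because exp (-c/x) beats
  every power at 0. At x = 0 itself the integrand is 0, since \<open>0 powr p\<close> is 0.\<close>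

lemma LINT_unit_inverse:
  fixes c s :: real
  assumes c: "c > 0"
  shows "(LINT x:{0..1}|lborel. x powr (s - 1) * exp (- c / x)) = (LINT v:{1..}|lborel. exp (- c * v) * v powr (- s - 1))"
    and "set_integrable lborel {0..1} (\<lambda>x. x powr (s - 1) * exp (- c / x))"
proof -
  let ?L = "LINT v:{1..}|lborel. exp (- c * v) * v powr (- s - 1)"
  let ?f = "\<lambda>v. exp (- c * v) * v powr (- s - 1)"
  let ?h = "\<lambda>x. x powr (s - 1) * exp (- c / x)"
  have img: "(\<lambda>x. 1 / x) ` {0<..1} = {1::real..}"
  proof
    show "{1::real..} \<subseteq> (\<lambda>x. 1 / x) ` {0<..1}"
    proof
      fix v :: real assume "v \<in> {1..}"
      then show "v \<in> (\<lambda>x. 1 / x) ` {0<..1}" by (intro image_eqI[of _ _ "1 / v"]) auto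
    qed
  qed auto
  have int: "set_integrable lborel {1..} ?f" by (rule set_integrable_exp_powr_Ici_1[OF c])
  then have "?f absolutely_integrable_on {1..}"
    unfolding set_integrable_def by (subst integrable_completion) (auto simp: set_borel_measurable_def)
  moreover have "integral {1..} ?f = ?L"
    using set_borel_integral_eq_integral(2)[OF int] by simp
  ultimately have "(\<lambda>x. \<bar>- 1 / x\<^sup>2\<bar> * ?f (1 / x)) absolutely_integrable_on {0<..1} \<and>
     integral {0<..1} (\<lambda>x. \<bar>- 1 / x\<^sup>2\<bar> * ?f (1 / x)) = ?L"
    by (subst has_absolute_integral_change_of_variables_1')
       (auto simp: img inj_on_def power2_eq_square intro!: derivative_eq_intros)
  moreover have eq: "\<bar>- 1 / x\<^sup>2\<bar> * ?f (1 / x) = ?h x" if "x \<in> {0<..1}" for x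
  proof -
    have "1 / x\<^sup>2 = x powr (-2)" using that by (simp add: powr_minus powr_numeral divide_inverse)
    moreover have "(1 / x) powr (- s - 1) = x powr (s + 1)"
    proof -
      have e: "1 / x = x powr (-1)" using that by (simp add: powr_minus divide_inverse)
      show ?thesis unfolding e powr_powr by (simp add: add.commute)
    qed
    moreover have "x powr (-2) * x powr (s + 1) = x powr (s - 1)" by (simp add: powr_add[symmetric])
    ultimately show ?thesis using that by (simp add: mult_ac)
  qed
  ultimately have abs: "?h absolutely_integrable_on {0<..1}" and val: "integral {0<..1} ?h = ?L"
    using set_integrable_cong[of lebesgue lebesgue "{0<..1}" "{0<..1}" "\<lambda>x. \<bar>- 1 / x\<^sup>2\<bar> * ?f (1 / x)" ?h]
      Henstock_Kurzweil_Integration.integral_cong[of "{0<..1}" "\<lambda>x. \<bar>- 1 / x\<^sup>2\<bar> * ?f (1 / x)" ?h]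
    by auto
  have i1: "set_integrable lborel {0<..1} ?h"
    using abs unfolding set_integrable_def by (subst (asm) integrable_completion) auto
  have ind: "indicator {0<..1} x *\<^sub>R ?h x = indicator {0..1} x *\<^sub>R ?h x" for x
    by (auto simp: indicator_def)
  show "set_integrable lborel {0..1} ?h"
    using i1 unfolding set_integrable_def ind .
  have "(LINT x:{0..1}|lborel. ?h x) = (LINT x:{0<..1}|lborel. ?h x)"
    unfolding set_lebesgue_integral_def ind ..
  also have "\<dots> = ?L"
    using set_borel_integral_eq_integral(2)[OF i1] val by simp
  finally show "(LINT x:{0..1}|lborel. ?h x) = ?L" .
qed

text \<open>The two parts of the path are \<open>[0,1]\<close> and \<open>1 + \<i> [0,\<infinity>)\<close>; the parameters stand for
  \<open>k = \<kappa>\<^sup>2\<close> and \<open>c = r\<^sup>2/4\<close>.\<close>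

definition hankel_int1 :: "real \<Rightarrow> real \<Rightarrow> real \<Rightarrow> real" where
  "hankel_int1 k c \<mu> = (LINT x:{0..1}|lborel. exp (k * x) * (x powr (- \<mu> - 1) * exp (- c / x)))"

definition hankel_int2 :: "real \<Rightarrow> real \<Rightarrow> real \<Rightarrow> complex" where
  "hankel_int2 k c \<mu> = (LINT y:{0..}|lborel. \<i> * (exp (of_real k * (1 + \<i> * of_real y))
      * (1 + \<i> * of_real y) powr of_real (- \<mu> - 1)) * exp (- of_real c / (1 + \<i> * of_real y)))"

text \<open>On [0,1] the factor exp (k x) is the harmless one and is expanded; each power of x is
  absorbed into the exponent, and inversion sends the term to a real ray integral with index j -
  \<mu>.\<close>

lemma hankel_int1_sums:
  assumes "k > 0" "c > 0"
  shows "(\<lambda>j. of_real (k ^ j / fact j) * ray_integral 1 (- of_real c) (real j - \<mu>)) sums of_real (hankel_int1 k c \<mu>)"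
proof -
  let ?w = "\<lambda>x. x powr (- \<mu> - 1) * exp (- c / x)"
  let ?f = "\<lambda>j x. (k * x) ^ j /\<^sub>R fact j * ?w x"
  have "(\<lambda>j. LINT x:{0..1}|lborel. ?f j x) sums hankel_int1 k c \<mu>"
    unfolding hankel_int1_def
  proof (rule sums_set_lebesgue_integral_dominated(1))
    show "set_integrable lborel {0..1} ?w"
      using LINT_unit_inverse(2)[OF assms(2), of "- \<mu>"] by simp
    show "summable (\<lambda>j. k ^ j /\<^sub>R fact j)" by (rule summable_exp_generic)
    show "set_borel_measurable lborel {0..1} (?f j)" for j
      unfolding set_borel_measurable_def by measurable
    fix x :: real assume x: "x \<in> {0..1}"
    show "(\<lambda>j. ?f j x) sums (exp (k * x) * ?w x)"
      by (intro sums_mult2 exp_converges)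
    have "(k * x) ^ j \<le> k ^ j" for j using x assms by (intro power_mono) (auto simp: mult_left_le)
    then show "norm (?f j x) \<le> k ^ j /\<^sub>R fact j * ?w x" for j
      using x assms by (auto simp: abs_mult intro!: mult_right_mono mult_left_mono)
  qed
  moreover have "(LINT x:{0..1}|lborel. ?f j x) 
      = k ^ j / fact j * (LINT v:{1..}|lborel. exp (- c * v) * v powr (- (real j - \<mu>) - 1))" for j
  proof -
    have "(LINT x:{0..1}|lborel. ?f j x) = (LINT x:{0..1}|lborel. k ^ j / fact j * (x powr (real j - \<mu> - 1) * exp (- c / x)))"
    proof (intro set_lebesgue_integral_cong ballI allI impI)
      fix x :: real assume x: "x \<in> {0..1}"
      show "?f j x = k ^ j / fact j * (x powr (real j - \<mu> - 1) * exp (- c / x))"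
      proof (cases "x = 0")
        case False
        then have "x ^ j = x powr real j" using x by (simp add: powr_realpow)
        moreover have "x powr real j * x powr (- \<mu> - 1) = x powr (real j - \<mu> - 1)"
          by (simp add: powr_add[symmetric] algebra_simps)
        ultimately have *: "x ^ j * x powr (- \<mu> - 1) = x powr (real j - \<mu> - 1)" by simp
        show ?thesis unfolding *[symmetric] by (simp add: power_mult_distrib divide_inverse mult_ac)
      qed simp
    qed simp
    then show ?thesis using LINT_unit_inverse(1)[OF assms(2), of "real j - \<mu>"] by simp
  qed
  ultimately have "(\<lambda>j. k ^ j / fact j * (LINT v:{1..}|lborel. exp (- c * v) * v powr (- (real j - \<mu>) - 1))) sums hankel_int1 k c \<mu>"
    by simp
  from sums_of_real[OF this, where 'a=complex] show ?thesis
    by (simp add: ray_integral_one_eq[OF assms(2)])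
qed

lemma norm_hankel_int2_integrand_le:
  assumes "\<mu> > -1" "c > 0" "y \<ge> 0"
  shows "norm (exp (of_real k * (1 + \<i> * complex_of_real y)) * (1 + \<i> * of_real y) powr of_real (- \<mu> - 1)) 
     \<le> exp k * (2 powr (\<mu> + 1) * (1 + y) powr (- \<mu> - 1))"
    "norm (exp (- of_real c / (1 + \<i> * complex_of_real y))) \<le> 1"
proof -
  have "norm (exp (of_real k * (1 + \<i> * complex_of_real y))) = exp k" by simp
  then show "norm (exp (of_real k * (1 + \<i> * complex_of_real y)) * (1 + \<i> * of_real y) powr of_real (- \<mu> - 1)) 
     \<le> exp k * (2 powr (\<mu> + 1) * (1 + y) powr (- \<mu> - 1))"
    using norm_one_plus_ii_powr_le[OF assms(3), of "- \<mu> - 1"] assms by (simp add: norm_mult add.commute)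
  show "norm (exp (- of_real c / (1 + \<i> * complex_of_real y))) \<le> 1"
    using norm_exp_neg_sq_divide_le[of "1 + \<i> * complex_of_real y" "sqrt c"] assms by (simp flip: of_real_power)
qed

text \<open>On the vertical ray |1/\<sigma>| \<le> 1, so exp (-c/\<sigma>) may be expanded with the
  majorant c^m/m!. Each factor \<sigma>^(-m) raises the index by m, and \<mu> > 0 makes the
  remaining power integrable.\<close>

lemma hankel_int2_sums:
  assumes "k > 0" "c > 0" "\<mu> > 0"
  shows "(\<lambda>m. of_real ((- c) ^ m / fact m) * ray_integral \<i> (of_real k) (\<mu> + real m)) sums hankel_int2 k c \<mu>"
proof -
  let ?a = "\<lambda>y. 1 + \<i> * complex_of_real y"
  let ?g = "\<lambda>y. \<i> * (exp (of_real k * ?a y) * ?a y powr of_real (- \<mu> - 1))"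
  let ?f = "\<lambda>m y. ?g y * ((- of_real c / ?a y) ^ m /\<^sub>R fact m)"
  let ?w = "\<lambda>y. exp k * (2 powr (\<mu> + 1) * (1 + y) powr (- \<mu> - 1))"
  have "(\<lambda>m. LINT y:{0..}|lborel. ?f m y) sums hankel_int2 k c \<mu>"
    unfolding hankel_int2_def
  proof (rule sums_set_lebesgue_integral_dominated(1))
    show "set_integrable lborel {0..} ?w"
      by (intro set_integrable_mult_right set_integrable_powr_shift) (use assms in simp)
    show "summable (\<lambda>m. c ^ m /\<^sub>R fact m)" by (rule summable_exp_generic)
    show "set_borel_measurable lborel {0..} (?f m)" for m
      by (intro set_borel_measurable_lborel_continuous continuous_intros) (use ray_not_nonpos(2)[of \<i>] in auto)
    fix y :: real assume y: "y \<in> {0..}"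
    show "(\<lambda>m. ?f m y) sums (?g y * exp (- of_real c / ?a y))"
      by (intro sums_mult exp_converges)
    have "c / norm (?a y) \<le> c" using norm_one_plus_ii_ge(2)[of y] y assms(2) by (auto simp: divide_le_eq mult_le_cancel_left1 intro: less_le_trans)
    then have "norm ((- of_real c / ?a y) ^ m /\<^sub>R fact m) \<le> c ^ m /\<^sub>R fact m" for m
      using assms(2) by (auto simp: norm_power norm_divide intro!: mult_left_mono power_mono)
    moreover have "norm (?g y) \<le> ?w y"
      using norm_hankel_int2_integrand_le(1)[of \<mu> c y k] assms y by (simp add: norm_mult)
    ultimately show "norm (?f m y) 
        \<le> c ^ m /\<^sub>R fact m * ?w y" for m
      unfolding norm_mult[of "?g y"] mult.commute[of "norm (?g y)"] by (intro mult_mono) (use assms in auto)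
  qed
  moreover have "(LINT y:{0..}|lborel. ?f m y) 
       = of_real ((- c) ^ m / fact m) * ray_integral \<i> (of_real k) (\<mu> + real m)" for m
    unfolding ray_integral_def set_integral_mult_right[symmetric]
  proof (intro set_lebesgue_integral_cong ballI allI impI)
    fix y :: real assume "y \<in> {0..}"
    then have nz: "?a y \<noteq> 0" using ray_not_nonpos(2)[of \<i> y] by simp
    have "?a y powr of_real (- (\<mu> + real m) - 1) = ?a y powr (of_real (- \<mu> - 1) - of_nat m)"
      by (simp add: algebra_simps)
    also have "\<dots> = ?a y powr of_real (- \<mu> - 1) / ?a y ^ m"
      using nz by (simp add: powr_diff powr_nat)
    finally have *: "?a y powr of_real (- (\<mu> + real m) - 1) = ?a y powr of_real (- \<mu> - 1) / ?a y ^ m" .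
    show "?f m y 
       = of_real ((- c) ^ m / fact m) * (\<i> * (exp (of_real k * ?a y) * ?a y powr of_real (- (\<mu> + real m) - 1)))"
      unfolding * power_divide by (simp add: scaleR_conv_of_real divide_inverse mult_ac)
  qed simp
  ultimately show ?thesis by simp
qed

text \<open>The elementary parts of the two expansions are double series in \<open>j\<close> and \<open>m\<close> that cancel,
  since \<open>1/(m - (j - \<mu>)) + 1/(j - (\<mu> + m)) = 0\<close>.\<close>

lemma eser_double_sums:
  fixes k c \<mu> :: real
  assumes \<mu>: "\<mu> \<notin> \<int>"
  obtains T where "(\<lambda>j. of_real (k ^ j / fact j) * eser (real j - \<mu>) (- of_real c)) sums T"
    "(\<lambda>m. of_real ((- c) ^ m / fact m) * eser (\<mu> + real m) (of_real k)) sums (- T)"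
proof -
  let ?g = "\<lambda>m. - (of_real ((- c) ^ m / fact m) * eser (\<mu> + real m) (of_real k))"
  let ?a = "\<lambda>j m. complex_of_real (k ^ j / fact j) * ((- of_real c) ^ m / (fact m * (of_nat m - of_real (real j - \<mu>))))"
  obtain d where d: "d > 0" "\<And>i::int. d \<le> \<bar>of_int i - \<mu>\<bar>" using dist_Ints_pos[OF \<mu>] by blast
  note s1 = nonint_shift(2)[OF \<mu>] and s2 = nonint_shift(1)[OF \<mu>]
  have nd: "d \<le> norm (of_nat m - complex_of_real (real j - \<mu>))" for j m
  proof -
    have "of_nat m - complex_of_real (real j - \<mu>) = - of_real (of_int (int j - int m) - \<mu>)" by simp
    then have "norm (of_nat m - complex_of_real (real j - \<mu>)) = \<bar>of_int (int j - int m) - \<mu>\<bar>"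
      by (simp only: norm_minus_cancel norm_of_real)
    then show ?thesis using d(2)[of "int j - int m"] by simp
  qed
  have neg: "?a j m = - (of_real ((- c) ^ m / fact m) * (of_real k ^ j / (fact j * (of_nat j - of_real (\<mu> + real m)))))" for j m
  proof -
    have "of_nat m - complex_of_real (real j - \<mu>) = - (of_nat j - of_real (\<mu> + real m))" by simp
    then show ?thesis by (simp only: mult_minus_right divide_minus_right) (simp add: mult_ac)
  qed
  \<comment> \<open>The sum over m is treated as an integral over counting measure, so the exchange
    of summations is dominated convergence. The majorant is the product of two exponential series
    and the bound 1/d on the denominators.\<close>
  let ?M = "count_space (UNIV :: nat set)"
  let ?w = "\<lambda>m. norm ((- complex_of_real c) ^ m /\<^sub>R fact m)"
  have wi: "set_integrable ?M UNIV ?w"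
    unfolding set_integrable_def using summable_norm_exp[of "- complex_of_real c"]
    by (simp add: integrable_count_space_nat_iff)
  let ?b = "\<lambda>j. norm (complex_of_real k ^ j /\<^sub>R fact j) * (1 / d)"
  have le: "norm (?a j m) \<le> ?b j * ?w m" for j m
  proof -
    have "norm (?a j m) = norm (complex_of_real k ^ j /\<^sub>R fact j) * ?w m * (1 / norm (of_nat m - complex_of_real (real j - \<mu>)))"
      by (simp add: norm_mult norm_divide norm_power power_abs abs_divide norm_inverse divide_inverse)
    also have "\<dots> \<le> norm (complex_of_real k ^ j /\<^sub>R fact j) * ?w m * (1 / d)"
      using nd[of m j] d(1) by (intro mult_left_mono frac_le) auto
    finally show ?thesis by (simp only: mult_ac)
  qed
  have G: "(\<lambda>j. ?a j m) sums ?g m" for m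
    unfolding neg by (intro sums_minus sums_mult eser_sums s2)
  note dom = sums_set_lebesgue_integral_dominated[of ?M UNIV ?a ?w ?b, OF _ wi _ le G]
  have sb: "summable ?b" by (intro summable_mult2 summable_norm_exp)
  have 1: "(\<lambda>j. LINT m:UNIV|?M. ?a j m) sums (LINT m:UNIV|?M. ?g m)"
    by (rule dom(1)) (simp add: set_borel_measurable_def, rule sb)
  have "set_integrable ?M UNIV (\<lambda>m. ?g m)"
    by (rule dom(2)) (simp add: set_borel_measurable_def, rule sb)
  then have "integrable ?M (\<lambda>m. ?g m)"
    by (simp add: set_integrable_def)
  from sums_integral_count_space_nat[OF this]
  have 2: "(\<lambda>m. ?g m) sums
      (LINT m:UNIV|?M. ?g m)"
    by (simp add: set_lebesgue_integral_def)
  have "(LINT m:UNIV|?M. ?a j m) = of_real (k ^ j / fact j) * eser (real j - \<mu>) (- of_real c)" for j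
  proof -
    have "integrable ?M (?a j)"
      unfolding integrable_count_space_nat_iff
      by (rule summable_comparison_test'[OF summable_mult[OF summable_norm_exp[of "- complex_of_real c"], of "?b j"]])
         (use le[of j] in auto)
    from sums_integral_count_space_nat[OF this] have "?a j sums (LINT m:UNIV|?M. ?a j m)"
      by (simp add: set_lebesgue_integral_def)
    moreover have "?a j sums (of_real (k ^ j / fact j) * eser (real j - \<mu>) (- of_real c))"
      by (intro sums_mult eser_sums s1)
    ultimately show ?thesis using sums_unique2 by blast
  qed
  with 1 have "(\<lambda>j. of_real (k ^ j / fact j) * eser (real j - \<mu>) (- of_real c)) sums
      (LINT m:UNIV|?M. ?g m)" by simp
  moreover from sums_minus[OF 2] have "(\<lambda>m. of_real ((- c) ^ m / fact m) * eser (\<mu> + real m) (of_real k)) sums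
      - (LINT m:UNIV|?M. ?g m)" by simp
  ultimately show thesis by (rule that)
qed

section \<open>From Gamma functions to Bessel series\<close>

lemma Gamma_reflection_real':
  fixes x :: real
  assumes that: "x \<notin> \<int>"
  shows "Gamma x = pi / sin (pi * x) * rGamma (1 - x)"
proof -
  have "1 - x \<notin> \<int>" using that by (metis Ints_1 Ints_diff diff_diff_eq2 add_diff_cancel_left')
  then have nz: "Gamma (1 - x) \<noteq> 0" using Gamma_eq_zero_iff[of "1 - x"] nonpos_Ints_Int by blast
  have "complex_of_real (Gamma x * Gamma (1 - x)) = of_real (pi / sin (pi * x))"
  proof -
    have "1 - complex_of_real x = of_real (1 - x)" "of_real pi * complex_of_real x = of_real (pi * x)" by simp_all
    with Gamma_reflection_complex[of "of_real x"] show ?thesis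
      by (simp only: Gamma_complex_of_real sin_of_real of_real_mult[symmetric] of_real_divide[symmetric])
  qed
  then have "Gamma x * Gamma (1 - x) = pi / sin (pi * x)" by (simp only: of_real_eq_iff)
  moreover have "Gamma x = Gamma x * Gamma (1 - x) * inverse (Gamma (1 - x))" using nz by simp
  ultimately show ?thesis by (simp only: rGamma_inverse_Gamma)
qed

lemma sin_pi_diff_nat: "sin (pi * (\<mu> - real j)) = (-1) ^ j * sin (pi * \<mu>)"
proof (induction j)
  case (Suc j)
  have "pi * (\<mu> - real (Suc j)) = pi * (\<mu> - real j) - pi" by (simp add: algebra_simps)
  then show ?case using Suc by (simp add: sin_diff)
qed simp

definition bessel_term :: "real \<Rightarrow> real \<Rightarrow> nat \<Rightarrow> real" where
  "bessel_term \<nu> x k = (-1) ^ k / fact k * rGamma (real k + \<nu> + 1) * (x / 2) powr (2 * real k + \<nu>)"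

lemma sin_pi_nonint_ne_0: "\<mu> \<notin> \<int> \<Longrightarrow> sin (pi * \<mu>) \<noteq> 0"
  by (auto simp: sin_zero_iff_int2 Ints_def mult.commute)

text \<open>Reflection turns \<Gamma>(\<mu> - j) into the reciprocal Gamma value of J_(-\<mu>), and
  the sign of sin (pi (\<mu> - j)) is its alternating sign. The powers regroup as
  (\<kappa>/\<rho>)^\<mu> (\<kappa>\<rho>)^(2j-\<mu>), whence the argument 2\<kappa>\<rho>.\<close>

lemma hankel_term_neg:
  fixes \<kappa> \<rho> \<mu> :: real
  assumes p: "\<kappa> > 0" "\<rho> > 0" and \<mu>: "\<mu> \<notin> \<int>"
  shows "(\<kappa>\<^sup>2) ^ j / fact j * ((\<rho>\<^sup>2) powr (real j - \<mu>) * Gamma (- (real j - \<mu>)))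
     = pi / sin (pi * \<mu>) * (\<kappa> / \<rho>) powr \<mu> * bessel_term (- \<mu>) (2 * (\<kappa> * \<rho>)) j"
proof -
  have "Gamma (- (real j - \<mu>)) = pi / ((-1)^j * sin (pi * \<mu>)) * rGamma (real j + - \<mu> + 1)"
  proof -
    have e: "1 - (\<mu> - real j) = real j + - \<mu> + 1" "- (real j - \<mu>) = \<mu> - real j" by simp_all
    show ?thesis
      using Gamma_reflection_real'[OF nonint_shift(3)[OF \<mu>]] by (simp only: sin_pi_diff_nat e)
  qed
  also have "\<dots> = (-1)^j * (pi / sin (pi * \<mu>)) * rGamma (real j + - \<mu> + 1)"
    by (cases "even j") auto
  finally have G: "Gamma (- (real j - \<mu>)) = (-1)^j * (pi / sin (pi * \<mu>)) * rGamma (real j + - \<mu> + 1)" .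
  have "(\<kappa>\<^sup>2) ^ j = (\<kappa>\<^sup>2) powr real j" using p by (simp add: powr_realpow)
  then have P: "(\<kappa>\<^sup>2) ^ j * (\<rho>\<^sup>2) powr (real j - \<mu>) = (\<kappa> / \<rho>) powr \<mu> * (2 * (\<kappa> * \<rho>) / 2) powr (2 * real j + - \<mu>)"
    using p by (simp add: powr_def ln_mult ln_div ln_realpow exp_add[symmetric] algebra_simps)
  have "(\<kappa>\<^sup>2) ^ j / fact j * ((\<rho>\<^sup>2) powr (real j - \<mu>) * Gamma (- (real j - \<mu>)))
      = ((\<kappa>\<^sup>2) ^ j * (\<rho>\<^sup>2) powr (real j - \<mu>)) * Gamma (- (real j - \<mu>)) / fact j" by simp
  also have "\<dots> = pi / sin (pi * \<mu>) * (\<kappa> / \<rho>) powr \<mu> * bessel_term (- \<mu>) (2 * (\<kappa> * \<rho>)) j"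
    unfolding P G bessel_term_def by (simp only: divide_inverse mult_ac)
  finally show ?thesis .
qed

text \<open>The sign (-1)^m occurs three times: in the power of -\<rho>^2, in exp (-\<i> pi (\<mu> +
  m)) and in the sine of the reflection formula. One survives and is the alternating sign of
  J_\<mu>; the overall minus comes from sin (-pi \<mu>).\<close>

lemma hankel_term_pos:
  fixes \<kappa> \<rho> \<mu> :: real
  assumes p: "\<kappa> > 0" "\<rho> > 0" and \<mu>: "\<mu> \<notin> \<int>"
  shows "of_real ((- (\<rho>\<^sup>2)) ^ m / fact m) * (of_real ((\<kappa>\<^sup>2) powr (\<mu> + real m)) * exp (- \<i> * pi * of_real (\<mu> + real m)) * of_real (Gamma (- (\<mu> + real m))))
     = - (of_real (pi / sin (pi * \<mu>) * (\<kappa> / \<rho>) powr \<mu>) * exp (- \<i> * pi * of_real \<mu>)) * of_real (bessel_term \<mu> (2 * (\<kappa> * \<rho>)) m)"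
proof -
  have "sin (pi * - (\<mu> + real m)) = - ((-1)^m * sin (pi * \<mu>))"
    using sin_pi_diff_nat[of "- \<mu>" m] by (simp add: algebra_simps)
  then have "Gamma (- (\<mu> + real m)) = pi / (- ((-1)^m * sin (pi * \<mu>))) * rGamma (real m + \<mu> + 1)"
    using Gamma_reflection_real'[OF nonint_shift(4)[OF \<mu>]] by (simp add: algebra_simps)
  also have "\<dots> = - ((-1)^m * (pi / sin (pi * \<mu>))) * rGamma (real m + \<mu> + 1)"
    by (cases "even m") auto
  finally have G: "Gamma (- (\<mu> + real m)) = - ((-1)^m * (pi / sin (pi * \<mu>))) * rGamma (real m + \<mu> + 1)" .
  have "(\<rho>\<^sup>2) ^ m = (\<rho>\<^sup>2) powr real m" using p by (simp add: powr_realpow)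
  then have P: "(\<rho>\<^sup>2) ^ m * (\<kappa>\<^sup>2) powr (\<mu> + real m) = (\<kappa> / \<rho>) powr \<mu> * (2 * (\<kappa> * \<rho>) / 2) powr (2 * real m + \<mu>)"
    using p by (simp add: powr_def ln_mult ln_div ln_realpow exp_add[symmetric] algebra_simps)
  have E: "exp (- \<i> * pi * of_real (\<mu> + real m)) = (-1)^m * exp (- \<i> * pi * of_real \<mu>)"
  proof -
    have "exp (- \<i> * pi * of_real (\<mu> + real m)) = exp (- \<i> * pi * of_real \<mu>) * exp (of_nat m * (- (\<i> * pi)))"
      unfolding exp_add[symmetric] by (simp add: algebra_simps)
    also have "exp (of_nat m * (- (\<i> * pi))) = (exp (- (\<i> * pi))) ^ m" by (rule exp_of_nat_mult)
    also have "exp (- (\<i> * pi)) = -1" by (simp add: exp_minus exp_pi_i')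
    finally show ?thesis by simp
  qed
  have N: "(- (\<rho>\<^sup>2)) ^ m = (-1)^m * (\<rho>\<^sup>2) ^ m" by (rule power_minus)
  have "of_real ((- (\<rho>\<^sup>2)) ^ m / fact m) * (of_real ((\<kappa>\<^sup>2) powr (\<mu> + real m)) * exp (- \<i> * pi * of_real (\<mu> + real m)) * of_real (Gamma (- (\<mu> + real m))))
      = exp (- \<i> * pi * of_real \<mu>) * (((-1)^m * (-1)^m) * of_real (((\<rho>\<^sup>2) ^ m * (\<kappa>\<^sup>2) powr (\<mu> + real m)) * Gamma (- (\<mu> + real m)) / fact m))"
    unfolding E N by (simp add: divide_inverse mult_ac)
  also have "(-1)^m * (-1)^m = (1::complex)" by (simp flip: power_mult_distrib)
  also have "((\<rho>\<^sup>2) ^ m * (\<kappa>\<^sup>2) powr (\<mu> + real m)) * Gamma (- (\<mu> + real m)) / fact m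
     = - (pi / sin (pi * \<mu>) * (\<kappa> / \<rho>) powr \<mu> * bessel_term \<mu> (2 * (\<kappa> * \<rho>)) m)"
    unfolding P G bessel_term_def by (simp only: divide_inverse mult_ac mult_minus_left mult_minus_right)
  finally show ?thesis by simp
qed

definition hankel_int :: "real \<Rightarrow> real \<Rightarrow> real \<Rightarrow> complex" where
  "hankel_int k c \<mu> = of_real (hankel_int1 k c \<mu>) + hankel_int2 k c \<mu>"

text \<open>The two series add up to pi/sin (pi \<mu>) (\<kappa>/\<rho>)^\<mu> (J_(-\<mu>) - exp
  (-\<i> pi \<mu>) J_\<mu>). Splitting the exponential into cosine and sine yields \<i> (J_\<mu> +
  \<i> Y_\<mu>), with Y given by its defining quotient.\<close>

lemma hankel_int_nonint:
  fixes \<kappa> \<rho> \<mu> :: real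
  assumes p: "\<kappa> > 0" "\<rho> > 0" and \<mu>: "\<mu> > 0" "\<mu> \<notin> \<int>"
  defines "x \<equiv> 2 * (\<kappa> * \<rho>)"
  shows "hankel_int (\<kappa>\<^sup>2) (\<rho>\<^sup>2) \<mu> = \<i> * of_real (pi * (\<kappa> / \<rho>) powr \<mu>) *
    Complex (bessel_J \<mu> x) ((bessel_J \<mu> x * cos (\<mu> * pi) - bessel_J (- \<mu>) x) / sin (\<mu> * pi))"
proof -
  let ?A = "\<lambda>j. of_real ((\<kappa>\<^sup>2) ^ j / fact j) * ray_integral 1 (- of_real (\<rho>\<^sup>2)) (real j - \<mu>)"
  let ?S = "\<lambda>j. of_real ((\<kappa>\<^sup>2) ^ j / fact j) * eser (real j - \<mu>) (- of_real (\<rho>\<^sup>2))"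
  let ?A' = "\<lambda>m. of_real ((- (\<rho>\<^sup>2)) ^ m / fact m) * ray_integral \<i> (of_real (\<kappa>\<^sup>2)) (\<mu> + real m)"
  let ?S' = "\<lambda>m. of_real ((- (\<rho>\<^sup>2)) ^ m / fact m) * eser (\<mu> + real m) (of_real (\<kappa>\<^sup>2))"
  let ?h1 = "complex_of_real (hankel_int1 (\<kappa>\<^sup>2) (\<rho>\<^sup>2) \<mu>)"
  let ?h2 = "hankel_int2 (\<kappa>\<^sup>2) (\<rho>\<^sup>2) \<mu>"
  let ?C = "complex_of_real (pi / sin (pi * \<mu>) * (\<kappa> / \<rho>) powr \<mu>)"
  let ?E = "exp (- \<i> * pi * of_real \<mu>)"
  have k: "\<kappa>\<^sup>2 > 0" and c: "\<rho>\<^sup>2 > 0" using p by auto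
  have snz: "sin (pi * \<mu>) \<noteq> 0" by (rule sin_pi_nonint_ne_0[OF \<mu>(2)])
  have C: "?C \<noteq> 0" using snz p by simp
  note s1 = nonint_shift(2)[OF \<mu>(2)] and s2 = nonint_shift(1)[OF \<mu>(2)]
  obtain T where T1: "(\<lambda>j. ?S j) sums T"
    and T2: "(\<lambda>m. ?S' m) sums (- T)"
    by (rule eser_double_sums[OF \<mu>(2)])
  have "(\<lambda>j. ?A j + ?S j)
      sums (?h1 + T)"
    by (intro sums_add hankel_int1_sums k c T1)
  moreover have "?A j + ?S j
      = ?C * of_real (bessel_term (- \<mu>) x j)" for j
  proof -
    have "?A j + ?S j
       = of_real ((\<kappa>\<^sup>2) ^ j / fact j * ((\<rho>\<^sup>2) powr (real j - \<mu>) * Gamma (- (real j - \<mu>))))"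
      unfolding ray_integral_real[OF c s1] by (simp add: right_diff_distrib)
    also have "\<dots> = ?C * of_real (bessel_term (- \<mu>) x j)"
      unfolding hankel_term_neg[OF p \<mu>(2)] x_def by simp
    finally show ?thesis .
  qed
  ultimately have P: "(\<lambda>j. ?C * of_real (bessel_term (- \<mu>) x j)) sums (?h1 + T)"
    by simp
  have "(\<lambda>m. ?A' m + ?S' m)
      sums (?h2 + - T)"
    by (intro sums_add hankel_int2_sums k c T2 \<mu>(1))
  moreover have "?A' m + ?S' m
      = - (?C * ?E) * of_real (bessel_term \<mu> x m)" for m
  proof -
    have pos: "\<mu> + real m > 0" using \<mu>(1) by simp
    show ?thesis
      unfolding ray_integral_imag_limit[OF k pos s2] x_def
      unfolding hankel_term_pos[OF p \<mu>(2), of m, symmetric] by (simp only: right_diff_distrib diff_add_cancel)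
  qed
  ultimately have Q: "(\<lambda>m. - (?C * ?E) * of_real (bessel_term \<mu> x m)) sums (?h2 + - T)"
    by simp
  have J: "bessel_J \<nu> x = suminf (bessel_term \<nu> x)" for \<nu>
    unfolding bessel_J_def bessel_term_def ..
  \<comment> \<open>Convergence of the Bessel series is not proved separately: it is read off from
    the convergence of the series just obtained, after division by a nonzero constant.\<close>
  have sJ: "of_real (bessel_J \<nu> x) = L / D" if "(\<lambda>j. D * complex_of_real (bessel_term \<nu> x j)) sums L" "D \<noteq> 0" for \<nu> L D
  proof -
    have "(\<lambda>j. complex_of_real (bessel_term \<nu> x j)) sums (L / D)"
      using sums_divide[OF that(1), of D] that(2) by simp
    moreover from this have "summable (bessel_term \<nu> x)"
      using sums_summable summable_of_real_iff by blast
    then have "(\<lambda>j. complex_of_real (bessel_term \<nu> x j)) sums of_real (suminf (bessel_term \<nu> x))"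
      by (intro sums_of_real summable_sums)
    ultimately show ?thesis unfolding J using sums_unique2 by blast
  qed
  have "?h1 + T = ?C * of_real (bessel_J (- \<mu>) x)"
    using sJ[OF P C] C by simp
  moreover have "?h2 + - T = - (?C * ?E) * of_real (bessel_J \<mu> x)"
    using sJ[OF Q] C by simp
  moreover have "hankel_int (\<kappa>\<^sup>2) (\<rho>\<^sup>2) \<mu> = (?h1 + T) + (?h2 + - T)"
    by (simp add: hankel_int_def)
  moreover have "D * a + - (D * e) * b = D * (a - e * b)" for D a e b :: complex
    by (simp add: algebra_simps)
  ultimately have "hankel_int (\<kappa>\<^sup>2) (\<rho>\<^sup>2) \<mu> = ?C * (of_real (bessel_J (- \<mu>) x) - ?E * of_real (bessel_J \<mu> x))"
    by (simp only:)
  also have "\<dots> = of_real (pi * (\<kappa> / \<rho>) powr \<mu>) * ((of_real (bessel_J (- \<mu>) x) - ?E * of_real (bessel_J \<mu> x)) / of_real (sin (pi * \<mu>)))"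
    by simp
  also have "?E = Complex (cos (pi * \<mu>)) (- sin (pi * \<mu>))"
    by (simp add: exp_eq_polar cis.ctr complex_eq_iff)
  also have "(of_real (bessel_J (- \<mu>) x) - Complex (cos (pi * \<mu>)) (- sin (pi * \<mu>)) * of_real (bessel_J \<mu> x)) / of_real (sin (pi * \<mu>))
     = \<i> * Complex (bessel_J \<mu> x) ((bessel_J \<mu> x * cos (\<mu> * pi) - bessel_J (- \<mu>) x) / sin (\<mu> * pi))"
    using snz by (simp add: complex_eq_iff Re_divide_of_real Im_divide_of_real mult.commute[of \<mu>] field_simps)
  finally show ?thesis by (simp only: mult_ac)
qed

section \<open>Continuity in the index\<close>

lemma tendsto_hankel_int1:
  assumes c: "c > 0" and k: "k > 0"
  shows "((\<lambda>\<mu>. hankel_int1 k c \<mu>) \<longlongrightarrow> hankel_int1 k c \<nu>) (at \<nu> within {..\<nu> + 1})"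
  unfolding tendsto_at_iff_sequentially
proof (intro allI impI)
  let ?f = "\<lambda>\<mu> x. indicator {0..1} x *\<^sub>R (exp (k * x) * (x powr (- \<mu> - 1) * exp (- c / x)))"
  \<comment> \<open>On [0,1] powers decrease in the exponent, so \<mu> \<le> \<nu> + 1 gives
    x^(-\<mu>-1) \<le> x^(-\<nu>-2), and exp (-c/x) keeps this majorant integrable.\<close>
  let ?w = "\<lambda>x. indicator {0..1} x *\<^sub>R (exp k * (x powr ((- \<nu> - 1) - 1) * exp (- c / x)))"
  fix X :: "nat \<Rightarrow> real"
  assume X: "\<forall>i. X i \<in> {..\<nu> + 1} - {\<nu>}" "X \<longlonglongrightarrow> \<nu>"
  show "((\<lambda>\<mu>. hankel_int1 k c \<mu>) \<circ> X) \<longlonglongrightarrow> hankel_int1 k c \<nu>"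
    unfolding o_def hankel_int1_def set_lebesgue_integral_def
  proof (rule integral_dominated_convergence)
    show "integrable lborel (\<lambda>x. ?w x)"
      using set_integrable_mult_right[of "exp k" lborel "{0..1}" "\<lambda>x. x powr ((- \<nu> - 1) - 1) * exp (- c / x)"]
        LINT_unit_inverse(2)[OF c, of "- \<nu> - 1"] unfolding set_integrable_def by simp
    show "AE x in lborel. norm (?f (X i) x)
        \<le> ?w x" for i
    proof (rule AE_I2)
      fix x :: real
      show "norm (?f (X i) x)
        \<le> ?w x"
      proof (cases "x \<in> {0..1}")
        case True
        have "exp (k * x) \<le> exp k" using True k by (simp add: mult_left_le)
        moreover have "x powr (- X i - 1) \<le> x powr ((- \<nu> - 1) - 1)"
          using True X(1) by (intro powr_mono') (auto simp: algebra_simps)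
        ultimately have "exp (k * x) * (x powr (- X i - 1) * exp (- c / x)) \<le> exp k * (x powr ((- \<nu> - 1) - 1) * exp (- c / x))"
          by (intro mult_mono) auto
        then show ?thesis using True by (simp add: abs_mult)
      qed simp
    qed
    show "AE x in lborel. (\<lambda>i. ?f (X i) x)
       \<longlonglongrightarrow> ?f \<nu> x"
    proof (rule AE_I2)
      fix x :: real
      have "(\<lambda>i. x powr (- X i - 1)) \<longlonglongrightarrow> x powr (- \<nu> - 1)"
      proof (cases "x = 0")
        case False
        then show ?thesis by (intro tendsto_intros X(2)) auto
      qed simp
      then show "(\<lambda>i. ?f (X i) x)
       \<longlonglongrightarrow> ?f \<nu> x"
        by (rule tendsto_scaleR[OF tendsto_const tendsto_mult[OF tendsto_const tendsto_mult[OF _ tendsto_const]]])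
    qed
  qed measurable
qed

lemma hankel_int2_measurable:
  "set_borel_measurable lborel {0..} (\<lambda>y. \<i> * (exp (of_real k * (1 + \<i> * of_real y))
      * (1 + \<i> * of_real y) powr of_real (- \<mu> - 1)) * exp (- of_real c / (1 + \<i> * of_real y)))"
  by (intro set_borel_measurable_lborel_continuous continuous_intros) (use ray_not_nonpos(2)[of \<i>] in auto)

lemma tendsto_hankel_int2:
  assumes c: "c > 0" and k: "k > 0"
  shows "((\<lambda>\<mu>. hankel_int2 k c \<mu>) \<longlongrightarrow> hankel_int2 k c \<nu>) (at \<nu> within {1/2..})"
  unfolding tendsto_at_iff_sequentially
proof (intro allI impI)
  \<comment> \<open>On the ray, where |1 + \<i> y| \<ge> 1, the power is largest at the threshold
    \<mu> = 1/2, and (1 + y)^(-3/2) is integrable. The threshold leaves a full neighbourhood of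
    every positive integer.\<close>
  let ?w = "\<lambda>y::real. exp k * (2 powr (1/2 + 1) * (1 + y) powr (- (1/2) - 1))"
  let ?u = "\<lambda>p y. exp (of_real k * (1 + \<i> * of_real y)) * (1 + \<i> * complex_of_real y) powr of_real (- p - 1)"
  fix X :: "nat \<Rightarrow> real"
  assume X: "\<forall>i. X i \<in> {1/2..} - {\<nu>}" "X \<longlonglongrightarrow> \<nu>"
  let ?g = "\<lambda>\<mu> y. \<i> * (exp (of_real k * (1 + \<i> * of_real y))
      * (1 + \<i> * complex_of_real y) powr of_real (- \<mu> - 1)) * exp (- of_real c / (1 + \<i> * of_real y))"
  show "((\<lambda>\<mu>. hankel_int2 k c \<mu>) \<circ> X) \<longlonglongrightarrow> hankel_int2 k c \<nu>"
    unfolding o_def hankel_int2_def set_lebesgue_integral_def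
  proof (rule integral_dominated_convergence)
    show "integrable lborel (\<lambda>y. indicator {0..} y *\<^sub>R (?w y))"
      using set_integrable_powr_shift[of "- (1/2) - 1"] unfolding set_integrable_def
      by (simp add: mult.left_commute[of "indicator _ _"])
    show "AE y in lborel. norm (indicator {0..} y *\<^sub>R ?g (X i) y) \<le> indicator {0..} y *\<^sub>R (?w y)" for i
    proof (rule AE_I2)
      fix y :: real
      show "norm (indicator {0..} y *\<^sub>R ?g (X i) y) \<le> indicator {0..} y *\<^sub>R (?w y)"
      proof (cases "y \<ge> 0")
        case True
        have "norm ((1 + \<i> * complex_of_real y) powr of_real (- X i - 1)) \<le> norm ((1 + \<i> * complex_of_real y) powr of_real (- (1/2) - 1))"
          using spec[OF X(1), of i] norm_one_plus_ii_ge(2)[OF True]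
          by (subst (1 2) norm_powr_real_powr') (auto intro!: powr_mono)
        then have "norm (?u (X i) y)
           \<le> norm (?u (1/2) y)"
          unfolding norm_mult by (intro mult_left_mono) auto
        also have "\<dots> \<le> ?w y"
          by (rule norm_hankel_int2_integrand_le(1)[OF _ c True]) simp
        finally have "norm (?u (X i) y)
            * norm (exp (- of_real c / (1 + \<i> * complex_of_real y))) \<le> (?w y) * 1"
          by (intro mult_mono norm_hankel_int2_integrand_le(2)[of 1, OF _ c True]) auto
        then show ?thesis using True by (simp only: norm_mult norm_scaleR) (simp add: norm_mult mult.assoc)
      qed simp
    qed
    show "AE y in lborel. (\<lambda>i. indicator {0..} y *\<^sub>R ?g (X i) y) \<longlonglongrightarrow> indicator {0..} y *\<^sub>R ?g \<nu> y"
    proof (rule AE_I2)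
      fix y :: real
      show "(\<lambda>i. indicator {0..} y *\<^sub>R ?g (X i) y) \<longlonglongrightarrow> indicator {0..} y *\<^sub>R ?g \<nu> y"
      proof (cases "y \<ge> 0")
        case True
        then show ?thesis using ray_not_nonpos[of \<i> y] by (intro tendsto_intros X(2)) auto
      qed simp
    qed
  qed (use hankel_int2_measurable[unfolded set_borel_measurable_def] in auto)
qed

text \<open>Each step of rGamma z = z rGamma (z + 1) divides by a number that is at least 1. This
  gives a majorant of the Bessel terms that is uniform in the index.\<close>

lemma abs_rGamma_add_nat_le:
  fixes z :: real
  assumes "z \<ge> 1"
  shows "\<bar>rGamma (z + real k)\<bar> \<le> \<bar>rGamma z\<bar>"
proof (induction k)
  case (Suc k)
  have "rGamma (z + real k) = (z + real k) * rGamma (z + real k + 1)"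
    using rGamma_plus1[of "z + real k"] by simp
  then have "\<bar>rGamma (z + real k)\<bar> = (z + real k) * \<bar>rGamma (z + real k + 1)\<bar>"
    using assms by (simp add: abs_mult)
  moreover have "1 * \<bar>rGamma (z + real k + 1)\<bar> \<le> (z + real k) * \<bar>rGamma (z + real k + 1)\<bar>"
    using assms by (intro mult_right_mono) auto
  ultimately have "\<bar>rGamma (z + real (Suc k))\<bar> \<le> \<bar>rGamma (z + real k)\<bar>" by (simp add: add_ac)
  then show ?case using Suc by linarith
qed simp

text \<open>Weierstrass test on [0, \<nu> + 1] with terms G P (x/2)^(2k)/k!, where G and P bound the
  Gamma factor and the power on this compact interval. Unlike Y, the function J is not defined as a
  limit at integers, so its continuity has to be shown.\<close>

lemma isCont_bessel_J:
  fixes \<nu> x :: real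
  assumes x: "x > 0" and \<nu>: "\<nu> > 0"
  shows "isCont (\<lambda>\<mu>. bessel_J \<mu> x) \<nu>"
proof -
  let ?S = "{0..\<nu> + 1}"
  have cont: "continuous_on ?S (\<lambda>\<mu>. bessel_term \<mu> x k)" for k
  proof -
    have "continuous_on ?S (\<lambda>\<mu>. rGamma (real k + \<mu> + 1))"
      by (rule continuous_on_compose2[OF continuous_on_rGamma[of UNIV]]) (auto intro!: continuous_intros)
    then show ?thesis unfolding bessel_term_def using x by (intro continuous_intros) auto
  qed
  have "continuous_on ?S (\<lambda>\<mu>. rGamma (\<mu> + 1))"
    by (rule continuous_on_compose2[OF continuous_on_rGamma[of UNIV]]) (auto intro!: continuous_intros)
  then obtain G where G: "\<And>\<mu>. \<mu> \<in> ?S \<Longrightarrow> norm (rGamma (\<mu> + 1)) \<le> G"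
    by (rule continuous_on_compact_bound[OF compact_Icc]) blast
  have "continuous_on ?S (\<lambda>\<mu>. (x / 2) powr \<mu>)"
    using x by (intro continuous_intros) auto
  then obtain P where P: "\<And>\<mu>. \<mu> \<in> ?S \<Longrightarrow> norm ((x / 2) powr \<mu>) \<le> P"
    by (rule continuous_on_compact_bound[OF compact_Icc]) blast
  have "uniform_limit ?S (\<lambda>n \<mu>. \<Sum>k<n. bessel_term \<mu> x k) (\<lambda>\<mu>. \<Sum>k. bessel_term \<mu> x k) sequentially"
  proof (rule Weierstrass_m_test)
    show "summable (\<lambda>k. (((x / 2)\<^sup>2) ^ k /\<^sub>R fact k) * (G * P))"
      by (intro summable_mult2 summable_exp_generic)
    fix k \<mu> assume \<mu>: "\<mu> \<in> ?S"
    have "\<bar>rGamma (\<mu> + 1 + real k)\<bar> \<le> \<bar>rGamma (\<mu> + 1)\<bar>"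
      by (rule abs_rGamma_add_nat_le) (use \<mu> in simp)
    also have "\<dots> \<le> G" using G[OF \<mu>] by simp
    finally have g: "\<bar>rGamma (real k + \<mu> + 1)\<bar> \<le> G" by (simp add: add_ac)
    have p: "(x / 2) powr \<mu> \<le> P" using P[OF \<mu>] by simp
    have *: "(x / 2) powr (2 * real k + \<mu>) = ((x / 2)\<^sup>2) ^ k * (x / 2) powr \<mu>"
      using x powr_realpow[of "x / 2" "2 * k"] by (simp add: powr_add power_mult)
    have "norm (bessel_term \<mu> x k) = (((x / 2)\<^sup>2) ^ k /\<^sub>R fact k) * (\<bar>rGamma (real k + \<mu> + 1)\<bar> * (x / 2) powr \<mu>)"
    proof -
      have "norm (bessel_term \<mu> x k) = 1 / fact k * \<bar>rGamma (real k + \<mu> + 1)\<bar> * (x / 2) powr (2 * real k + \<mu>)"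
        unfolding bessel_term_def by (simp add: abs_mult abs_divide power_abs)
      then have "norm (bessel_term \<mu> x k) = 1 / fact k * \<bar>rGamma (real k + \<mu> + 1)\<bar> * (((x / 2)\<^sup>2) ^ k * (x / 2) powr \<mu>)"
        unfolding * .
      then show ?thesis by (simp only: real_scaleR_def divide_inverse mult_ac mult_1_left)
    qed
    also have "\<dots> \<le> (((x / 2)\<^sup>2) ^ k /\<^sub>R fact k) * (G * P)"
      by (intro mult_left_mono mult_mono g p order_trans[OF abs_ge_zero g]) simp_all
    finally show "norm (bessel_term \<mu> x k) \<le> (((x / 2)\<^sup>2) ^ k /\<^sub>R fact k) * (G * P)" .
  qed
  then have "continuous_on ?S (\<lambda>\<mu>. \<Sum>k. bessel_term \<mu> x k)"
    by (rule uniform_limit_theorem[rotated]) (auto intro!: always_eventually continuous_on_sum cont)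
  moreover have "\<nu> \<in> interior ?S" using \<nu> by simp
  ultimately show ?thesis
    unfolding bessel_J_def bessel_term_def[symmetric] by (rule continuous_on_interior)
qed

lemma tendsto_hankel_int:
  assumes "c > 0" "k > 0" "\<nu> \<ge> 1"
  shows "((\<lambda>\<mu>. hankel_int k c \<mu>) \<longlongrightarrow> hankel_int k c \<nu>) (at \<nu>)"
proof -
  let ?S = "{1/2<..<\<nu> + 1}"
  have "((\<lambda>\<mu>. hankel_int1 k c \<mu>) \<longlongrightarrow> hankel_int1 k c \<nu>) (at \<nu> within ?S)"
    by (rule tendsto_within_subset[OF tendsto_hankel_int1[OF assms(1,2)]]) auto
  moreover have "((\<lambda>\<mu>. hankel_int2 k c \<mu>) \<longlongrightarrow> hankel_int2 k c \<nu>) (at \<nu> within ?S)"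
    by (rule tendsto_within_subset[OF tendsto_hankel_int2[OF assms(1,2)]]) auto
  ultimately have "((\<lambda>\<mu>. hankel_int k c \<mu>) \<longlongrightarrow> hankel_int k c \<nu>) (at \<nu> within ?S)"
    unfolding hankel_int_def by (intro tendsto_add tendsto_of_real)
  moreover have "at \<nu> within ?S = at \<nu>"
    by (rule at_within_open) (use assms(3) in auto)
  ultimately show ?thesis by (simp only:)
qed

lemma hankel_int_eq:
  fixes \<kappa> \<rho> \<nu> :: real
  assumes p: "\<kappa> > 0" "\<rho> > 0" and \<nu>: "\<nu> > 0"
  shows "hankel_int (\<kappa>\<^sup>2) (\<rho>\<^sup>2) \<nu> = \<i> * of_real (pi * (\<kappa> / \<rho>) powr \<nu>) * hankel1 \<nu> (2 * (\<kappa> * \<rho>))"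
proof (cases "\<nu> \<in> \<int>")
  case False
  then show ?thesis
    using hankel_int_nonint[OF p \<nu> False] by (simp add: hankel1_def bessel_Y_def)
next
  case True
  let ?x = "2 * (\<kappa> * \<rho>)"
  let ?Y = "\<lambda>\<mu>. (bessel_J \<mu> ?x * cos (\<mu> * pi) - bessel_J (- \<mu>) ?x) / sin (\<mu> * pi)"
  let ?C = "\<lambda>\<mu>. \<i> * complex_of_real (pi * (\<kappa> / \<rho>) powr \<mu>)"
  \<comment> \<open>Division by the nonvanishing prefactor isolates the Hankel function. For indices
    near \<nu> its real and imaginary parts are J and the quotient defining Y, so the single limit
    of \<open>H\<close> splits into the two limits wanted.\<close>
  define H where "H = (\<lambda>\<mu>. hankel_int (\<kappa>\<^sup>2) (\<rho>\<^sup>2) \<mu> / ?C \<mu>)"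
  have Cnz: "?C \<mu> \<noteq> 0" for \<mu> using p by simp
  obtain n where n: "\<nu> = of_int n" using True by (auto elim: Ints_cases)
  then have \<nu>1: "\<nu> \<ge> 1" using \<nu> by simp
  have ev: "\<forall>\<^sub>F \<mu> in at \<nu>. \<mu> \<notin> \<int> \<and> \<mu> > 0"
    unfolding eventually_at
  proof (intro exI conjI ballI impI)
    fix \<mu> assume \<mu>: "\<mu> \<noteq> \<nu> \<and> dist \<mu> \<nu> < 1"
    show "\<mu> > 0" using \<mu> \<nu>1 by (auto simp: dist_real_def)
    show "\<mu> \<notin> \<int>"
    proof
      assume "\<mu> \<in> \<int>"
      then obtain m where "\<mu> = of_int m" by (auto elim: Ints_cases)
      then have "m \<noteq> n" "\<bar>m - n\<bar> < 1"
        using \<mu> n by (auto simp: dist_real_def simp flip: of_int_diff of_int_abs)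
      then show False by simp
    qed
  qed simp
  have Hlim: "(H \<longlongrightarrow> H \<nu>) (at \<nu>)"
    unfolding H_def
    by (intro tendsto_intros tendsto_hankel_int \<nu>1) (use p in auto)
  have Heq: "\<forall>\<^sub>F \<mu> in at \<nu>. H \<mu> = Complex (bessel_J \<mu> ?x) (?Y \<mu>)"
    using ev by eventually_elim (use hankel_int_nonint[OF p] Cnz in \<open>simp add: H_def\<close>)
  have "((\<lambda>\<mu>. Im (H \<mu>)) \<longlongrightarrow> Im (H \<nu>)) (at \<nu>)" by (intro tendsto_Im Hlim)
  then have "(?Y \<longlongrightarrow> Im (H \<nu>)) (at \<nu>)"
    by (rule Lim_transform_eventually) (use Heq in eventually_elim, simp)
  \<comment> \<open>\<open>Lim\<close> is a definite description, so it is determined only now that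
    convergence is established.\<close>
  then have "Lim (at \<nu>) ?Y = Im (H \<nu>)"
    by (intro tendsto_Lim) auto
  then have Y: "bessel_Y \<nu> ?x = Im (H \<nu>)"
    using True by (simp add: bessel_Y_def)
  have "((\<lambda>\<mu>. Re (H \<mu>)) \<longlongrightarrow> Re (H \<nu>)) (at \<nu>)" by (intro tendsto_Re Hlim)
  then have "((\<lambda>\<mu>. bessel_J \<mu> ?x) \<longlongrightarrow> Re (H \<nu>)) (at \<nu>)"
    by (rule Lim_transform_eventually) (use Heq in eventually_elim, simp)
  moreover have "((\<lambda>\<mu>. bessel_J \<mu> ?x) \<longlongrightarrow> bessel_J \<nu> ?x) (at \<nu>)"
    using isCont_bessel_J[of ?x \<nu>] p \<nu> by (simp add: isCont_def)
  ultimately have J: "bessel_J \<nu> ?x = Re (H \<nu>)"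
    using tendsto_unique[OF trivial_limit_at] by blast
  have "hankel1 \<nu> ?x = H \<nu>" by (simp add: hankel1_def J Y)
  then show ?thesis using Cnz by (simp add: H_def)
qed

section \<open>Anisotropic wave and contour shift\<close>

lemma hermite_H_holomorphic: "hermite_H k holomorphic_on S"
  unfolding hermite_H_def poly_altdef by (intro holomorphic_intros)

lemma hermite_H_bounded:
  obtains C where "C \<ge> 0" "\<And>z. norm z \<le> R \<Longrightarrow> norm (hermite_H k z) \<le> C"
proof -
  have "continuous_on (cball 0 R) (hermite_H k)"
    by (rule holomorphic_on_imp_continuous_on[OF hermite_H_holomorphic])
  then obtain C where "C \<ge> 0" "\<And>z. z \<in> cball 0 R \<Longrightarrow> norm (hermite_H k z) \<le> C"
    by (rule continuous_on_compact_bound[OF compact_cball]) blast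
  then show thesis using that[of C] by simp
qed

lemma one_plus_4_not_nonpos:
  assumes "Re \<sigma> \<ge> 0"
  shows "1 + 4 * \<sigma> \<notin> \<real>\<^sub>\<le>\<^sub>0" "1 + 4 * \<sigma> \<noteq> 0" "norm (1 + 4 * \<sigma>) \<ge> 1"
proof -
  have "Re (1 + 4 * \<sigma>) \<ge> 1" using assms by simp
  then show "1 + 4 * \<sigma> \<notin> \<real>\<^sub>\<le>\<^sub>0" "1 + 4 * \<sigma> \<noteq> 0" "norm (1 + 4 * \<sigma>) \<ge> 1"
    using complex_Re_le_cmod[of "1 + 4 * \<sigma>"] by (force simp: complex_nonpos_Reals_iff)+
qed

text \<open>On the closed half-plane 1 + 4\<sigma> has real part at least 1 and avoids the branch
  cut. This includes \<sigma> = 0, which the kernel itself does not tolerate.\<close>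

lemma eta_heat_holomorphic: "eta_heat M x holomorphic_on {\<sigma>. Re \<sigma> \<ge> 0}"
proof -
  have "(\<lambda>\<sigma>. hermite_H k (complex_of_real x / csqrt (1 + 4 * \<sigma>))) holomorphic_on {\<sigma>. Re \<sigma> \<ge> 0}" for k
  proof -
    have "(hermite_H k \<circ> (\<lambda>\<sigma>. complex_of_real x / csqrt (1 + 4 * \<sigma>))) holomorphic_on {\<sigma>. Re \<sigma> \<ge> 0}"
      by (intro holomorphic_on_compose hermite_H_holomorphic holomorphic_intros) (use one_plus_4_not_nonpos in auto)
    then show ?thesis by (simp add: o_def)
  qed
  then show ?thesis
    unfolding eta_heat_def PM_def
    by (intro holomorphic_intros) (use one_plus_4_not_nonpos in auto)
qed

text \<open>With |1 + 4\<sigma>| \<ge> 1, the Hermite argument stays in the disc of radius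
  \<bar>x\<bar>, the Gaussian is at most 1, and the slowest of the powers is the one with s = 0. The
  exponent -1/2 per coordinate becomes -n/2 in the product.\<close>

lemma eta_heat_bound:
  obtains C where "C \<ge> 0" "\<And>\<sigma>. Re \<sigma> \<ge> 0 \<Longrightarrow> norm (eta_heat M x \<sigma>) \<le> C * norm (1 + 4 * \<sigma>) powr (-1/2)"
proof -
  have "\<exists>C\<ge>0. \<forall>z. norm z \<le> \<bar>x\<bar> \<longrightarrow> norm (hermite_H (2 * s) z) \<le> C" for s
    by (rule hermite_H_bounded) blast
  then obtain C where C: "\<And>s. C s \<ge> 0" "\<And>s z. norm z \<le> \<bar>x\<bar> \<Longrightarrow> norm (hermite_H (2 * s) z) \<le> C s" by metis
  have "norm (eta_heat M x \<sigma>) \<le> (\<Sum>s<M. C s) * norm (1 + 4 * \<sigma>) powr (-1/2)" if \<sigma>: "Re \<sigma> \<ge> 0" for \<sigma>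
  proof -
    let ?w = "1 + 4 * \<sigma>"
    let ?T = "\<lambda>s. (-1)^s / (of_nat (fact s) * 4^s) * (1 / (?w powr (of_nat s + 1/2))) * hermite_H (2 * s) (of_real x / csqrt ?w)"
    have w: "norm ?w \<ge> 1" using one_plus_4_not_nonpos[OF \<sigma>] by simp
    have "norm (PM M x (4 * \<sigma>)) \<le> (\<Sum>s<M. C s * norm ?w powr (-1/2))"
      unfolding PM_def
    proof (rule order_trans[OF norm_sum sum_mono])
      fix s
      have sq: "norm (csqrt ?w) \<ge> 1"
      proof -
        have "norm (csqrt ?w) ^ 2 = norm ?w" by (simp add: norm_power[symmetric])
        then show ?thesis using w by (intro power2_le_imp_le[of 1]) auto
      qed
      have "norm (complex_of_real x / csqrt ?w) \<le> \<bar>x\<bar>"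
        using divide_left_mono[OF sq, of "\<bar>x\<bar>"] one_plus_4_not_nonpos(2)[OF \<sigma>] by (simp add: norm_divide)
      then have 1: "norm (hermite_H (2 * s) (of_real x / csqrt ?w)) \<le> C s" by (rule C(2))
      have "norm (1 / (?w powr (of_nat s + 1/2))) = norm ?w powr (- (real s + 1/2))"
      proof -
        have "norm (?w powr (of_nat s + 1/2)) = norm ?w powr (real s + 1/2)"
          by (subst norm_powr_real_powr') auto
        then show ?thesis by (simp only: norm_divide norm_one powr_minus_divide)
      qed
      also have "\<dots> \<le> norm ?w powr (-1/2)" using w by (intro powr_mono) auto
      finally have 2: "norm (1 / (?w powr (of_nat s + 1/2))) \<le> norm ?w powr (-1/2)" .
      have 3: "norm ((-1)^s / (of_nat (fact s) * 4^s) :: complex) \<le> 1"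
      proof -
        have "1 * 1 \<le> fact s * (4::real)^s" by (intro mult_mono) auto
        then show ?thesis by (simp add: norm_divide norm_mult norm_power)
      qed
      have "norm (?T s)
        \<le> 1 * norm ?w powr (-1/2) * C s"
        unfolding norm_mult by (intro mult_mono 1 2 3) auto
      then show "norm (?T s)
        \<le> C s * norm ?w powr (-1/2)" by (simp only: mult_1_left mult.commute)
    qed
    also have "\<dots> = (\<Sum>s<M. C s) * norm ?w powr (-1/2)" by (simp add: sum_distrib_right)
    finally have 1: "norm (PM M x (4 * \<sigma>)) \<le> (\<Sum>s<M. C s) * norm ?w powr (-1/2)" .
    have 2: "norm (exp (- (of_real x)\<^sup>2 / ?w)) \<le> 1"
      by (rule norm_exp_neg_sq_divide_le) (use \<sigma> in simp)
    have 3: "norm (complex_of_real (1 / sqrt pi)) \<le> 1"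
      using pi_ge_two by (simp add: norm_divide)
    have "norm (eta_heat M x \<sigma>) \<le> 1 * ((\<Sum>s<M. C s) * norm ?w powr (-1/2)) * 1"
      unfolding eta_heat_def norm_mult by (intro mult_mono 1 2 3 mult_nonneg_nonneg sum_nonneg C(1)) auto
    then show ?thesis by simp
  qed
  then show thesis using C(1) by (intro that[of "\<Sum>s<M. C s"] sum_nonneg) auto
qed

lemma eta_heat_scaled_bound:
  fixes a :: real
  assumes a: "a > 0"
  obtains C where "C \<ge> 0" "\<And>\<sigma>. Re \<sigma> \<ge> 0 \<Longrightarrow> Im \<sigma> \<ge> 0 \<Longrightarrow>
    norm (eta_heat M x (of_real (a\<^sup>2) * \<sigma>)) \<le> C * (1 + Im \<sigma>) powr (-1/2)"
proof -
  obtain C where C: "C \<ge> 0" "\<And>\<sigma>. Re \<sigma> \<ge> 0 \<Longrightarrow> norm (eta_heat M x \<sigma>) \<le> C * norm (1 + 4 * \<sigma>) powr (-1/2)"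
    by (rule eta_heat_bound[of M x]) blast
  \<comment> \<open>Averaging the bounds |w| \<ge> 1 and |w| \<ge> 4 a^2 Im \<sigma> gives |w| \<ge>
    1/2 + 2 a^2 Im \<sigma>, which is at least m (1 + Im \<sigma>).\<close>
  define m where "m = min (1/2) (2 * a\<^sup>2)"
  have m: "m > 0" using a by (simp add: m_def)
  have "norm (eta_heat M x (of_real (a\<^sup>2) * \<sigma>)) \<le> C * m powr (-1/2) * (1 + Im \<sigma>) powr (-1/2)"
    if \<sigma>: "Re \<sigma> \<ge> 0" "Im \<sigma> \<ge> 0" for \<sigma>
  proof -
    let ?w = "1 + 4 * (of_real (a\<^sup>2) * \<sigma>)"
    have "1 \<le> norm ?w" by (rule one_plus_4_not_nonpos(3)) (use \<sigma> in simp)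
    moreover have "4 * a\<^sup>2 * Im \<sigma> \<le> norm ?w" using abs_Im_le_cmod[of ?w] by simp
    moreover have "m \<le> 1/2" "m * Im \<sigma> \<le> 2 * a\<^sup>2 * Im \<sigma>" using \<sigma> by (auto simp: m_def intro!: mult_right_mono)
    ultimately have "m * (1 + Im \<sigma>) \<le> norm ?w" by (simp add: distrib_left)
    then have "norm ?w powr (-1/2) \<le> (m * (1 + Im \<sigma>)) powr (-1/2)"
      using m \<sigma> by (intro powr_mono2') auto
    also have "\<dots> = m powr (-1/2) * (1 + Im \<sigma>) powr (-1/2)" using m \<sigma> by (simp add: powr_mult)
    finally have "C * norm ?w powr (-1/2) \<le> C * (m powr (-1/2) * (1 + Im \<sigma>) powr (-1/2))"
      using C(1) by (rule mult_left_mono)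
    moreover have "norm (eta_heat M x (of_real (a\<^sup>2) * \<sigma>)) \<le> C * norm ?w powr (-1/2)"
      by (rule C(2)) (use \<sigma> in simp)
    ultimately show ?thesis by (simp add: mult.assoc)
  qed
  then show thesis using C(1) by (intro that[of "C * m powr (-1/2)"]) auto
qed

text \<open>At real time the kernel is the normal density of variance 2s. Its mass stays 1 as s
  tends to 0, while its supremum grows like s^(-1/2), too fast for the n-fold product to be
  integrable in s.\<close>

lemma integral_norm_heat_kernel:
  assumes "s > 0"
  shows "(\<integral>y. norm (heat_kernel (of_real s) (x - y)) \<partial>lborel) = 1"
    and "integrable lborel (\<lambda>y. norm (heat_kernel (of_real s) (x - y)))"
proof -
  have "norm (heat_kernel (of_real s) (x - y)) = normal_density x (sqrt (2 * s)) y" for y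
  proof -
    have "norm ((4 * complex_of_real pi * of_real s) powr (-1/2)) = 1 / sqrt (2 * pi * (2 * s))"
    proof -
      have 1: "norm (Z powr (-1/2)) = norm Z powr (-1/2)" for Z :: complex
        by (simp add: norm_powr_real_powr')
      have 2: "w powr (-1/2) = 1 / sqrt w" if "w > 0" for w :: real
        using that by (simp add: powr_minus powr_half_sqrt field_simps)
      have 3: "norm (4 * complex_of_real pi * of_real s) = 2 * pi * (2 * s)"
        using assms by (simp add: norm_mult)
      have "2 * pi * (2 * s) > 0" using assms by simp
      then show ?thesis unfolding 1 3 by (rule 2)
    qed
    moreover have "norm (exp (- (complex_of_real (x - y))\<^sup>2 / (4 * of_real s))) = exp (- (y - x)\<^sup>2 / (2 * (2 * s)))"
    proof -
      have "- (complex_of_real (x - y))\<^sup>2 / (4 * of_real s) = of_real (- (y - x)\<^sup>2 / (2 * (2 * s)))"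
        by (simp add: power2_commute[of "complex_of_real y"])
      then show ?thesis by (simp only: norm_exp_eq_Re Re_complex_of_real)
    qed
    ultimately show ?thesis using assms by (simp add: heat_kernel_def norm_mult normal_density_def)
  qed
  then show "(\<integral>y. norm (heat_kernel (of_real s) (x - y)) \<partial>lborel) = 1"
    "integrable lborel (\<lambda>y. norm (heat_kernel (of_real s) (x - y)))"
    using assms by simp_all
qed

text \<open>The majorant \<open>B\<close> bounds the L^1 norm in y for each t, not the integrand.
  This distinction matters on [0,1], where the weight alone is of order t^(-n/2). The weight
  \<open>A\<close> is allowed to carry the indicator of the parameter interval.\<close>

lemma kernel_Fubini:
  fixes f :: "'a::euclidean_space \<Rightarrow> complex" and A \<sigma> :: "real \<Rightarrow> complex" and x :: 'a
  assumes [measurable]: "A \<in> borel_measurable borel" "\<sigma> \<in> borel_measurable borel"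
    and f: "integrable lborel f"
    and \<sigma>: "\<And>t. Re (\<sigma> t) \<ge> 0"
    and B: "integrable lborel B"
    and le: "\<And>t. (\<integral>y. norm (A t * exp (- (of_real (norm (x - y)))\<^sup>2 / (4 * \<sigma> t)) * f y) \<partial>lborel) \<le> B t"
  defines "K \<equiv> \<lambda>t y. A t * exp (- (of_real (norm (x - y)))\<^sup>2 / (4 * \<sigma> t))"
  shows "integrable lborel (\<lambda>y. (\<integral>t. K t y \<partial>lborel) * f y)"
    and "(\<integral>y. (\<integral>t. K t y \<partial>lborel) * f y \<partial>lborel) = (\<integral>t. (\<integral>y. K t y * f y \<partial>lborel) \<partial>lborel)"
proof -
  have [measurable]: "f \<in> borel_measurable borel" using f by auto
  have Km: "(\<lambda>(t, y). K t y * f y) \<in> borel_measurable (lborel \<Otimes>\<^sub>M lborel)"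
    unfolding K_def by measurable
  have inner: "integrable lborel (\<lambda>y. K t y * f y)" for t
  proof (rule Bochner_Integration.integrable_bound)
    show "integrable lborel (\<lambda>y. A t * f y)" using f by simp
    show "AE y in lborel. norm (K t y * f y) \<le> norm (A t * f y)"
    proof (rule AE_I2)
      fix y
      have "norm (exp (- (complex_of_real (norm (x - y)))\<^sup>2 / (4 * \<sigma> t))) \<le> 1"
        by (rule norm_exp_neg_sq_divide_le) (use \<sigma>[of t] in simp)
      from mult_left_mono[OF this, of "norm (A t * f y)"]
      show "norm (K t y * f y) \<le> norm (A t * f y)" by (simp only: K_def norm_mult) (simp add: mult_ac)
    qed
  qed (simp add: K_def)
  have "integrable lborel (\<lambda>t. \<integral>y. norm (K t y * f y) \<partial>lborel)"
  proof (rule Bochner_Integration.integrable_bound[OF B])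
    show "(\<lambda>t. \<integral>y. norm (K t y * f y) \<partial>lborel) \<in> borel_measurable lborel"
      by (rule lborel.borel_measurable_lebesgue_integral) (unfold K_def, measurable)
    show "AE t in lborel. norm (\<integral>y. norm (K t y * f y) \<partial>lborel) \<le> norm (B t)"
    proof (rule AE_I2)
      fix t
      have "0 \<le> (\<integral>y. norm (K t y * f y) \<partial>lborel)" by simp
      then show "norm (\<integral>y. norm (K t y * f y) \<partial>lborel) \<le> norm (B t)"
        using le[of t] unfolding K_def real_norm_def by linarith
    qed
  qed
  then have int: "integrable (lborel \<Otimes>\<^sub>M lborel) (\<lambda>(t, y). K t y * f y)"
    by (intro lborel_pair.Fubini_integrable Km) (use inner in auto)
  have "integrable lborel (\<lambda>y. \<integral>t. K t y * f y \<partial>lborel)"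
    by (rule lborel_pair.integrable_snd[OF int])
  then show "integrable lborel (\<lambda>y. (\<integral>t. K t y \<partial>lborel) * f y)" by simp
  show "(\<integral>y. (\<integral>t. K t y \<partial>lborel) * f y \<partial>lborel) = (\<integral>t. (\<integral>y. K t y * f y \<partial>lborel) \<partial>lborel)"
    using lborel_pair.Fubini_integral[OF int] by simp
qed

section \<open>The fundamental solution as a path integral\<close>

definition path_weight :: "nat \<Rightarrow> real \<Rightarrow> complex \<Rightarrow> complex" where
  "path_weight n k \<sigma> = exp (of_real k * \<sigma>) * (4 * of_real pi * \<sigma>) powr (- of_nat n / 2)"

lemma path_weight_eq:
  assumes "c = r\<^sup>2 / 4"
  shows "path_weight n k \<sigma> * exp (- (of_real r)\<^sup>2 / (4 * \<sigma>))
      = of_real ((4 * pi) powr (- real n / 2)) * (exp (of_real k * \<sigma>) * \<sigma> powr of_real (- (real n / 2 - 1) - 1) * exp (- of_real c / \<sigma>))"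
proof -
  have "(complex_of_real (4 * pi) * \<sigma>) powr (- of_nat n / 2) = of_real (4 * pi) powr (- of_nat n / 2) * \<sigma> powr (- of_nat n / 2)"
    by (rule powr_times_real_left) auto
  moreover have "complex_of_real (4 * pi) powr (- of_nat n / 2) = of_real ((4 * pi) powr (- real n / 2))"
    using powr_of_real[of "4 * pi" "- real n / 2"] by simp
  moreover have "- (complex_of_real r)\<^sup>2 / (4 * \<sigma>) = - of_real c / \<sigma>"
  proof -
    have e: "complex_of_real c = (of_real r)\<^sup>2 / 4" unfolding assms by simp
    show ?thesis unfolding e by simp
  qed
  moreover have "complex_of_real (- (real n / 2 - 1) - 1) = - of_nat n / 2" by simp
  ultimately show ?thesis unfolding path_weight_def by (simp only: of_real_mult of_real_numeral mult_ac)
qed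

text \<open>Here \<rho> = r/2 and \<nu> = n/2 - 1, positive since n \<ge> 3. The constants match
  because n/2 = \<nu> + 1: one factor 4 pi against pi leaves the 1/4, and the others turn
  2\<kappa>/r into \<kappa>/(2 pi r).\<close>

lemma fund_sol_eq_hankel_int:
  assumes n: "n \<ge> 3" and \<kappa>: "\<kappa> > 0" and r: "r > 0"
  shows "fund_sol n \<kappa> r = of_real ((4 * pi) powr (- real n / 2)) * hankel_int (\<kappa>\<^sup>2) (r\<^sup>2 / 4) (real n / 2 - 1)"
proof -
  define \<nu> where "\<nu> = real n / 2 - 1"
  have \<nu>: "\<nu> > 0" using n by (simp add: \<nu>_def)
  have "hankel_int (\<kappa>\<^sup>2) ((r/2)\<^sup>2) \<nu> = \<i> * of_real (pi * (\<kappa> / (r/2)) powr \<nu>) * hankel1 \<nu> (2 * (\<kappa> * (r/2)))"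
    by (rule hankel_int_eq) (use \<kappa> r \<nu> in auto)
  then have h: "hankel_int (\<kappa>\<^sup>2) (r\<^sup>2 / 4) \<nu> = \<i> * of_real (pi * (2 * \<kappa> / r) powr \<nu>) * hankel1 \<nu> (\<kappa> * r)"
    by (simp add: power_divide mult.commute)
  have "(4 * pi) powr (- real n / 2) * (pi * (2 * \<kappa> / r) powr \<nu>) = 1/4 * (\<kappa> / (2 * pi * r)) powr \<nu>"
  proof -
    have "- real n / 2 = - \<nu> - 1" by (simp add: \<nu>_def)
    then have "(4 * pi) powr (- real n / 2) = (4 * pi) powr (- \<nu>) / (4 * pi)" by (simp add: powr_diff)
    moreover have "(\<kappa> / (2 * pi * r)) powr \<nu> = (4 * pi) powr (- \<nu>) * (2 * \<kappa> / r) powr \<nu>"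
    proof -
      have "\<kappa> / (2 * pi * r) = (2 * \<kappa> / r) / (4 * pi)" by simp
      also have "\<dots> powr \<nu> = (2 * \<kappa> / r) powr \<nu> / (4 * pi) powr \<nu>"
        by (rule powr_divide)
      finally show ?thesis by (simp only: powr_minus divide_inverse mult.commute)
    qed
    ultimately show ?thesis by simp
  qed
  from arg_cong[OF this, of complex_of_real]
  have "complex_of_real ((4 * pi) powr (- real n / 2)) * of_real (pi * (2 * \<kappa> / r) powr \<nu>) = 1/4 * of_real ((\<kappa> / (2 * pi * r)) powr \<nu>)"
    by (simp only: of_real_mult of_real_divide of_real_1 of_real_numeral)
  then have "of_real ((4 * pi) powr (- real n / 2)) * hankel_int (\<kappa>\<^sup>2) (r\<^sup>2 / 4) \<nu> = \<i> * (1/4 * of_real ((\<kappa> / (2 * pi * r)) powr \<nu>)) * hankel1 \<nu> (\<kappa> * r)"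
    unfolding h by (simp only: mult_ac)
  then show ?thesis by (simp add: fund_sol_def \<nu>_def)
qed

lemma fund_sol_eq_path_integral:
  assumes n: "n \<ge> 3" and \<kappa>: "\<kappa> > 0" and r: "r > 0"
  shows "fund_sol n \<kappa> r =
      (LINT t:{0..1}|lborel. path_weight n (\<kappa>\<^sup>2) (of_real t) * exp (- (of_real r)\<^sup>2 / (4 * of_real t)))
    + (LINT t:{0..}|lborel. \<i> * path_weight n (\<kappa>\<^sup>2) (1 + \<i> * of_real t) * exp (- (of_real r)\<^sup>2 / (4 * (1 + \<i> * of_real t))))"
proof -
  let ?c = "complex_of_real ((4 * pi) powr (- real n / 2))"
  let ?\<nu> = "real n / 2 - 1"
  have "?c * of_real (hankel_int1 (\<kappa>\<^sup>2) (r\<^sup>2 / 4) ?\<nu>) = (LINT t:{0..1}|lborel. path_weight n (\<kappa>\<^sup>2) (of_real t) * exp (- (of_real r)\<^sup>2 / (4 * of_real t)))"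
    unfolding hankel_int1_def set_integral_complex_of_real[symmetric] set_integral_mult_right[symmetric]
  proof (intro set_lebesgue_integral_cong ballI allI impI)
    fix t :: real assume "t \<in> {0..1}"
    then have "complex_of_real t powr of_real (- ?\<nu> - 1) = of_real (t powr (- ?\<nu> - 1))"
      by (intro powr_of_real) auto
    then show "?c * of_real (exp (\<kappa>\<^sup>2 * t) * (t powr (- ?\<nu> - 1) * exp (- (r\<^sup>2 / 4) / t)))
        = path_weight n (\<kappa>\<^sup>2) (of_real t) * exp (- (of_real r)\<^sup>2 / (4 * of_real t))"
      unfolding path_weight_eq[OF refl] by (simp add: exp_of_real[symmetric] mult.assoc)
  qed simp
  moreover have "?c * hankel_int2 (\<kappa>\<^sup>2) (r\<^sup>2 / 4) ?\<nu> = (LINT t:{0..}|lborel. \<i> * path_weight n (\<kappa>\<^sup>2) (1 + \<i> * of_real t) * exp (- (of_real r)\<^sup>2 / (4 * (1 + \<i> * of_real t))))"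
    unfolding hankel_int2_def set_integral_mult_right[symmetric] mult.assoc[of \<i>] path_weight_eq[OF refl]
    by (simp only: mult_ac)
  ultimately show ?thesis
    unfolding fund_sol_eq_hankel_int[OF assms] hankel_int_def by (simp only: distrib_left)
qed

lemma norm_path_weight_imag_le:
  assumes "t \<ge> 0"
  shows "norm (path_weight n k (1 + \<i> * of_real t)) \<le> exp k * ((4 * pi) powr (- real n / 2) * (2 powr (real n / 2) * (1 + t) powr (- real n / 2)))"
proof -
  let ?p = "- real n / 2"
  let ?s = "1 + \<i> * complex_of_real t"
  have "(complex_of_real (4 * pi) * ?s) powr of_real (?p) 
     = of_real (4 * pi) powr of_real (?p) * ?s powr of_real (?p)"
    by (rule powr_times_real_left) auto
  then have "norm ((4 * complex_of_real pi * ?s) powr (- of_nat n / 2)) 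
     = norm (complex_of_real (4 * pi) powr of_real (?p)) * norm (?s powr of_real (?p))"
    by (simp add: norm_mult)
  also have "norm (complex_of_real (4 * pi) powr of_real (?p)) = (4 * pi) powr (?p)"
    by (subst norm_powr_real_powr') auto
  also have "(4 * pi) powr (?p) * norm (?s powr of_real (?p))
     \<le> (4 * pi) powr (?p) * (2 powr (real n / 2) * (1 + t) powr (?p))"
    using norm_one_plus_ii_powr_le[OF assms, of "?p"] by (intro mult_left_mono) auto
  finally show ?thesis by (simp add: path_weight_def norm_mult)
qed

text \<open>\<open>e\<^bsup>k\<sigma>\<^esup>\<close> times the heat extension of the right-hand side to complex time \<open>\<sigma>\<close>.\<close>

definition aniso_wave :: "nat \<Rightarrow> real \<Rightarrow> real^'n \<Rightarrow> real^'n \<Rightarrow> complex \<Rightarrow> complex" where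
  "aniso_wave M k a x \<sigma> = exp (of_real k * \<sigma>) * (\<Prod>j\<in>UNIV. eta_heat M (a $ j * x $ j) (of_real ((a $ j)\<^sup>2) * \<sigma>))"

lemma kernel_eta_integral:
  fixes a x :: "real^'n"
  assumes \<sigma>: "Re \<sigma> > 0" and M: "M \<ge> 1" and a: "\<forall>j. a $ j > 0"
  shows "(\<integral>y. path_weight CARD('n) k \<sigma> * exp (- (of_real (norm (x - y)))\<^sup>2 / (4 * \<sigma>))
      * complex_of_real (\<Prod>j\<in>UNIV. eta M (a $ j * y $ j)) \<partial>lborel) = aniso_wave M k a x \<sigma>"
proof -
  let ?k = "\<lambda>y. path_weight CARD('n) k \<sigma> * exp (- (of_real (norm (x - y)))\<^sup>2 / (4 * \<sigma>))"
  let ?e = "\<lambda>j t. complex_of_real (eta M (a $ j * t))"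
  have nz: "\<sigma> \<noteq> 0" using \<sigma> by auto
  have "(\<integral>y. ?k y
      * complex_of_real (\<Prod>j\<in>UNIV. eta M (a $ j * y $ j)) \<partial>lborel)
     = (\<integral>y. exp (of_real k * \<sigma>) * (\<Prod>j\<in>UNIV. heat_kernel \<sigma> (x $ j - y $ j) * ?e j (y $ j)) \<partial>lborel)"
  proof (intro Bochner_Integration.integral_cong refl)
    fix y :: "real^'n"
    have "?k y = exp (of_real k * \<sigma>) * (\<Prod>j\<in>UNIV. heat_kernel \<sigma> (x $ j - y $ j))"
      unfolding path_weight_def mult.assoc[of "exp (of_real k * \<sigma>)"] prod_heat_kernel[OF nz, symmetric] vector_minus_component ..
    then show "?k y * complex_of_real (\<Prod>j\<in>UNIV. eta M (a $ j * y $ j))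
       = exp (of_real k * \<sigma>) * (\<Prod>j\<in>UNIV. heat_kernel \<sigma> (x $ j - y $ j) * ?e j (y $ j))"
      by (simp only: mult.assoc of_real_prod prod.distrib)
  qed
  also have "\<dots> = exp (of_real k * \<sigma>) * (\<integral>y. (\<Prod>j\<in>UNIV. heat_kernel \<sigma> (x $ j - y $ j) * ?e j (y $ j)) \<partial>lborel)"
    by simp
  also have "(\<integral>y. (\<Prod>j\<in>UNIV. heat_kernel \<sigma> (x $ j - y $ j) * ?e j (y $ j)) \<partial>lborel)
     = (\<Prod>j\<in>UNIV. \<integral>y. heat_kernel \<sigma> (x $ j - y) * ?e j y \<partial>lborel)"
    by (rule lborel_vec_prod(2)) (use a M in \<open>auto intro!: integrable_heat_kernel_mult[OF \<sigma>] integrable_eta_scaled\<close>)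
  also have "\<dots> = (\<Prod>j\<in>UNIV. eta_heat M (a $ j * x $ j) (of_real ((a $ j)\<^sup>2) * \<sigma>))"
    by (intro prod.cong refl heat_kernel_eta_scaled \<sigma> M) (use a in simp)
  finally show ?thesis by (simp add: aniso_wave_def)
qed

lemma integrable_prod_eta:
  fixes a :: "real^'n"
  assumes M: "M \<ge> 1" and a: "\<forall>j. a $ j > 0"
  shows "integrable lborel (\<lambda>y::real^'n. complex_of_real (\<Prod>j\<in>UNIV. eta M (a $ j * y $ j)))"
  unfolding of_real_prod
  by (rule lborel_vec_prod(1)) (use a M in \<open>auto intro!: integrable_eta_scaled\<close>)

lemma norm_prod_eta_le:
  fixes a :: "real^'n"
  assumes M: "M \<ge> 1"
  obtains C where "\<And>y::real^'n. norm (complex_of_real (\<Prod>j\<in>UNIV. eta M (a $ j * y $ j))) \<le> C"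
proof -
  obtain C where C: "\<And>y. \<bar>eta M y\<bar> \<le> C" using bounded_eta[OF M] by blast
  show thesis
  proof (rule that)
    fix y :: "real^'n"
    have "norm (complex_of_real (\<Prod>j\<in>UNIV. eta M (a $ j * y $ j))) = (\<Prod>j\<in>UNIV. \<bar>eta M (a $ j * y $ j)\<bar>)"
      by (simp only: norm_of_real abs_prod)
    also have "\<dots> \<le> (\<Prod>j\<in>(UNIV::'n set). C)" by (intro prod_mono conjI C) auto
    finally show "norm (complex_of_real (\<Prod>j\<in>UNIV. eta M (a $ j * y $ j))) \<le> (\<Prod>j\<in>(UNIV::'n set). C)" .
  qed
qed

text \<open>The strip Re \<sigma> \<le> 1 keeps the exponential below exp k, and the n coordinates
  contribute decay (1 + Im \<sigma>)^(-1/2) each.\<close>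

lemma aniso_wave_bound:
  fixes a x :: "real^'n"
  assumes a: "\<forall>j. a $ j > 0" and k: "k > 0"
  obtains C where "\<And>\<sigma>. 0 \<le> Re \<sigma> \<Longrightarrow> Re \<sigma> \<le> 1 \<Longrightarrow> 0 \<le> Im \<sigma> \<Longrightarrow>
      norm (aniso_wave M k a x \<sigma>) \<le> C * (1 + Im \<sigma>) powr (- real CARD('n) / 2)"
proof -
  let ?V = "\<lambda>j \<sigma>. eta_heat M (a $ j * x $ j) (of_real ((a $ j)\<^sup>2) * \<sigma>)"
  have "\<forall>j. \<exists>C. C \<ge> 0 \<and> (\<forall>\<sigma>. Re \<sigma> \<ge> 0 \<longrightarrow> Im \<sigma> \<ge> 0 \<longrightarrow>
      norm (?V j \<sigma>) \<le> C * (1 + Im \<sigma>) powr (-1/2))"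
  proof
    fix j
    show "\<exists>C. C \<ge> 0 \<and> (\<forall>\<sigma>. Re \<sigma> \<ge> 0 \<longrightarrow> Im \<sigma> \<ge> 0 \<longrightarrow>
      norm (?V j \<sigma>) \<le> C * (1 + Im \<sigma>) powr (-1/2))"
      using eta_heat_scaled_bound[of "a $ j" M "a $ j * x $ j"] a by metis
  qed
  then obtain C where C: "\<And>j. C j \<ge> 0" "\<And>j \<sigma>. Re \<sigma> \<ge> 0 \<Longrightarrow> Im \<sigma> \<ge> 0 \<Longrightarrow>
      norm (?V j \<sigma>) \<le> C j * (1 + Im \<sigma>) powr (-1/2)"
    by metis
  show thesis
  proof (rule that)
    fix \<sigma> :: complex assume \<sigma>: "0 \<le> Re \<sigma>" "Re \<sigma> \<le> 1" "0 \<le> Im \<sigma>"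
    have "norm (exp (of_real k * \<sigma>)) \<le> exp k" using \<sigma> k by (simp add: mult_left_le)
    moreover have "norm (\<Prod>j\<in>UNIV. ?V j \<sigma>) \<le> (\<Prod>j\<in>UNIV. C j * (1 + Im \<sigma>) powr (-1/2))"
      unfolding prod_norm[symmetric] by (intro prod_mono conjI C(2) \<sigma>) auto
    moreover have "(\<Prod>j\<in>UNIV. C j * (1 + Im \<sigma>) powr (-1/2)) = (\<Prod>j\<in>UNIV. C j) * (1 + Im \<sigma>) powr (- real CARD('n) / 2)"
      using \<sigma> by (simp add: prod.distrib powr_power)
    ultimately have "norm (aniso_wave M k a x \<sigma>) \<le> exp k * ((\<Prod>j\<in>UNIV. C j) * (1 + Im \<sigma>) powr (- real CARD('n) / 2))"
      unfolding aniso_wave_def norm_mult by (intro mult_mono) auto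
    then show "norm (aniso_wave M k a x \<sigma>) \<le> (exp k * (\<Prod>j\<in>UNIV. C j)) * (1 + Im \<sigma>) powr (- real CARD('n) / 2)"
      by (simp only: mult.assoc)
  qed
qed

lemma aniso_wave_holomorphic: "aniso_wave M k a x holomorphic_on {\<sigma>. Re \<sigma> \<ge> 0}"
proof -
  have "(\<lambda>\<sigma>. eta_heat M (a $ j * x $ j) (of_real ((a $ j)\<^sup>2) * \<sigma>)) holomorphic_on {\<sigma>. Re \<sigma> \<ge> 0}" for j
  proof -
    have "(eta_heat M (a $ j * x $ j) \<circ> (\<lambda>\<sigma>. of_real ((a $ j)\<^sup>2) * \<sigma>)) holomorphic_on {\<sigma>. Re \<sigma> \<ge> 0}"
      by (intro holomorphic_on_compose holomorphic_intros holomorphic_on_subset[OF eta_heat_holomorphic]) auto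
    then show ?thesis by (simp add: o_def)
  qed
  then show ?thesis unfolding aniso_wave_def by (intro holomorphic_intros) auto
qed

text \<open>For real t the modulus of the kernel is exp (k t) times a product of normal densities of
  total mass 1, so boundedness of \<open>f\<close> gives a bound uniform in t.\<close>

lemma integral_unit_kernel_le:
  fixes f :: "real^'n \<Rightarrow> complex" and x :: "real^'n"
  assumes f: "integrable lborel f" and C: "\<And>y. norm (f y) \<le> C" and k: "k > 0" and t: "0 < t" "t \<le> 1"
  shows "(\<integral>y. norm (path_weight CARD('n) k (of_real t) * exp (- (of_real (norm (x - y)))\<^sup>2 / (4 * of_real t)) * f y) \<partial>lborel) \<le> exp k * C"
proof -
  let ?k = "\<lambda>y. path_weight CARD('n) k (of_real t) * exp (- (of_real (norm (x - y)))\<^sup>2 / (4 * of_real t))"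
  let ?N = "\<lambda>y::real^'n. \<Prod>j\<in>UNIV. norm (heat_kernel (of_real t) (x $ j - y $ j))"
  have nz: "complex_of_real t \<noteq> 0" using t by simp
  have C0: "C \<ge> 0" using order_trans[OF norm_ge_zero C] .
  have eq: "norm (?k y * f y)
      = exp (k * t) * (?N y * norm (f y))" for y
  proof -
    have "?k y 
       = exp (of_real k * of_real t) * (\<Prod>j\<in>UNIV. heat_kernel (of_real t) (x $ j - y $ j))"
      unfolding path_weight_def mult.assoc[of "exp (of_real k * of_real t)"] prod_heat_kernel[OF nz, symmetric] vector_minus_component ..
    then show ?thesis by (simp add: norm_mult prod_norm)
  qed
  have N: "integrable lborel ?N" "integral\<^sup>L lborel ?N = 1"
    using integral_norm_heat_kernel[OF t(1)]
      lborel_vec_prod[of "\<lambda>j y. norm (heat_kernel (of_real t) (x $ j - y))"] by auto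
  have "(\<integral>y. exp (k * t) * (?N y * norm (f y)) \<partial>lborel) \<le> (\<integral>y. exp k * C * ?N y \<partial>lborel)"
  proof (rule integral_mono')
    show "integrable lborel (\<lambda>y. exp k * C * ?N y)" using N(1) by simp
    fix y
    have N0: "?N y \<ge> 0" by (simp add: prod_nonneg)
    have "exp (k * t) * (?N y * norm (f y)) \<le> exp k * (?N y * C)"
      using k t N0 by (intro mult_mono C) (auto simp: mult_left_le)
    then show "exp (k * t) * (?N y * norm (f y)) \<le> exp k * C * ?N y" by (simp only: mult_ac)
    show "0 \<le> exp k * C * ?N y" using C0 N0 by simp
  qed
  then show ?thesis unfolding eq using N(2) by simp
qed

lemma path_weight_unit_measurable:
  "(\<lambda>t. indicator {0..1} t *\<^sub>R path_weight n k (complex_of_real t)) \<in> borel_measurable borel"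
proof -
  have "set_borel_measurable lborel {0<..1} (\<lambda>t. path_weight n k (complex_of_real t))"
    unfolding path_weight_def
    by (intro set_borel_measurable_lborel_continuous continuous_intros) (use four_pi_not_nonpos in auto)
  moreover have "(\<lambda>t. indicator {0..1} t *\<^sub>R path_weight n k (complex_of_real t)) = (\<lambda>t. indicator {0<..1} t *\<^sub>R path_weight n k (complex_of_real t))"
  proof
    fix t :: real
    show "indicator {0..1} t *\<^sub>R path_weight n k (complex_of_real t) = indicator {0<..1} t *\<^sub>R path_weight n k (complex_of_real t)"
      by (cases "t = 0") (auto simp: indicator_def path_weight_def)
  qed
  ultimately show ?thesis by (simp add: set_borel_measurable_def)
qed

lemma path_weight_ray_measurable:
  "(\<lambda>t. indicator {0..} t *\<^sub>R (\<i> * path_weight n k (1 + \<i> * complex_of_real t))) \<in> borel_measurable borel"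
proof -
  have "set_borel_measurable lborel {0..} (\<lambda>t. \<i> * path_weight n k (1 + \<i> * complex_of_real t))"
    unfolding path_weight_def
    by (intro set_borel_measurable_lborel_continuous continuous_intros)
       (use ray_not_nonpos(2)[of \<i>] in auto)
  then show ?thesis by (simp add: set_borel_measurable_def)
qed

lemma fund_sol_convolution:
  fixes a x :: "real^'n" and \<kappa> :: real
  assumes n: "CARD('n) \<ge> 3" and M: "M \<ge> 1" and \<kappa>: "\<kappa> > 0" and a: "\<forall>j. a $ j > 0"
  defines "f \<equiv> \<lambda>y::real^'n. complex_of_real (\<Prod>j\<in>UNIV. eta M (a $ j * y $ j))"
  defines "W \<equiv> aniso_wave M (\<kappa>\<^sup>2) a x"
  shows "integrable lborel (\<lambda>y. fund_sol CARD('n) \<kappa> (norm (x - y)) * f y)"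
    and "(\<integral>y. fund_sol CARD('n) \<kappa> (norm (x - y)) * f y \<partial>lborel)
      = (LINT t:{0..1}|lborel. W (of_real t)) + \<i> * (LINT t:{0..}|lborel. W (Complex 1 t))"
proof -
  let ?e = "\<lambda>y \<sigma>. exp (- (of_real (norm (x - y)))\<^sup>2 / (4 * \<sigma>)) :: complex"
  let ?n = "CARD('n)"
  define A1 where "A1 = (\<lambda>t. indicator {0..1} t *\<^sub>R path_weight ?n (\<kappa>\<^sup>2) (complex_of_real t))"
  define A2 where "A2 = (\<lambda>t. indicator {0..} t *\<^sub>R (\<i> * path_weight ?n (\<kappa>\<^sup>2) (1 + \<i> * complex_of_real t)))"
  \<comment> \<open>Truncation at 0 keeps the real part nonnegative for every real parameter, as the
    Fubini lemma requires; \<open>A1\<close> vanishes where it alters the path.\<close>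
  define s1 where "s1 = (\<lambda>t. complex_of_real (max 0 t))"
  define s2 where "s2 = (\<lambda>t. 1 + \<i> * complex_of_real t)"
  define K1 where "K1 = (\<lambda>t y. A1 t * ?e y (s1 t))"
  define K2 where "K2 = (\<lambda>t y. A2 t * ?e y (s2 t))"
  have k: "\<kappa>\<^sup>2 > 0" using \<kappa> by simp
  have fi: "integrable lborel f" unfolding f_def by (rule integrable_prod_eta[OF M a])
  obtain C where C: "\<And>y. norm (f y) \<le> C" unfolding f_def using norm_prod_eta_le[OF M] by blast
  have C0: "C \<ge> 0" using order_trans[OF norm_ge_zero C] .
  have A1m: "A1 \<in> borel_measurable borel" unfolding A1_def by (rule path_weight_unit_measurable)
  have A2m: "A2 \<in> borel_measurable borel" unfolding A2_def by (rule path_weight_ray_measurable)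
  have s1m: "s1 \<in> borel_measurable borel" unfolding s1_def by measurable
  have s2m: "s2 \<in> borel_measurable borel" unfolding s2_def by measurable
  \<comment> \<open>The singular endpoint is harmless: \<open>0 powr p\<close> is 0, so the weight
    is 0 there.\<close>
  have A1_0: "A1 0 = 0" by (simp add: A1_def path_weight_def)
  have le1: "(\<integral>y. norm (A1 t * ?e y (s1 t) * f y) \<partial>lborel) \<le> indicator {0..1} t *\<^sub>R (exp (\<kappa>\<^sup>2) * C)" for t
  proof (cases "0 < t \<and> t \<le> 1")
    case True
    then show ?thesis using integral_unit_kernel_le[OF fi C k, of t x] by (simp add: A1_def s1_def)
  next
    case False
    then have "A1 t = 0" using A1_0 by (cases "t = 0") (auto simp: A1_def)
    then show ?thesis using C0 by (simp add: indicator_def)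
  qed
  have B1: "integrable lborel (\<lambda>t::real. indicator {0..1} t *\<^sub>R (exp (\<kappa>\<^sup>2) * C) :: real)"
  proof -
    have "set_integrable lborel {0..1::real} (\<lambda>t. exp (\<kappa>\<^sup>2) * C)"
      by (intro borel_integrable_atLeastAtMost' continuous_intros)
    then show ?thesis unfolding set_integrable_def .
  qed
  let ?b = "\<lambda>t. exp (\<kappa>\<^sup>2) * ((4 * pi) powr (- real ?n / 2) * (2 powr (real ?n / 2) * (1 + t) powr (- real ?n / 2)))"
  have le2: "(\<integral>y. norm (A2 t * ?e y (s2 t) * f y) \<partial>lborel)
      \<le> (\<integral>y. norm (f y) \<partial>lborel) * (indicator {0..} t *\<^sub>R ?b t)" for t
  proof -
    have "norm (A2 t * ?e y (s2 t) * f y) \<le> norm (f y) * (indicator {0..} t *\<^sub>R ?b t)" for y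
    proof (cases "t \<ge> 0")
      case True
      have 1: "norm (A2 t) \<le> ?b t"
        using norm_path_weight_imag_le[OF True, of ?n "\<kappa>\<^sup>2"] True by (simp add: A2_def norm_mult)
      have 2: "norm (?e y (s2 t)) \<le> 1"
        by (rule norm_exp_neg_sq_divide_le) (simp add: s2_def)
      have "norm (A2 t * ?e y (s2 t) * f y) \<le> ?b t * 1 * norm (f y)"
        unfolding norm_mult by (intro mult_mono 1 2 order_refl mult_nonneg_nonneg) auto
      then show ?thesis using True by (simp add: mult_ac)
    qed (simp add: A2_def)
    then have "(\<integral>y. norm (A2 t * ?e y (s2 t) * f y) \<partial>lborel)
       \<le> (\<integral>y. norm (f y) * (indicator {0..} t *\<^sub>R ?b t) \<partial>lborel)"
      by (intro integral_mono') (use fi in auto)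
    then show ?thesis by simp
  qed
  have B2: "integrable lborel (\<lambda>t. (\<integral>y. norm (f y) \<partial>lborel) * (indicator {0..} t *\<^sub>R ?b t))"
  proof -
    have "set_integrable lborel {0..} ?b"
      by (intro set_integrable_mult_right set_integrable_powr_shift) (use n in simp)
    then show ?thesis unfolding set_integrable_def by (rule integrable_mult_right)
  qed
  have F1: "integrable lborel (\<lambda>y. (\<integral>t. K1 t y \<partial>lborel) * f y)"
    "(\<integral>y. (\<integral>t. K1 t y \<partial>lborel) * f y \<partial>lborel) = (\<integral>t. (\<integral>y. K1 t y * f y \<partial>lborel) \<partial>lborel)"
    unfolding K1_def by (rule kernel_Fubini[OF A1m s1m fi _ B1 le1]; simp add: s1_def)+
  have F2: "integrable lborel (\<lambda>y. (\<integral>t. K2 t y \<partial>lborel) * f y)"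
    "(\<integral>y. (\<integral>t. K2 t y \<partial>lborel) * f y \<partial>lborel) = (\<integral>t. (\<integral>y. K2 t y * f y \<partial>lborel) \<partial>lborel)"
    unfolding K2_def by (rule kernel_Fubini[OF A2m s2m fi _ B2 le2]; simp add: s2_def)+
  have fs: "fund_sol ?n \<kappa> (norm (x - y)) = (\<integral>t. K1 t y \<partial>lborel) + (\<integral>t. K2 t y \<partial>lborel)" if "y \<noteq> x" for y
  proof -
    have "(\<lambda>t. K1 t y) = (\<lambda>t. indicator {0..1} t *\<^sub>R (path_weight ?n (\<kappa>\<^sup>2) (of_real t) * ?e y (of_real t)))"
      by (auto simp: K1_def A1_def s1_def indicator_def max_def)
    moreover have "(\<lambda>t. K2 t y) = (\<lambda>t. indicator {0..} t *\<^sub>R (\<i> * path_weight ?n (\<kappa>\<^sup>2) (1 + \<i> * of_real t) * ?e y (1 + \<i> * of_real t)))"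
      by (auto simp: K2_def A2_def s2_def)
    ultimately show ?thesis
      using fund_sol_eq_path_integral[OF n \<kappa>, of "norm (x - y)"] that unfolding set_lebesgue_integral_def by simp
  qed
  let ?I = "\<lambda>y. (\<integral>t. K1 t y \<partial>lborel) * f y + (\<integral>t. K2 t y \<partial>lborel) * f y"
  have I: "integrable lborel ?I" using F1(1) F2(1) by (rule Bochner_Integration.integrable_add)
  then have [measurable]: "?I \<in> borel_measurable borel" by auto
  let ?F = "\<lambda>y. fund_sol ?n \<kappa> (norm (x - y)) * f y"
  \<comment> \<open>At \<open>y = x\<close> the kernel has a junk value, which still has to be measurable.\<close>
  have Feq: "?F = (\<lambda>y. if y = x then ?F x else ?I y)"
    using fs by (auto simp: distrib_right)
  have Fm: "?F \<in> borel_measurable lborel" by (subst Feq) measurable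
  have ae: "AE y in lborel. ?F y = ?I y"
    using AE_lborel_singleton[of x] by eventually_elim (simp add: fs distrib_right)
  show "integrable lborel ?F"
    using integrable_cong_AE[OF Fm _ ae] I by simp
  have "(\<integral>y. ?F y \<partial>lborel) = (\<integral>y. ?I y \<partial>lborel)"
    by (rule integral_cong_AE[OF Fm _ ae]) simp
  also have "\<dots> = (\<integral>t. (\<integral>y. K1 t y * f y \<partial>lborel) \<partial>lborel) + (\<integral>t. (\<integral>y. K2 t y * f y \<partial>lborel) \<partial>lborel)"
    using F1 F2 by simp
  also have "(\<integral>t. (\<integral>y. K1 t y * f y \<partial>lborel) \<partial>lborel) = (LINT t:{0..1}|lborel. W (of_real t))"
  proof -
    \<comment> \<open>The interval is half-open because at t = 0 the left side is 0, while
      \<open>W\<close> extends continuously to its value at 0. The endpoint is restored afterwards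
      as a null set.\<close>
    have "(\<integral>y. K1 t y * f y \<partial>lborel) = indicator {0<..1} t *\<^sub>R W (of_real t)" for t
    proof (cases "0 < t \<and> t \<le> 1")
      case True
      then show ?thesis
        using kernel_eta_integral[of "of_real t" M a "\<kappa>\<^sup>2" x] M a by (simp add: K1_def A1_def s1_def f_def W_def)
    next
      case False
      then have "A1 t = 0" using A1_0 by (cases "t = 0") (auto simp: A1_def)
      then show ?thesis using False by (simp add: K1_def)
    qed
    then have "(\<integral>t. (\<integral>y. K1 t y * f y \<partial>lborel) \<partial>lborel) = (LINT t:{0<..1}|lborel. W (of_real t))"
      by (simp add: set_lebesgue_integral_def)
    also have "\<dots> = (LINT t:{0..1}|lborel. W (of_real t))"
      unfolding set_lebesgue_integral_def
    proof (rule integral_cong_AE)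
      have cont: "continuous_on S (\<lambda>t. W (of_real t))" if "S \<subseteq> {0..}" for S
        unfolding W_def
        by (rule continuous_on_compose2[OF holomorphic_on_imp_continuous_on[OF aniso_wave_holomorphic]])
           (use that in \<open>auto intro!: continuous_intros\<close>)
      show "(\<lambda>t. indicator {0<..1} t *\<^sub>R W (of_real t)) \<in> borel_measurable lborel"
        "(\<lambda>t. indicator {0..1} t *\<^sub>R W (of_real t)) \<in> borel_measurable lborel"
        using set_borel_measurable_lborel_continuous[OF _ cont, of "{0<..1}"]
          set_borel_measurable_lborel_continuous[OF _ cont, of "{0..1}"]
        by (auto simp: set_borel_measurable_def subset_iff)
      show "AE t in lborel. indicator {0<..1} t *\<^sub>R W (of_real t) = indicator {0..1} t *\<^sub>R W (of_real t)"
        using AE_lborel_singleton[of 0] by eventually_elim (auto simp: indicator_def)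
    qed
    finally show ?thesis .
  qed
  also have "(\<integral>t. (\<integral>y. K2 t y * f y \<partial>lborel) \<partial>lborel) = (LINT t:{0..}|lborel. \<i> * W (Complex 1 t))"
  proof -
    have "(\<integral>y. K2 t y * f y \<partial>lborel) = indicator {0..} t *\<^sub>R (\<i> * W (Complex 1 t))" for t
    proof (cases "t \<ge> 0")
      case True
      have "(\<integral>y. path_weight ?n (\<kappa>\<^sup>2) (s2 t) * ?e y (s2 t) * f y \<partial>lborel) = W (s2 t)"
        unfolding f_def W_def by (rule kernel_eta_integral[OF _ M a]) (simp add: s2_def)
      moreover have "(\<lambda>y. K2 t y * f y) = (\<lambda>y. \<i> * (path_weight ?n (\<kappa>\<^sup>2) (s2 t) * ?e y (s2 t) * f y))"
        using True by (simp add: K2_def A2_def s2_def mult.assoc)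
      ultimately have "(\<integral>y. K2 t y * f y \<partial>lborel) = \<i> * W (s2 t)"
        by (simp only: integral_mult_right_zero)
      moreover have "s2 t = Complex 1 t" by (simp add: s2_def Complex_eq)
      ultimately show ?thesis using True by simp
    qed (simp add: K2_def A2_def)
    then show ?thesis by (simp only: set_lebesgue_integral_def)
  qed
  finally show "(\<integral>y. ?F y \<partial>lborel) = (LINT t:{0..1}|lborel. W (of_real t)) + \<i> * (LINT t:{0..}|lborel. W (Complex 1 t))"
    by simp
qed

text \<open>The decay exponent -n/2 is below -1 for n \<ge> 3, so both vertical integrals converge
  absolutely and the top side of the rectangle disappears.\<close>

lemma aniso_wave_shift:
  fixes a x :: "real^'n" and M :: nat
  assumes n: "CARD('n) \<ge> 3" and k: "k > 0" and a: "\<forall>j. a $ j > 0"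
  defines "W \<equiv> aniso_wave M k a x"
  shows "set_integrable lborel {0..} (\<lambda>t. W (Complex 0 t))"
    and "(LINT t:{0..1}|lborel. W (of_real t)) + \<i> * (LINT t:{0..}|lborel. W (Complex 1 t))
      = \<i> * (LINT t:{0..}|lborel. W (Complex 0 t))"
proof -
  obtain C where C: "\<And>\<sigma>. 0 \<le> Re \<sigma> \<Longrightarrow> Re \<sigma> \<le> 1 \<Longrightarrow> 0 \<le> Im \<sigma> \<Longrightarrow>
      norm (W \<sigma>) \<le> C * (1 + Im \<sigma>) powr (- real CARD('n) / 2)"
    unfolding W_def using aniso_wave_bound[OF a k] by blast
  have cont: "continuous_on {\<sigma>. Re \<sigma> \<ge> 0} W"
    unfolding W_def by (rule holomorphic_on_imp_continuous_on[OF aniso_wave_holomorphic])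
  have int: "set_integrable lborel {0..} (\<lambda>t. W (Complex c t))" if "0 \<le> c" "c \<le> 1" for c
  proof (rule set_integrable_bound)
    show "set_integrable lborel {0..} (\<lambda>t. C * (1 + t) powr (- real CARD('n) / 2))"
      by (intro set_integrable_mult_right set_integrable_powr_shift) (use n in simp)
    show "set_borel_measurable lborel {0..} (\<lambda>t. W (Complex c t))"
      by (intro set_borel_measurable_lborel_continuous continuous_on_compose2[OF cont])
         (use that in \<open>auto simp: Complex_eq intro!: continuous_intros\<close>)
    show "AE t in lborel. t \<in> {0..} \<longrightarrow> norm (W (Complex c t)) \<le> norm (C * (1 + t) powr (- real CARD('n) / 2))"
      using C[of "Complex c _"] that by (auto intro!: AE_I2 order_trans[OF _ abs_ge_self] simp del: abs_mult)
  qed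
  show "set_integrable lborel {0..} (\<lambda>t. W (Complex 0 t))" by (rule int) auto
  show "(LINT t:{0..1}|lborel. W (of_real t)) + \<i> * (LINT t:{0..}|lborel. W (Complex 1 t))
      = \<i> * (LINT t:{0..}|lborel. W (Complex 0 t))"
  proof (rule half_strip_integral[where b="\<lambda>t. C * (1 + t) powr (- real CARD('n) / 2)"])
    show "continuous_on {z. 0 \<le> Re z \<and> Re z \<le> 1 \<and> 0 \<le> Im z} W"
      by (rule continuous_on_subset[OF cont]) auto
    show "W holomorphic_on {z. 0 < Re z \<and> Re z < 1 \<and> 0 < Im z}"
      unfolding W_def by (rule holomorphic_on_subset[OF aniso_wave_holomorphic]) auto
    have "- real CARD('n) / 2 < 0" using n by simp
    then show "((\<lambda>t. C * (1 + t) powr (- real CARD('n) / 2)) \<longlongrightarrow> 0) at_top"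
      by (intro tendsto_mult_right_zero tendsto_neg_powr filterlim_tendsto_add_at_top[OF tendsto_const filterlim_ident])
  qed (use C int in auto)
qed

text \<open>The solution is taken to be the outgoing one, the convolution with the fundamental
  solution. As the Bochner integral of a non-integrable function is 0, the two integrability claims
  are what give the formula its content. The integrand \<open>g\<close> is pi^(n/2) times
  \<open>aniso_wave\<close> at \<sigma> = \<i> t.\<close>

theorem theorem1:
  fixes M :: nat and \<kappa> :: real and a :: "real^'n" and x :: "real^'n"
  assumes "CARD('n) \<ge> 3"
    and "M \<ge> 1"
    and "\<kappa> > 0"
    and "\<forall>j. a $ j > 0"
  defines "f \<equiv> (\<lambda>y::real^'n. complex_of_real (\<Prod>j\<in>UNIV. eta M (a $ j * y $ j)))"
  defines "g \<equiv> (\<lambda>t::real. exp (\<i> * complex_of_real (\<kappa>^2 * t))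
              * (\<Prod>j\<in>UNIV. PM M (a $ j * x $ j) (4 * \<i> * complex_of_real ((a $ j)^2 * t))
                   * exp (- ((complex_of_real (a $ j * x $ j))^2)
                          / (1 + 4 * \<i> * complex_of_real (t * (a $ j)^2)))))"
  shows "integrable lborel (\<lambda>y. fund_sol CARD('n) \<kappa> (norm (x - y)) * f y)
       \<and> set_integrable lborel {0..} g
       \<and> diffraction_potential \<kappa> f x
           = \<i> * complex_of_real (pi powr (- real CARD('n) / 2)) * (LINT t:{0..}|lborel. g t)"
proof -
  let ?P = "\<lambda>j t. PM M (a $ j * x $ j) (4 * \<i> * complex_of_real ((a $ j)^2 * t))
                   * exp (- ((complex_of_real (a $ j * x $ j))^2)
                          / (1 + 4 * \<i> * complex_of_real (t * (a $ j)^2)))"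
  let ?W = "aniso_wave M (\<kappa>\<^sup>2) a x"
  let ?p = "complex_of_real (pi powr (- real CARD('n) / 2))"
  have k: "\<kappa>\<^sup>2 > 0" using assms(3) by simp
  have p: "?p \<noteq> 0" by simp
  have W: "?W (Complex 0 t) = ?p * g t" for t
  proof -
    have "eta_heat M (a $ j * x $ j) (of_real ((a $ j)\<^sup>2) * Complex 0 t) = of_real (1 / sqrt pi) *
        (?P j t)" for j
    proof -
      have "4 * (of_real ((a $ j)\<^sup>2) * Complex 0 t) = 4 * \<i> * complex_of_real ((a $ j)^2 * t)"
        "4 * (of_real ((a $ j)\<^sup>2) * Complex 0 t) = 4 * \<i> * complex_of_real (t * (a $ j)^2)"
        by (simp_all add: Complex_eq)
      then show ?thesis unfolding eta_heat_def mult.assoc[of "of_real (1 / sqrt pi)"] by metis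
    qed
    then have "?W (Complex 0 t) = exp (of_real (\<kappa>\<^sup>2) * Complex 0 t) * (of_real (1 / sqrt pi) ^ CARD('n) *
       (\<Prod>j\<in>UNIV. ?P j t))"
      unfolding aniso_wave_def by (simp only: prod.distrib prod_constant)
    moreover have "of_real (\<kappa>\<^sup>2) * Complex 0 t = \<i> * complex_of_real (\<kappa>^2 * t)"
      by (simp add: Complex_eq)
    moreover have "complex_of_real (1 / sqrt pi) ^ CARD('n) = ?p"
    proof -
      have "1 / sqrt pi = pi powr (-1/2)" by (simp add: powr_minus powr_half_sqrt field_simps)
      then have "(1 / sqrt pi) ^ CARD('n) = pi powr (- real CARD('n) / 2)" by (simp add: powr_power)
      then show ?thesis by (simp only: of_real_power[symmetric])
    qed
    ultimately show ?thesis unfolding g_def by (simp only: mult_ac)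
  qed
  have "set_integrable lborel {0..} (\<lambda>t. ?p * g t)"
    using aniso_wave_shift(1)[OF assms(1) k assms(4), of M x] unfolding W .
  then have "set_integrable lborel {0..} (\<lambda>t. (1 / ?p) * (?p * g t))"
    by (rule set_integrable_mult_right)
  then have "set_integrable lborel {0..} g" using p by simp
  moreover have "diffraction_potential \<kappa> f x = \<i> * ?p * (LINT t:{0..}|lborel. g t)"
    unfolding diffraction_potential_def f_def fund_sol_convolution(2)[OF assms(1-4)]
      aniso_wave_shift(2)[OF assms(1) k assms(4)] W set_integral_mult_right mult.assoc ..
  ultimately show ?thesis
    using fund_sol_convolution(1)[OF assms(1-4), of x] unfolding f_def by blast
qed

end
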